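(* Let $\mathcal{H}$ be a cocommutative Hopf $K$-algebra with a symmetric partial action on a unital $K$-algebra $A$, and suppose that $\mathcal{H}$ is projective over $K$. Then $(A\#\mathcal{H})^e$ is a projective left $A^e$-module.
   Context: $K$ is a commutative unital ring, $\otimes=\otimes_K$, all algebras are associative unital $K$-algebras. Sweedler notation $\Delta(h)=h_{(1)}\otimes h_{(2)}$ is used. Symmetric partial action: a linear map $\mathcal{H}\otimes A\to A$, $h\otimes a\mapsto h\cdot a$, with $1_{\mathcal{H}}\cdot a=a$; $h\cdot(ab)=(h_{(1)}\cdot a)(h_{(2)}\cdot b)$; $h\cdot(k\cdot a)=(h_{(1)}\cdot 1_A)(h_{(2)}k\cdot a)$; and $h\cdot(k\cdot a)=(h_{(1)}k\cdot a)(h_{(2)}\cdot 1_A)$ (symmetry). Partial smash product: $A\otimes\mathcal{H}$ has the associative product $(a\otimes h)(b\otimes k)=a(h_{(1)}\cdot b)\otimes h_{(2)}k$, and $A\#\mathcal{H}:=(A\otimes\mathcal{H})(1_A\otimes 1_{\mathcal{H}})$, a unital algebra generated by the elements $a\#h:=a(h_{(1)}\cdot 1_A)\otimes h_{(2)}$. For an algebra $R$, $R^e=R\otimes R^{op}$. The algebra homomorphism $\phi_0:A\to A\#\mathcal{H}$, $a\mapsto a\#1_{\mathcal{H}}$, induces an algebra homomorphism $A^e\to(A\#\mathcal{H})^e$, through which $(A\#\mathcal{H})^e$ is a left $A^e$-module. *)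

theory Defs
  imports "HOL-Algebra.Module" "HOL-Algebra.QuotRing"
begin

section \<open>Modules\<close>

text \<open>The library locale \<open>module\<close> is restricted to commutative scalars. Enveloping
  algebras are not commutative, so left modules over an arbitrary ring are needed.\<close>

locale left_module = R?: ring R + M?: abelian_group M
  for R :: "('r, 'c) ring_scheme" (structure) and M :: "('r, 'm, 'd) module_scheme" (structure) +
  assumes smult_closed:
      "\<lbrakk>a \<in> carrier R; x \<in> carrier M\<rbrakk> \<Longrightarrow> a \<odot>\<^bsub>M\<^esub> x \<in> carrier M"
    and smult_l_distr:
      "\<lbrakk>a \<in> carrier R; b \<in> carrier R; x \<in> carrier M\<rbrakk> \<Longrightarrow>
       (a \<oplus>\<^bsub>R\<^esub> b) \<odot>\<^bsub>M\<^esub> x = a \<odot>\<^bsub>M\<^esub> x \<oplus>\<^bsub>M\<^esub> b \<odot>\<^bsub>M\<^esub> x"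
    and smult_r_distr:
      "\<lbrakk>a \<in> carrier R; x \<in> carrier M; y \<in> carrier M\<rbrakk> \<Longrightarrow>
       a \<odot>\<^bsub>M\<^esub> (x \<oplus>\<^bsub>M\<^esub> y) = a \<odot>\<^bsub>M\<^esub> x \<oplus>\<^bsub>M\<^esub> a \<odot>\<^bsub>M\<^esub> y"
    and smult_assoc1:
      "\<lbrakk>a \<in> carrier R; b \<in> carrier R; x \<in> carrier M\<rbrakk> \<Longrightarrow>
       (a \<otimes>\<^bsub>R\<^esub> b) \<odot>\<^bsub>M\<^esub> x = a \<odot>\<^bsub>M\<^esub> (b \<odot>\<^bsub>M\<^esub> x)"
    and smult_one: "x \<in> carrier M \<Longrightarrow> \<one>\<^bsub>R\<^esub> \<odot>\<^bsub>M\<^esub> x = x"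

definition mod_hom ::
  "('r, 'c) ring_scheme \<Rightarrow> ('r, 'm, 'd) module_scheme \<Rightarrow> ('r, 'n, 'e) module_scheme \<Rightarrow> ('m \<Rightarrow> 'n) set"
  where "mod_hom R M N = {f \<in> carrier M \<rightarrow> carrier N.
     (\<forall>x\<in>carrier M. \<forall>y\<in>carrier M. f (x \<oplus>\<^bsub>M\<^esub> y) = f x \<oplus>\<^bsub>N\<^esub> f y) \<and>
     (\<forall>r\<in>carrier R. \<forall>x\<in>carrier M. f (r \<odot>\<^bsub>M\<^esub> x) = r \<odot>\<^bsub>N\<^esub> f x)}"

text \<open>Records that represent plain modules leave \<open>mult\<close> and \<open>one\<close> unspecified. Elements of
  the free module on \<open>X\<close> are the finitely supported functions that vanish outside \<open>X\<close>.\<close>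

definition free_module :: "('r, 'c) ring_scheme \<Rightarrow> 'x set \<Rightarrow> ('r, 'x \<Rightarrow> 'r) module"
  where "free_module R X =
    \<lparr>carrier = {f. f \<in> X \<rightarrow> carrier R \<and> (\<forall>x. x \<notin> X \<longrightarrow> f x = \<zero>\<^bsub>R\<^esub>) \<and> finite {x. f x \<noteq> \<zero>\<^bsub>R\<^esub>}},
     mult = undefined, one = undefined,
     zero = (\<lambda>x. \<zero>\<^bsub>R\<^esub>),
     add = (\<lambda>f g x. f x \<oplus>\<^bsub>R\<^esub> g x),
     smult = (\<lambda>r f x. r \<otimes>\<^bsub>R\<^esub> f x)\<rparr>"

definition free_basis :: "('r, 'c) ring_scheme \<Rightarrow> 'x \<Rightarrow> 'x \<Rightarrow> 'r"
  where "free_basis R x = (\<lambda>y. if y = x then \<one>\<^bsub>R\<^esub> else \<zero>\<^bsub>R\<^esub>)"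

definition lincomb ::
  "('r, 'c) ring_scheme \<Rightarrow> ('r, 'm, 'd) module_scheme \<Rightarrow> ('x \<Rightarrow> 'm) \<Rightarrow> ('x \<Rightarrow> 'r) \<Rightarrow> 'm"
  where "lincomb R M u f = finsum M (\<lambda>x. f x \<odot>\<^bsub>M\<^esub> u x) {x. f x \<noteq> \<zero>\<^bsub>R\<^esub>}"

text \<open>A projective module is a direct summand (up to isomorphism) of a free module, i.e. a
  retract of one. Letting the basis \<open>X\<close> range over subsets of the type of \<open>P\<close> is no
  restriction: a retract of any free module is a retract of the free module on its own
  carrier. The lemmas \<open>projective_module_lift\<close> and \<open>projective_moduleI\<close> below
  give the equivalence with the lifting property.\<close>

definition projective_module :: "('r, 'c) ring_scheme \<Rightarrow> ('r, 'p, 'd) module_scheme \<Rightarrow> bool"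
  where "projective_module R P \<longleftrightarrow> left_module R P \<and>
    (\<exists>X :: 'p set. \<exists>i \<in> mod_hom R P (free_module R X). \<exists>q \<in> mod_hom R (free_module R X) P.
       \<forall>x\<in>carrier P. q (i x) = x)"

lemma (in left_module) smult_l_null:
  assumes "x \<in> carrier M" shows "\<zero>\<^bsub>R\<^esub> \<odot>\<^bsub>M\<^esub> x = \<zero>\<^bsub>M\<^esub>"
proof -
  have "\<zero>\<^bsub>R\<^esub> \<odot>\<^bsub>M\<^esub> x \<oplus>\<^bsub>M\<^esub> \<zero>\<^bsub>R\<^esub> \<odot>\<^bsub>M\<^esub> x = \<zero>\<^bsub>R\<^esub> \<odot>\<^bsub>M\<^esub> x"
    using smult_l_distr[of "\<zero>\<^bsub>R\<^esub>" "\<zero>\<^bsub>R\<^esub>" x] assms by simp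
  then show ?thesis using assms smult_closed by simp
qed

lemma (in left_module) smult_r_null:
  assumes "a \<in> carrier R" shows "a \<odot>\<^bsub>M\<^esub> \<zero>\<^bsub>M\<^esub> = \<zero>\<^bsub>M\<^esub>"
proof -
  have "a \<odot>\<^bsub>M\<^esub> \<zero>\<^bsub>M\<^esub> \<oplus>\<^bsub>M\<^esub> a \<odot>\<^bsub>M\<^esub> \<zero>\<^bsub>M\<^esub> = a \<odot>\<^bsub>M\<^esub> \<zero>\<^bsub>M\<^esub>"
    using smult_r_distr[of a "\<zero>\<^bsub>M\<^esub>" "\<zero>\<^bsub>M\<^esub>"] assms by simp
  then show ?thesis using assms smult_closed by simp
qed

lemma (in left_module) smult_finsum:
  assumes "finite U" "a \<in> carrier R" "u \<in> U \<rightarrow> carrier M"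
  shows "a \<odot>\<^bsub>M\<^esub> finsum M u U = finsum M (\<lambda>x. a \<odot>\<^bsub>M\<^esub> u x) U"
  using assms
  by (induct rule: finite_induct) (auto simp: smult_r_null smult_r_distr smult_closed Pi_def)

lemma free_module_left_module:
  fixes R :: "('r, 'c) ring_scheme" and X :: "'x set"
  assumes "ring R" shows "left_module R (free_module R X)"
proof -
  interpret ring R by fact
  have fin: "finite {x. f x \<oplus>\<^bsub>R\<^esub> g x \<noteq> \<zero>\<^bsub>R\<^esub>}"
    if "finite {x. f x \<noteq> \<zero>\<^bsub>R\<^esub>}" "finite {x. g x \<noteq> \<zero>\<^bsub>R\<^esub>}" for f g :: "'x \<Rightarrow> 'r"
    by (rule finite_subset[OF _ finite_UnI[OF that]]) auto
  have car: "f x \<in> carrier R" if "f \<in> carrier (free_module R X)" for f x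
    using that by (cases "x \<in> X") (auto simp: free_module_def)
  have finm: "finite {x. r \<otimes>\<^bsub>R\<^esub> f x \<noteq> \<zero>\<^bsub>R\<^esub>}"
    if "finite {x. f x \<noteq> \<zero>\<^bsub>R\<^esub>}" "r \<in> carrier R" for r and f :: "'x \<Rightarrow> 'r"
    by (rule finite_subset[OF _ that(1)]) (auto simp: that)
  have ag: "abelian_group (free_module R X)"
  proof (rule abelian_groupI)
    fix f assume f: "f \<in> carrier (free_module R X)"
    have "(\<lambda>x. \<ominus>\<^bsub>R\<^esub> f x) \<in> carrier (free_module R X)"
    proof -
      have "finite {x. \<ominus>\<^bsub>R\<^esub> f x \<noteq> \<zero>\<^bsub>R\<^esub>}"
        by (rule finite_subset[of _ "{x. f x \<noteq> \<zero>\<^bsub>R\<^esub>}"]) (use f in \<open>auto simp: free_module_def\<close>)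
      then show ?thesis using f by (auto simp: free_module_def)
    qed
    moreover have "(\<lambda>x. \<ominus>\<^bsub>R\<^esub> f x) \<oplus>\<^bsub>free_module R X\<^esub> f = \<zero>\<^bsub>free_module R X\<^esub>"
      using car[OF f] by (auto simp: free_module_def l_neg)
    ultimately show "\<exists>g\<in>carrier (free_module R X). g \<oplus>\<^bsub>free_module R X\<^esub> f = \<zero>\<^bsub>free_module R X\<^esub>"
      by blast
  next
    fix f g h assume "f \<in> carrier (free_module R X)" "g \<in> carrier (free_module R X)"
      "h \<in> carrier (free_module R X)"
    then show "f \<oplus>\<^bsub>free_module R X\<^esub> g \<oplus>\<^bsub>free_module R X\<^esub> h =
      f \<oplus>\<^bsub>free_module R X\<^esub> (g \<oplus>\<^bsub>free_module R X\<^esub> h)"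
      using car[of f] car[of g] car[of h] by (simp add: free_module_def fun_eq_iff a_assoc)
  next
    fix f g assume "f \<in> carrier (free_module R X)" "g \<in> carrier (free_module R X)"
    then show "f \<oplus>\<^bsub>free_module R X\<^esub> g = g \<oplus>\<^bsub>free_module R X\<^esub> f"
      using car[of f] car[of g] by (simp add: free_module_def fun_eq_iff a_comm)
  next
    fix f assume "f \<in> carrier (free_module R X)"
    then show "\<zero>\<^bsub>free_module R X\<^esub> \<oplus>\<^bsub>free_module R X\<^esub> f = f"
      using car[of f] by (simp add: free_module_def)
  qed (auto simp: free_module_def fin Pi_def)
  interpret F: abelian_group "free_module R X" by (rule ag)
  show ?thesis
  proof (intro left_module.intro left_module_axioms.intro)
    show "ring R" by fact
    show "abelian_group (free_module R X)" by (rule ag)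
  next
    fix a f assume "a \<in> carrier R" "f \<in> carrier (free_module R X)"
    then show "a \<odot>\<^bsub>free_module R X\<^esub> f \<in> carrier (free_module R X)"
      by (auto simp: free_module_def Pi_def finm)
  next
    fix a b f assume "a \<in> carrier R" "b \<in> carrier R" and f: "f \<in> carrier (free_module R X)"
    then show "(a \<oplus>\<^bsub>R\<^esub> b) \<odot>\<^bsub>free_module R X\<^esub> f =
        a \<odot>\<^bsub>free_module R X\<^esub> f \<oplus>\<^bsub>free_module R X\<^esub> b \<odot>\<^bsub>free_module R X\<^esub> f"
      "(a \<otimes>\<^bsub>R\<^esub> b) \<odot>\<^bsub>free_module R X\<^esub> f =
        a \<odot>\<^bsub>free_module R X\<^esub> (b \<odot>\<^bsub>free_module R X\<^esub> f)"
      using car[OF f] by (auto simp: free_module_def fun_eq_iff l_distr m_assoc)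
  next
    fix a f g assume "a \<in> carrier R" and f: "f \<in> carrier (free_module R X)"
      and g: "g \<in> carrier (free_module R X)"
    then show "a \<odot>\<^bsub>free_module R X\<^esub> (f \<oplus>\<^bsub>free_module R X\<^esub> g) =
        a \<odot>\<^bsub>free_module R X\<^esub> f \<oplus>\<^bsub>free_module R X\<^esub> a \<odot>\<^bsub>free_module R X\<^esub> g"
      using car[OF f] car[OF g] by (auto simp: free_module_def fun_eq_iff r_distr)
  next
    fix f assume f: "f \<in> carrier (free_module R X)"
    then show "\<one>\<^bsub>R\<^esub> \<odot>\<^bsub>free_module R X\<^esub> f = f"
      using car[OF f] by (auto simp: free_module_def fun_eq_iff)
  qed
qed

lemma free_basis_carrier:
  assumes "ring R" "x \<in> X" shows "free_basis R x \<in> carrier (free_module R X)"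
proof -
  interpret ring R by fact
  have "finite {y. free_basis R x y \<noteq> \<zero>\<^bsub>R\<^esub>}"
    by (rule finite_subset[of _ "{x}"]) (auto simp: free_basis_def)
  then show ?thesis using assms(2) by (auto simp: free_module_def free_basis_def)
qed

context left_module
begin

lemma lincomb_superset:
  assumes "u \<in> X \<rightarrow> carrier M" "f \<in> carrier (free_module R X)"
    and "finite U" "U \<subseteq> X" "{x. f x \<noteq> \<zero>\<^bsub>R\<^esub>} \<subseteq> U"
  shows "lincomb R M u f = finsum M (\<lambda>x. f x \<odot>\<^bsub>M\<^esub> u x) U"
  unfolding lincomb_def
proof (rule M.add.finprod_mono_neutral_cong_left)
  show "(\<lambda>x. f x \<odot>\<^bsub>M\<^esub> u x) \<in> U \<rightarrow> carrier M"
    using assms by (auto simp: free_module_def Pi_def intro!: smult_closed)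
  show "\<And>i. i \<in> U - {x. f x \<noteq> \<zero>\<^bsub>R\<^esub>} \<Longrightarrow> f i \<odot>\<^bsub>M\<^esub> u i = \<zero>\<^bsub>M\<^esub>"
    using assms by (auto simp: Pi_def subset_iff intro!: smult_l_null)
qed (use assms in auto)

lemma lincomb_hom:
  assumes u: "u \<in> X \<rightarrow> carrier M"
  shows "lincomb R M u \<in> mod_hom R (free_module R X) M"
proof -
  interpret F: left_module R "free_module R X"
    by (rule free_module_left_module) (rule R.ring_axioms)
  have supp: "finite {x. f x \<noteq> \<zero>\<^bsub>R\<^esub>}" "{x. f x \<noteq> \<zero>\<^bsub>R\<^esub>} \<subseteq> X" "\<And>x. x \<in> X \<Longrightarrow> f x \<in> carrier R"
    if "f \<in> carrier (free_module R X)" for f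
    using that by (auto simp: free_module_def)
  have cl: "(\<lambda>x. f x \<odot>\<^bsub>M\<^esub> u x) \<in> U \<rightarrow> carrier M"
    if "f \<in> carrier (free_module R X)" "U \<subseteq> X" for f U
    using supp(3)[OF that(1)] that(2) u by (auto intro!: smult_closed)
  have "lincomb R M u f \<in> carrier M" if "f \<in> carrier (free_module R X)" for f
    unfolding lincomb_def using cl[OF that supp(2)[OF that]] by (rule M.finsum_closed)
  moreover have "lincomb R M u (f \<oplus>\<^bsub>free_module R X\<^esub> g) = lincomb R M u f \<oplus>\<^bsub>M\<^esub> lincomb R M u g"
    if f: "f \<in> carrier (free_module R X)" and g: "g \<in> carrier (free_module R X)" for f g
  proof -
    let ?U = "{x. f x \<noteq> \<zero>\<^bsub>R\<^esub>} \<union> {x. g x \<noteq> \<zero>\<^bsub>R\<^esub>}"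
    have U: "finite ?U" "?U \<subseteq> X" using supp[OF f] supp[OF g] by auto
    have fg: "f \<oplus>\<^bsub>free_module R X\<^esub> g = (\<lambda>x. f x \<oplus>\<^bsub>R\<^esub> g x)" by (simp add: free_module_def)
    have "lincomb R M u (f \<oplus>\<^bsub>free_module R X\<^esub> g) =
        finsum M (\<lambda>x. (f \<oplus>\<^bsub>free_module R X\<^esub> g) x \<odot>\<^bsub>M\<^esub> u x) ?U"
      by (rule lincomb_superset[OF u _ U]) (use f g in \<open>auto simp: fg[symmetric] intro: F.a_closed\<close>, auto simp: fg)
    also have "\<dots> = finsum M (\<lambda>x. f x \<odot>\<^bsub>M\<^esub> u x \<oplus>\<^bsub>M\<^esub> g x \<odot>\<^bsub>M\<^esub> u x) ?U"
      by (rule M.finsum_cong') (use cl[OF f U(2)] cl[OF g U(2)] supp(3)[OF f] supp(3)[OF g] U u in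
          \<open>auto simp: fg Pi_def subset_iff intro!: smult_l_distr\<close>)
    also have "\<dots> = finsum M (\<lambda>x. f x \<odot>\<^bsub>M\<^esub> u x) ?U \<oplus>\<^bsub>M\<^esub> finsum M (\<lambda>x. g x \<odot>\<^bsub>M\<^esub> u x) ?U"
      by (rule M.finsum_addf) (rule cl[OF f U(2)] cl[OF g U(2)])+
    also have "\<dots> = lincomb R M u f \<oplus>\<^bsub>M\<^esub> lincomb R M u g"
      using lincomb_superset[OF u f U] lincomb_superset[OF u g U] by auto
    finally show ?thesis .
  qed
  moreover have "lincomb R M u (r \<odot>\<^bsub>free_module R X\<^esub> f) = r \<odot>\<^bsub>M\<^esub> lincomb R M u f"
    if r: "r \<in> carrier R" and f: "f \<in> carrier (free_module R X)" for r f
  proof -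
    let ?U = "{x. f x \<noteq> \<zero>\<^bsub>R\<^esub>}"
    have U: "finite ?U" "?U \<subseteq> X" using supp[OF f] by auto
    have rf: "r \<odot>\<^bsub>free_module R X\<^esub> f = (\<lambda>x. r \<otimes>\<^bsub>R\<^esub> f x)" by (simp add: free_module_def)
    have "lincomb R M u (r \<odot>\<^bsub>free_module R X\<^esub> f) =
        finsum M (\<lambda>x. (r \<odot>\<^bsub>free_module R X\<^esub> f) x \<odot>\<^bsub>M\<^esub> u x) ?U"
      by (rule lincomb_superset[OF u F.smult_closed[OF r f] U]) (auto simp: rf r)
    also have "\<dots> = finsum M (\<lambda>x. r \<odot>\<^bsub>M\<^esub> (f x \<odot>\<^bsub>M\<^esub> u x)) ?U"
      by (rule M.finsum_cong') (use cl[OF f U(2)] supp(3)[OF f] U u r in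
          \<open>auto simp: rf Pi_def subset_iff smult_closed intro!: smult_assoc1\<close>)
    also have "\<dots> = r \<odot>\<^bsub>M\<^esub> lincomb R M u f"
      unfolding lincomb_def by (rule smult_finsum[OF U(1) r cl[OF f U(2)], symmetric])
    finally show ?thesis .
  qed
  ultimately show ?thesis by (auto simp: mod_hom_def)
qed

lemma lincomb_basis:
  assumes "u x \<in> carrier M"
  shows "lincomb R M u (free_basis R x) = u x"
proof -
  have "lincomb R M u (free_basis R x) = finsum M (\<lambda>y. free_basis R x y \<odot>\<^bsub>M\<^esub> u y) {x}"
    by (rule lincomb_superset[where X = "{x}"])
      (use assms free_basis_carrier[OF R.ring_axioms, of x "{x}"] in \<open>auto simp: free_basis_def\<close>)
  also have "\<dots> = u x"
    using assms by (simp add: free_basis_def smult_one)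
  finally show ?thesis .
qed

lemma hom_eq_lincomb:
  assumes k: "k \<in> mod_hom R (free_module R X) M" and f: "f \<in> carrier (free_module R X)"
  shows "k f = lincomb R M (\<lambda>x. k (free_basis R x)) f"
proof -
  interpret F: left_module R "free_module R X"
    by (rule free_module_left_module) (rule R.ring_axioms)
  let ?u = "\<lambda>x. k (free_basis R x)"
  have u: "?u \<in> X \<rightarrow> carrier M"
    using k free_basis_carrier[OF R.ring_axioms, of _ X] by (auto simp: mod_hom_def)
  have l: "lincomb R M ?u \<in> mod_hom R (free_module R X) M" by (rule lincomb_hom[OF u])
  have null: "j \<zero>\<^bsub>free_module R X\<^esub> = \<zero>\<^bsub>M\<^esub>" if "j \<in> mod_hom R (free_module R X) M" for j
  proof -
    have "j (\<zero>\<^bsub>R\<^esub> \<odot>\<^bsub>free_module R X\<^esub> \<zero>\<^bsub>free_module R X\<^esub>) = \<zero>\<^bsub>R\<^esub> \<odot>\<^bsub>M\<^esub> j \<zero>\<^bsub>free_module R X\<^esub>"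
      using that by (auto simp: mod_hom_def)
    moreover have "j \<zero>\<^bsub>free_module R X\<^esub> \<in> carrier M" using that by (auto simp: mod_hom_def)
    ultimately show ?thesis by (simp add: F.smult_l_null smult_l_null)
  qed
  have "k f = lincomb R M ?u f" if "finite U" "{x. f x \<noteq> \<zero>\<^bsub>R\<^esub>} \<subseteq> U"
    "f \<in> carrier (free_module R X)" for U f
    using that
  proof (induct arbitrary: f rule: finite_induct)
    case empty
    then have "f = \<zero>\<^bsub>free_module R X\<^esub>" by (auto simp: free_module_def)
    then show ?case using null[OF k] null[OF l] by simp
  next
    case (insert a U)
    show ?case
    proof (cases "a \<in> X")
      case False
      then show ?thesis
        using insert by (intro insert.hyps) (auto simp: free_module_def)
    next
      case True
      let ?g = "f(a := \<zero>\<^bsub>R\<^esub>)"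
      let ?b = "f a \<odot>\<^bsub>free_module R X\<^esub> free_basis R a"
      have "finite {x. ?g x \<noteq> \<zero>\<^bsub>R\<^esub>}"
        by (rule finite_subset[OF _ insert.hyps(1)]) (use insert in auto)
      then have g: "?g \<in> carrier (free_module R X)"
        using insert.prems(2) by (auto simp: free_module_def)
      have fa: "f a \<in> carrier R" and fx: "\<And>x. f x \<in> carrier R"
        using insert.prems(2) True by (auto simp: free_module_def)
      have b: "?b \<in> carrier (free_module R X)"
        by (intro F.smult_closed fa free_basis_carrier True R.ring_axioms)
      have "f = ?g \<oplus>\<^bsub>free_module R X\<^esub> ?b"
        using fx by (auto simp: free_module_def free_basis_def fun_eq_iff)
      then have *: "j f = j ?g \<oplus>\<^bsub>M\<^esub> f a \<odot>\<^bsub>M\<^esub> j (free_basis R a)"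
        if "j \<in> mod_hom R (free_module R X) M" for j
        using that g b fa free_basis_carrier[OF R.ring_axioms True]
        by (smt (verit) mem_Collect_eq mod_hom_def)
      have "k ?g = lincomb R M ?u ?g"
        by (rule insert.hyps(3)[OF _ g]) (use insert.prems in auto)
      moreover have "lincomb R M ?u (free_basis R a) = k (free_basis R a)"
        by (rule lincomb_basis) (use u True in auto)
      ultimately show ?thesis using *[OF k] *[OF l] by simp
    qed
  qed
  from this[of "{x. f x \<noteq> \<zero>\<^bsub>R\<^esub>}" f] show ?thesis
    using f by (auto simp: free_module_def)
qed

end

lemma mod_hom_compose:
  "f \<in> mod_hom R L M \<Longrightarrow> g \<in> mod_hom R M N \<Longrightarrow> (\<lambda>x. g (f x)) \<in> mod_hom R L N"
  by (auto simp: mod_hom_def Pi_def)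

lemma projective_module_lift:
  fixes P :: "('r, 'p, 'd) module_scheme"
  assumes P: "projective_module R P" and M: "left_module R M" and N: "left_module R N"
    and g: "g \<in> mod_hom R M N" "g ` carrier M = carrier N" and f: "f \<in> mod_hom R P N"
  shows "\<exists>h\<in>mod_hom R P M. \<forall>x\<in>carrier P. g (h x) = f x"
proof -
  interpret M: left_module R M by fact
  interpret N: left_module R N by fact
  obtain X :: "'p set" and i q where i: "i \<in> mod_hom R P (free_module R X)"
    and q: "q \<in> mod_hom R (free_module R X) P" and qi: "\<And>x. x \<in> carrier P \<Longrightarrow> q (i x) = x"
    using P unfolding projective_module_def by auto
  have "\<exists>m. m \<in> carrier M \<and> g m = f (q (free_basis R x))" if "x \<in> X" for x
  proof -
    have "f (q (free_basis R x)) \<in> carrier N"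
      using free_basis_carrier[OF M.R.ring_axioms that] q f by (auto simp: mod_hom_def)
    then show ?thesis using g(2) by (metis imageE)
  qed
  then obtain u where u: "\<And>x. x \<in> X \<Longrightarrow> u x \<in> carrier M \<and> g (u x) = f (q (free_basis R x))"
    by metis
  let ?l = "lincomb R M u"
  have l: "?l \<in> mod_hom R (free_module R X) M" by (rule M.lincomb_hom) (use u in auto)
  have gl: "g (?l y) = f (q y)" if y: "y \<in> carrier (free_module R X)" for y
  proof -
    have eq: "finsum N (\<lambda>x. y x \<odot>\<^bsub>N\<^esub> g (?l (free_basis R x))) {x. y x \<noteq> \<zero>\<^bsub>R\<^esub>} =
      finsum N (\<lambda>x. y x \<odot>\<^bsub>N\<^esub> f (q (free_basis R x))) {x. y x \<noteq> \<zero>\<^bsub>R\<^esub>}"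
    proof (rule N.M.finsum_cong')
      fix x assume "x \<in> {x. y x \<noteq> \<zero>\<^bsub>R\<^esub>}"
      then have "x \<in> X" using y by (auto simp: free_module_def)
      then show "y x \<odot>\<^bsub>N\<^esub> g (?l (free_basis R x)) = y x \<odot>\<^bsub>N\<^esub> f (q (free_basis R x))"
        using u by (simp add: M.lincomb_basis)
    next
      show "(\<lambda>x. y x \<odot>\<^bsub>N\<^esub> f (q (free_basis R x))) \<in> {x. y x \<noteq> \<zero>\<^bsub>R\<^esub>} \<rightarrow> carrier N"
      proof
        fix x assume "x \<in> {x. y x \<noteq> \<zero>\<^bsub>R\<^esub>}"
        then have "x \<in> X" "y x \<in> carrier R" using y by (auto simp: free_module_def)
        then show "y x \<odot>\<^bsub>N\<^esub> f (q (free_basis R x)) \<in> carrier N"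
          using free_basis_carrier[OF M.R.ring_axioms, of x X] q f
          by (auto simp: mod_hom_def intro!: N.smult_closed)
      qed
    qed simp
    show ?thesis
      using N.hom_eq_lincomb[OF mod_hom_compose[OF l g(1)] y]
        N.hom_eq_lincomb[OF mod_hom_compose[OF q f] y] eq
      by (simp add: lincomb_def)
  qed
  show ?thesis
  proof (intro bexI ballI)
    show "(\<lambda>x. ?l (i x)) \<in> mod_hom R P M" by (rule mod_hom_compose[OF i l])
    fix x assume x: "x \<in> carrier P"
    then have "i x \<in> carrier (free_module R X)" using i by (auto simp: mod_hom_def)
    then show "g (?l (i x)) = f x" using gl qi[OF x] by simp
  qed
qed

lemma projective_moduleI:
  fixes P :: "('r, 'p, 'd) module_scheme"
  assumes P: "left_module R P"
    and split: "\<And>(M :: ('r, 'p \<Rightarrow> 'r) module) g.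
      \<lbrakk>left_module R M; g \<in> mod_hom R M P; g ` carrier M = carrier P\<rbrakk> \<Longrightarrow>
      \<exists>h\<in>mod_hom R P M. \<forall>x\<in>carrier P. g (h x) = x"
  shows "projective_module R P"
proof -
  interpret P: left_module R P by fact
  let ?F = "free_module R (carrier P)" and ?q = "lincomb R P (\<lambda>x. x)"
  have q: "?q \<in> mod_hom R ?F P" by (rule P.lincomb_hom) auto
  have "?q ` carrier ?F = carrier P"
  proof
    show "?q ` carrier ?F \<subseteq> carrier P" using q by (auto simp: mod_hom_def)
    show "carrier P \<subseteq> ?q ` carrier ?F"
      using P.lincomb_basis[of "\<lambda>x. x"] free_basis_carrier[OF P.R.ring_axioms]
      by (metis image_eqI subsetI)
  qed
  from split[OF free_module_left_module[OF P.R.ring_axioms] q this]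
  show ?thesis unfolding projective_module_def using P q by blast
qed




subsection \<open>Quotients and bilinear maps\<close>

definition quot_module :: "('r, 'm, 'd) module_scheme \<Rightarrow> 'm set \<Rightarrow> ('r, 'm set) module"
  where "quot_module M N =
    \<lparr>carrier = a_rcosets\<^bsub>M\<^esub> N,
     mult = undefined, one = undefined,
     zero = N,
     add = (\<lambda>U V. U <+>\<^bsub>M\<^esub> V),
     smult = (\<lambda>r U. \<Union>x\<in>U. N +>\<^bsub>M\<^esub> (r \<odot>\<^bsub>M\<^esub> x))\<rparr>"

definition generated_submodule ::
  "('r, 'c) ring_scheme \<Rightarrow> ('r, 'm, 'd) module_scheme \<Rightarrow> 'm set \<Rightarrow> 'm set"
  where "generated_submodule R M S = \<Inter>{N. submodule N R M \<and> S \<subseteq> N}"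

definition bilinear_map ::
  "('k, 'c) ring_scheme \<Rightarrow> ('k, 'm, 'd) module_scheme \<Rightarrow> ('k, 'n, 'e) module_scheme \<Rightarrow>
   ('k, 'p, 'f) module_scheme \<Rightarrow> ('m \<Rightarrow> 'n \<Rightarrow> 'p) \<Rightarrow> bool"
  where "bilinear_map K M N P \<beta> \<longleftrightarrow>
    (\<forall>m\<in>carrier M. \<beta> m \<in> mod_hom K N P) \<and> (\<forall>n\<in>carrier N. (\<lambda>m. \<beta> m n) \<in> mod_hom K M P)"


section \<open>Tensor products over a commutative ring\<close>

abbreviation free_pairs ::
  "('k, 'c) ring_scheme \<Rightarrow> ('k, 'm, 'd) module_scheme \<Rightarrow> ('k, 'n, 'e) module_scheme \<Rightarrow>
   ('k, 'm \<times> 'n \<Rightarrow> 'k) module"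
  where "free_pairs K M N \<equiv> free_module K (carrier M \<times> carrier N)"

definition tensor_relations ::
  "('k, 'c) ring_scheme \<Rightarrow> ('k, 'm, 'd) module_scheme \<Rightarrow> ('k, 'n, 'e) module_scheme \<Rightarrow>
   ('m \<times> 'n \<Rightarrow> 'k) set"
  where "tensor_relations K M N =
    (let F = free_pairs K M N; e = (\<lambda>m n. free_basis K (m, n)) in
      {e (m \<oplus>\<^bsub>M\<^esub> m') n \<ominus>\<^bsub>F\<^esub> (e m n \<oplus>\<^bsub>F\<^esub> e m' n) | m m' n.
         m \<in> carrier M \<and> m' \<in> carrier M \<and> n \<in> carrier N} \<union>
      {e m (n \<oplus>\<^bsub>N\<^esub> n') \<ominus>\<^bsub>F\<^esub> (e m n \<oplus>\<^bsub>F\<^esub> e m n') | m n n'.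
         m \<in> carrier M \<and> n \<in> carrier N \<and> n' \<in> carrier N} \<union>
      {e (k \<odot>\<^bsub>M\<^esub> m) n \<ominus>\<^bsub>F\<^esub> k \<odot>\<^bsub>F\<^esub> e m n | k m n.
         k \<in> carrier K \<and> m \<in> carrier M \<and> n \<in> carrier N} \<union>
      {e m (k \<odot>\<^bsub>N\<^esub> n) \<ominus>\<^bsub>F\<^esub> k \<odot>\<^bsub>F\<^esub> e m n | k m n.
         k \<in> carrier K \<and> m \<in> carrier M \<and> n \<in> carrier N})"

definition tensor_null ::
  "('k, 'c) ring_scheme \<Rightarrow> ('k, 'm, 'd) module_scheme \<Rightarrow> ('k, 'n, 'e) module_scheme \<Rightarrow>
   ('m \<times> 'n \<Rightarrow> 'k) set"
  where "tensor_null K M N =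
    generated_submodule K (free_pairs K M N) (tensor_relations K M N)"

definition tensor ::
  "('k, 'c) ring_scheme \<Rightarrow> ('k, 'm, 'd) module_scheme \<Rightarrow> ('k, 'n, 'e) module_scheme \<Rightarrow>
   ('k, ('m \<times> 'n \<Rightarrow> 'k) set) module"
  where "tensor K M N = quot_module (free_pairs K M N) (tensor_null K M N)"

definition pure_tensor ::
  "('k, 'c) ring_scheme \<Rightarrow> ('k, 'm, 'd) module_scheme \<Rightarrow> ('k, 'n, 'e) module_scheme \<Rightarrow>
   'm \<Rightarrow> 'n \<Rightarrow> ('m \<times> 'n \<Rightarrow> 'k) set"
  where "pure_tensor K M N m n =
    tensor_null K M N +>\<^bsub>free_pairs K M N\<^esub> free_basis K (m, n)"

text \<open>\<open>tensor_lift K P \<beta>\<close> is the linear map into \<open>P\<close> with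
  \<open>m \<otimes> n \<mapsto> \<beta> m n\<close>, for a bilinear \<open>\<beta>\<close>; by \<open>tensor_lift_eq\<close>
  below the value does not depend on the chosen representative of the coset \<open>t\<close>. Sweedler notation is
  read through it: an expression \<open>\<beta> h\<^sub>1 h\<^sub>2\<close> with values in \<open>P\<close> is
  \<open>tensor_lift K P \<beta> (\<Delta> h)\<close>.\<close>

definition tensor_lift ::
  "('k, 'c) ring_scheme \<Rightarrow> ('k, 'p, 'f) module_scheme \<Rightarrow> ('m \<Rightarrow> 'n \<Rightarrow> 'p) \<Rightarrow>
   ('m \<times> 'n \<Rightarrow> 'k) set \<Rightarrow> 'p"
  where "tensor_lift K P \<beta> t = lincomb K P (\<lambda>(m, n). \<beta> m n) (SOME f. f \<in> t)"

lemma module_left_module: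
  assumes "module K M" shows "left_module K M"
proof -
  interpret module K M by fact
  show ?thesis
    by (intro left_module.intro left_module_axioms.intro)
      (auto simp: smult_l_distr smult_r_distr smult_assoc1 intro: ring_axioms abelian_group_axioms)
qed

lemma left_module_module:
  assumes "cring K" "left_module K M" shows "module K M"
proof -
  interpret left_module K M by fact
  show ?thesis
    by (rule moduleI) (auto simp: smult_l_distr smult_r_distr smult_assoc1 smult_closed smult_one
        assms(1) intro: M.abelian_group_axioms)
qed

lemma free_module_module: "cring K \<Longrightarrow> module K (free_module K X)"
  by (rule left_module_module) (auto intro: free_module_left_module simp: cring_def)

context
  fixes K :: "('k, 'c) ring_scheme" and M :: "('k, 'm, 'd) module_scheme"
    and N :: "('k, 'n, 'e) module_scheme"
  assumes M: "module K M" and N: "module K N"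
begin

interpretation M: module K M by (rule M)
interpretation N: module K N by (rule N)

interpretation F: module K "free_pairs K M N" by (rule free_module_module) (rule M.R.is_cring)

lemma tensor_relations_carrier: "tensor_relations K M N \<subseteq> carrier (free_pairs K M N)"
proof -
  have "free_basis K (m, n) \<in> carrier (free_pairs K M N)" if "m \<in> carrier M" "n \<in> carrier N" for m n
    using that by (intro free_basis_carrier M.R.ring_axioms) auto
  then show ?thesis
    unfolding tensor_relations_def Let_def by (auto intro!: F.M.minus_closed F.smult_closed)
qed

lemma tensor_null_submodule: "submodule (tensor_null K M N) K (free_pairs K M N)"
proof (rule F.submoduleI)
  have *: "submodule (carrier (free_pairs K M N)) K (free_pairs K M N)" by (rule F.carrier_is_submodule)
  then show "tensor_null K M N \<subseteq> carrier (free_pairs K M N)"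
    using tensor_relations_carrier by (auto simp: tensor_null_def generated_submodule_def)
  have S: "N' \<subseteq> carrier (free_pairs K M N) \<Longrightarrow> \<zero>\<^bsub>free_pairs K M N\<^esub> \<in> N'" if "submodule N' K (free_pairs K M N)" for N'
    using subgroup.one_closed[OF submodule.axioms(1)[OF that]] by simp
  then show "\<zero>\<^bsub>free_pairs K M N\<^esub> \<in> tensor_null K M N"
    by (auto simp: tensor_null_def generated_submodule_def dest: F.submoduleE(1))
qed (auto simp: tensor_null_def generated_submodule_def
      dest: F.submoduleE(3) F.submoduleE(5) F.submoduleE(4))

lemma lincomb_tensor_null:
  assumes P: "module K P" and b: "bilinear_map K M N P \<beta>" and f: "f \<in> tensor_null K M N"
  shows "lincomb K P (\<lambda>(m, n). \<beta> m n) f = \<zero>\<^bsub>P\<^esub>"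
proof -
  interpret P: module K P by fact
  interpret LP: left_module K P by (rule module_left_module[OF P])
  let ?l = "lincomb K P (\<lambda>(m, n). \<beta> m n)"
  have cl: "\<beta> m n \<in> carrier P" if "m \<in> carrier M" "n \<in> carrier N" for m n
    using b that by (auto simp: bilinear_map_def mod_hom_def)
  have hom: "?l \<in> mod_hom K (free_pairs K M N) P" by (rule LP.lincomb_hom) (auto intro: cl)
  have bas: "?l (free_basis K (m, n)) = \<beta> m n" if "m \<in> carrier M" "n \<in> carrier N" for m n
    using LP.lincomb_basis[of "\<lambda>(m, n). \<beta> m n" "(m, n)"] cl[OF that] by simp
  have e: "free_basis K (m, n) \<in> carrier (free_pairs K M N)" if "m \<in> carrier M" "n \<in> carrier N" for m n
    using that by (intro free_basis_carrier M.R.ring_axioms) auto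
  have lc: "?l g \<in> carrier P" if "g \<in> carrier (free_pairs K M N)" for g using hom that by (auto simp: mod_hom_def)
  have la: "?l (g \<oplus>\<^bsub>free_pairs K M N\<^esub> h) = ?l g \<oplus>\<^bsub>P\<^esub> ?l h" if "g \<in> carrier (free_pairs K M N)" "h \<in> carrier (free_pairs K M N)" for g h
    using hom that by (auto simp: mod_hom_def)
  have ls: "?l (k \<odot>\<^bsub>free_pairs K M N\<^esub> g) = k \<odot>\<^bsub>P\<^esub> ?l g" if "k \<in> carrier K" "g \<in> carrier (free_pairs K M N)" for k g
    using hom that by (auto simp: mod_hom_def)
  have lz: "?l \<zero>\<^bsub>free_pairs K M N\<^esub> = \<zero>\<^bsub>P\<^esub>"
    using la[OF F.M.zero_closed F.M.zero_closed] lc[OF F.M.zero_closed]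
    by (metis F.M.l_zero F.M.zero_closed P.M.add.r_cancel_one')
  have li: "?l (\<ominus>\<^bsub>free_pairs K M N\<^esub> g) = \<ominus>\<^bsub>P\<^esub> ?l g" if "g \<in> carrier (free_pairs K M N)" for g
    using la[OF F.M.a_inv_closed[OF that] that] lc[OF that] lc[OF F.M.a_inv_closed[OF that]]
    by (simp add: F.M.l_neg[OF that] lz) (metis P.M.minus_equality)
  have lm: "?l (g \<ominus>\<^bsub>free_pairs K M N\<^esub> h) = \<zero>\<^bsub>P\<^esub>" if "g \<in> carrier (free_pairs K M N)" "h \<in> carrier (free_pairs K M N)" "?l g = ?l h" for g h
    using that la[OF that(1) F.M.a_inv_closed[OF that(2)]] li[OF that(2)] lc[OF that(2)]
    by (simp add: a_minus_def P.M.r_neg)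
  let ?N = "{g \<in> carrier (free_pairs K M N). ?l g = \<zero>\<^bsub>P\<^esub>}"
  have "submodule ?N K (free_pairs K M N)"
    by (rule F.submoduleI) (auto simp: lz li la ls)
  moreover have "tensor_relations K M N \<subseteq> ?N"
  proof
    fix g assume g: "g \<in> tensor_relations K M N"
    have b1: "\<beta> (m \<oplus>\<^bsub>M\<^esub> m') n = \<beta> m n \<oplus>\<^bsub>P\<^esub> \<beta> m' n"
      if "m \<in> carrier M" "m' \<in> carrier M" "n \<in> carrier N" for m m' n
      using b that by (auto simp: bilinear_map_def mod_hom_def)
    have b2: "\<beta> (k \<odot>\<^bsub>M\<^esub> m) n = k \<odot>\<^bsub>P\<^esub> \<beta> m n"
      if "m \<in> carrier M" "n \<in> carrier N" "k \<in> carrier K" for m n k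
      using b that by (auto simp: bilinear_map_def mod_hom_def)
    have b3: "\<beta> m (n \<oplus>\<^bsub>N\<^esub> n') = \<beta> m n \<oplus>\<^bsub>P\<^esub> \<beta> m n'"
      if "m \<in> carrier M" "n \<in> carrier N" "n' \<in> carrier N" for m n n'
      using b that by (auto simp: bilinear_map_def mod_hom_def)
    have b4: "\<beta> m (k \<odot>\<^bsub>N\<^esub> n) = k \<odot>\<^bsub>P\<^esub> \<beta> m n"
      if "m \<in> carrier M" "n \<in> carrier N" "k \<in> carrier K" for m n k
      using b that by (auto simp: bilinear_map_def mod_hom_def)
    from g have "?l g = \<zero>\<^bsub>P\<^esub>"
      unfolding tensor_relations_def Let_def
      by (elim UnE CollectE exE conjE; hypsubst; intro lm)
        (auto intro!: e F.smult_closed F.M.a_closed M.M.a_closed N.M.a_closed M.smult_closed N.smult_closed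
          simp: la ls e bas b1 b2 b3 b4)
    then show "g \<in> ?N" using g tensor_relations_carrier by auto
  qed
  ultimately have "tensor_null K M N \<subseteq> ?N"
    by (auto simp: tensor_null_def generated_submodule_def)
  then show ?thesis using f by auto
qed

lemma tensor_lift_eq:
  assumes P: "module K P" and b: "bilinear_map K M N P \<beta>"
    and t: "t \<in> carrier (tensor K M N)" and f: "f \<in> t"
  shows "tensor_lift K P \<beta> t = lincomb K P (\<lambda>(m, n). \<beta> m n) f"
proof -
  interpret P: module K P by fact
  interpret LP: left_module K P by (rule module_left_module[OF P])
  let ?l = "lincomb K P (\<lambda>(m, n). \<beta> m n)"
  have "\<beta> m n \<in> carrier P" if "m \<in> carrier M" "n \<in> carrier N" for m n
    using b that by (auto simp: bilinear_map_def mod_hom_def)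
  then have hom: "?l \<in> mod_hom K (free_pairs K M N) P" by (intro LP.lincomb_hom) auto
  obtain g where g: "g \<in> carrier (free_pairs K M N)" "t = tensor_null K M N +>\<^bsub>free_pairs K M N\<^esub> g"
    using t by (auto simp: tensor_def quot_module_def A_RCOSETS_def')
  have *: "?l h = ?l g" if "h \<in> t" for h
  proof -
    obtain z where z: "z \<in> tensor_null K M N" "h = z \<oplus>\<^bsub>free_pairs K M N\<^esub> g"
      using \<open>h \<in> t\<close> g(2) by (auto simp: a_r_coset_def')
    moreover have "z \<in> carrier (free_pairs K M N)" using z(1) F.submoduleE(1)[OF tensor_null_submodule] by auto
    ultimately have "?l h = ?l z \<oplus>\<^bsub>P\<^esub> ?l g" using hom g(1) by (auto simp: mod_hom_def)
    moreover have "?l g \<in> carrier P" using hom g(1) unfolding mod_hom_def by blast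
    ultimately show ?thesis
      using lincomb_tensor_null[OF P b z(1)] by simp
  qed
  have "tensor_lift K P \<beta> t = ?l (SOME f. f \<in> t)"
    by (simp add: tensor_lift_def)
  also have "\<dots> = ?l f" using *[OF f] *[OF someI[of "\<lambda>f. f \<in> t", OF f]] by simp
  finally show ?thesis .
qed

lemma tensor_lift_pure_tensor:
  assumes P: "module K P" and b: "bilinear_map K M N P \<beta>" and m: "m \<in> carrier M" and n: "n \<in> carrier N"
  shows "tensor_lift K P \<beta> (pure_tensor K M N m n) = \<beta> m n"
proof -
  interpret LP: left_module K P by (rule module_left_module[OF P])
  have e: "free_basis K (m, n) \<in> carrier (free_pairs K M N)"
    using m n by (intro free_basis_carrier M.R.ring_axioms) auto
  have "pure_tensor K M N m n \<in> carrier (tensor K M N)"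
    using e by (auto simp: pure_tensor_def tensor_def quot_module_def A_RCOSETS_def')
  moreover have "free_basis K (m, n) \<in> pure_tensor K M N m n"
  proof -
    have "\<zero>\<^bsub>free_pairs K M N\<^esub> \<in> tensor_null K M N"
      using subgroup.one_closed[OF submodule.axioms(1)[OF tensor_null_submodule]] by simp
    then show ?thesis
      using e unfolding pure_tensor_def a_r_coset_def' by (auto intro!: bexI[of _ "\<zero>\<^bsub>free_pairs K M N\<^esub>"])
  qed
  moreover have "\<beta> m n \<in> carrier P"
    using b m n by (auto simp: bilinear_map_def mod_hom_def)
  ultimately show ?thesis
    using LP.lincomb_basis[of "\<lambda>(m, n). \<beta> m n" "(m, n)"] tensor_lift_eq[OF P b] by simp
qed

end

text \<open>In \<open>tensor_map\<close> the modules \<open>M\<close> and \<open>N\<close> are the codomains of \<open>f\<close> and \<open>g\<close>.\<close>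

definition tensor_map ::
  "('k, 'c) ring_scheme \<Rightarrow> ('k, 'm, 'd) module_scheme \<Rightarrow> ('k, 'n, 'e) module_scheme \<Rightarrow>
   ('a \<Rightarrow> 'm) \<Rightarrow> ('b \<Rightarrow> 'n) \<Rightarrow> ('a \<times> 'b \<Rightarrow> 'k) set \<Rightarrow> ('m \<times> 'n \<Rightarrow> 'k) set"
  where "tensor_map K M N f g =
    tensor_lift K (tensor K M N) (\<lambda>a b. pure_tensor K M N (f a) (g b))"

definition tensor_flip ::
  "('k, 'c) ring_scheme \<Rightarrow> ('k, 'm, 'd) module_scheme \<Rightarrow> ('k, 'n, 'e) module_scheme \<Rightarrow>
   ('m \<times> 'n \<Rightarrow> 'k) set \<Rightarrow> ('n \<times> 'm \<Rightarrow> 'k) set"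
  where "tensor_flip K M N =
    tensor_lift K (tensor K N M) (\<lambda>m n. pure_tensor K N M n m)"

definition tensor_assoc ::
  "('k, 'c) ring_scheme \<Rightarrow> ('k, 'l, 'd) module_scheme \<Rightarrow> ('k, 'm, 'e) module_scheme \<Rightarrow>
   ('k, 'n, 'f) module_scheme \<Rightarrow> (('l \<times> 'm \<Rightarrow> 'k) set \<times> 'n \<Rightarrow> 'k) set \<Rightarrow>
   ('l \<times> ('m \<times> 'n \<Rightarrow> 'k) set \<Rightarrow> 'k) set"
  where "tensor_assoc K L M N =
    (let T = tensor K L (tensor K M N)
     in tensor_lift K T (\<lambda>s n. tensor_lift K T
          (\<lambda>l m. pure_tensor K L (tensor K M N) l (pure_tensor K M N m n)) s))"


section \<open>Associative unital algebras\<close>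

text \<open>The library locale \<open>algebra\<close> requires a commutative multiplication.\<close>

locale unital_algebra = module K A + A: ring A
  for K :: "('k, 'c) ring_scheme" (structure) and A :: "('k, 'a, 'd) module_scheme" (structure) +
  assumes smult_mult_left:
      "\<lbrakk>k \<in> carrier K; x \<in> carrier A; y \<in> carrier A\<rbrakk> \<Longrightarrow>
       (k \<odot>\<^bsub>A\<^esub> x) \<otimes>\<^bsub>A\<^esub> y = k \<odot>\<^bsub>A\<^esub> (x \<otimes>\<^bsub>A\<^esub> y)"
    and smult_mult_right:
      "\<lbrakk>k \<in> carrier K; x \<in> carrier A; y \<in> carrier A\<rbrakk> \<Longrightarrow>
       x \<otimes>\<^bsub>A\<^esub> (k \<odot>\<^bsub>A\<^esub> y) = k \<odot>\<^bsub>A\<^esub> (x \<otimes>\<^bsub>A\<^esub> y)"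

definition alg_hom ::
  "('k, 'c) ring_scheme \<Rightarrow> ('k, 'a, 'd) module_scheme \<Rightarrow> ('k, 'b, 'e) module_scheme \<Rightarrow> ('a \<Rightarrow> 'b) set"
  where "alg_hom K A B = ring_hom A B \<inter> mod_hom K A B"

definition ground_algebra :: "('k, 'c) ring_scheme \<Rightarrow> ('k, 'k) module"
  where "ground_algebra K =
    \<lparr>carrier = carrier K, mult = mult K, one = one K, zero = zero K, add = add K, smult = mult K\<rparr>"

definition opposite_algebra :: "('k, 'a, 'd) module_scheme \<Rightarrow> ('k, 'a, 'd) module_scheme"
  where "opposite_algebra A = A\<lparr>mult := (\<lambda>x y. y \<otimes>\<^bsub>A\<^esub> x)\<rparr>"

definition tensor_algebra ::
  "('k, 'c) ring_scheme \<Rightarrow> ('k, 'a, 'd) module_scheme \<Rightarrow> ('k, 'b, 'e) module_scheme \<Rightarrow>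
   ('k, ('a \<times> 'b \<Rightarrow> 'k) set) module"
  where "tensor_algebra K A B = (let T = tensor K A B in
    T\<lparr>mult := (\<lambda>s t. tensor_lift K T (\<lambda>a b. tensor_lift K T
                (\<lambda>a' b'. pure_tensor K A B (a \<otimes>\<^bsub>A\<^esub> a') (b \<otimes>\<^bsub>B\<^esub> b')) t) s),
      one := pure_tensor K A B \<one>\<^bsub>A\<^esub> \<one>\<^bsub>B\<^esub>\<rparr>)"

definition enveloping_algebra ::
  "('k, 'c) ring_scheme \<Rightarrow> ('k, 'a, 'd) module_scheme \<Rightarrow> ('k, ('a \<times> 'a \<Rightarrow> 'k) set) module"
  where "enveloping_algebra K A = tensor_algebra K A (opposite_algebra A)"

text \<open>An algebra \<open>B\<close> as a left module along a ring homomorphism \<open>\<phi>\<close> into it.\<close>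

definition module_along :: "('r \<Rightarrow> 'b) \<Rightarrow> ('b, 'd) ring_scheme \<Rightarrow> ('r, 'b) module"
  where "module_along \<phi> B =
    \<lparr>carrier = carrier B, mult = mult B, one = one B, zero = zero B, add = add B,
     smult = (\<lambda>r x. \<phi> r \<otimes>\<^bsub>B\<^esub> x)\<rparr>"


section \<open>Hopf algebras and partial actions\<close>

locale hopf_algebra = unital_algebra K H
  for K :: "('k, 'c) ring_scheme" (structure) and H :: "('k, 'h, 'd) module_scheme" (structure) +
  fixes \<Delta> :: "'h \<Rightarrow> ('h \<times> 'h \<Rightarrow> 'k) set" and \<epsilon> :: "'h \<Rightarrow> 'k" and S :: "'h \<Rightarrow> 'h"
  assumes comult_hom: "\<Delta> \<in> alg_hom K H (tensor_algebra K H H)"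
    and counit_hom: "\<epsilon> \<in> alg_hom K H (ground_algebra K)"
    and coassoc: "h \<in> carrier H \<Longrightarrow>
        tensor_assoc K H H H (tensor_map K (tensor K H H) H \<Delta> id (\<Delta> h)) =
        tensor_map K H (tensor K H H) id \<Delta> (\<Delta> h)"
    and counit_left: "h \<in> carrier H \<Longrightarrow> tensor_lift K H (\<lambda>x y. \<epsilon> x \<odot>\<^bsub>H\<^esub> y) (\<Delta> h) = h"
    and counit_right: "h \<in> carrier H \<Longrightarrow> tensor_lift K H (\<lambda>x y. \<epsilon> y \<odot>\<^bsub>H\<^esub> x) (\<Delta> h) = h"
    and antipode_linear: "S \<in> mod_hom K H H"
    and antipode_left: "h \<in> carrier H \<Longrightarrow>
        tensor_lift K H (\<lambda>x y. S x \<otimes>\<^bsub>H\<^esub> y) (\<Delta> h) = \<epsilon> h \<odot>\<^bsub>H\<^esub> \<one>\<^bsub>H\<^esub>"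
    and antipode_right: "h \<in> carrier H \<Longrightarrow>
        tensor_lift K H (\<lambda>x y. x \<otimes>\<^bsub>H\<^esub> S y) (\<Delta> h) = \<epsilon> h \<odot>\<^bsub>H\<^esub> \<one>\<^bsub>H\<^esub>"

locale cocommutative_hopf_algebra = hopf_algebra +
  assumes cocommutative: "h \<in> carrier H \<Longrightarrow> tensor_flip K H H (\<Delta> h) = \<Delta> h"

text \<open>The linear map from the tensor product of \<open>H\<close> and \<open>A\<close> to \<open>A\<close> is given as the
  corresponding bilinear map \<open>act\<close>.\<close>

locale symmetric_partial_action = H: hopf_algebra K H \<Delta> \<epsilon> S + A: unital_algebra K A
  for K :: "('k, 'c) ring_scheme" and H :: "('k, 'h, 'd) module_scheme" and \<Delta> and \<epsilon> and S
    and A :: "('k, 'a, 'e) module_scheme" +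
  fixes act :: "'h \<Rightarrow> 'a \<Rightarrow> 'a"
  assumes act_bilinear: "bilinear_map K H A A act"
    and act_one: "a \<in> carrier A \<Longrightarrow> act \<one>\<^bsub>H\<^esub> a = a"
    and act_mult: "\<lbrakk>h \<in> carrier H; a \<in> carrier A; b \<in> carrier A\<rbrakk> \<Longrightarrow>
        act h (a \<otimes>\<^bsub>A\<^esub> b) = tensor_lift K A (\<lambda>x y. act x a \<otimes>\<^bsub>A\<^esub> act y b) (\<Delta> h)"
    and act_act: "\<lbrakk>h \<in> carrier H; k \<in> carrier H; a \<in> carrier A\<rbrakk> \<Longrightarrow>
        act h (act k a) =
        tensor_lift K A (\<lambda>x y. act x \<one>\<^bsub>A\<^esub> \<otimes>\<^bsub>A\<^esub> act (y \<otimes>\<^bsub>H\<^esub> k) a) (\<Delta> h)"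
    and act_act_symmetric: "\<lbrakk>h \<in> carrier H; k \<in> carrier H; a \<in> carrier A\<rbrakk> \<Longrightarrow>
        act h (act k a) =
        tensor_lift K A (\<lambda>x y. act (x \<otimes>\<^bsub>H\<^esub> k) a \<otimes>\<^bsub>A\<^esub> act y \<one>\<^bsub>A\<^esub>) (\<Delta> h)"


section \<open>The partial smash product\<close>

text \<open>The product \<open>(a \<otimes> h) (b \<otimes> k) = a (h\<^sub>1 \<cdot> b) \<otimes> h\<^sub>2 k\<close>;
  it has no two-sided unit in general.\<close>

definition smash_tensor ::
  "('k, 'c) ring_scheme \<Rightarrow> ('k, 'h, 'd) module_scheme \<Rightarrow> ('h \<Rightarrow> ('h \<times> 'h \<Rightarrow> 'k) set) \<Rightarrow>
   ('k, 'a, 'e) module_scheme \<Rightarrow> ('h \<Rightarrow> 'a \<Rightarrow> 'a) \<Rightarrow> ('k, ('a \<times> 'h \<Rightarrow> 'k) set) module"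
  where "smash_tensor K H \<Delta> A act = (let T = tensor K A H in
    T\<lparr>mult := (\<lambda>s t. tensor_lift K T (\<lambda>a h. tensor_lift K T (\<lambda>b k. tensor_lift K T
        (\<lambda>x y. pure_tensor K A H (a \<otimes>\<^bsub>A\<^esub> act x b) (y \<otimes>\<^bsub>H\<^esub> k)) (\<Delta> h)) t) s)\<rparr>)"

definition smash_elem ::
  "('k, 'c) ring_scheme \<Rightarrow> ('k, 'h, 'd) module_scheme \<Rightarrow> ('h \<Rightarrow> ('h \<times> 'h \<Rightarrow> 'k) set) \<Rightarrow>
   ('k, 'a, 'e) module_scheme \<Rightarrow> ('h \<Rightarrow> 'a \<Rightarrow> 'a) \<Rightarrow> 'a \<Rightarrow> 'h \<Rightarrow> ('a \<times> 'h \<Rightarrow> 'k) set"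
  where "smash_elem K H \<Delta> A act a h =
    tensor_lift K (tensor K A H) (\<lambda>x y. pure_tensor K A H (a \<otimes>\<^bsub>A\<^esub> act x \<one>\<^bsub>A\<^esub>) y) (\<Delta> h)"

definition partial_smash ::
  "('k, 'c) ring_scheme \<Rightarrow> ('k, 'h, 'd) module_scheme \<Rightarrow> ('h \<Rightarrow> ('h \<times> 'h \<Rightarrow> 'k) set) \<Rightarrow>
   ('k, 'a, 'e) module_scheme \<Rightarrow> ('h \<Rightarrow> 'a \<Rightarrow> 'a) \<Rightarrow> ('k, ('a \<times> 'h \<Rightarrow> 'k) set) module"
  where "partial_smash K H \<Delta> A act =
    (let T = smash_tensor K H \<Delta> A act; e = pure_tensor K A H \<one>\<^bsub>A\<^esub> \<one>\<^bsub>H\<^esub>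
     in T\<lparr>carrier := {t \<otimes>\<^bsub>T\<^esub> e | t. t \<in> carrier T}, one := smash_elem K H \<Delta> A act \<one>\<^bsub>A\<^esub> \<one>\<^bsub>H\<^esub>\<rparr>)"

definition smash_incl ::
  "('k, 'c) ring_scheme \<Rightarrow> ('k, 'h, 'd) module_scheme \<Rightarrow> ('h \<Rightarrow> ('h \<times> 'h \<Rightarrow> 'k) set) \<Rightarrow>
   ('k, 'a, 'e) module_scheme \<Rightarrow> ('h \<Rightarrow> 'a \<Rightarrow> 'a) \<Rightarrow> 'a \<Rightarrow> ('a \<times> 'h \<Rightarrow> 'k) set"
  where "smash_incl K H \<Delta> A act a = smash_elem K H \<Delta> A act a \<one>\<^bsub>H\<^esub>"

text \<open>The homomorphism of enveloping algebras induced by \<open>smash_incl\<close>.\<close>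

definition smash_incl_env ::
  "('k, 'c) ring_scheme \<Rightarrow> ('k, 'h, 'd) module_scheme \<Rightarrow> ('h \<Rightarrow> ('h \<times> 'h \<Rightarrow> 'k) set) \<Rightarrow>
   ('k, 'a, 'e) module_scheme \<Rightarrow> ('h \<Rightarrow> 'a \<Rightarrow> 'a) \<Rightarrow> ('a \<times> 'a \<Rightarrow> 'k) set \<Rightarrow>
   (('a \<times> 'h \<Rightarrow> 'k) set \<times> ('a \<times> 'h \<Rightarrow> 'k) set \<Rightarrow> 'k) set"
  where "smash_incl_env K H \<Delta> A act =
    (let B = partial_smash K H \<Delta> A act
     in tensor_map K B (opposite_algebra B) (smash_incl K H \<Delta> A act) (smash_incl K H \<Delta> A act))"

end

theory Submission
  imports Defs
begin

text \<open>Write \<open>B = A # H\<close>. An element \<open>a \<otimes> a'\<close> of the enveloping algebra of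
  \<open>A\<close> acts on \<open>B \<otimes> B\<^sup>o\<^sup>p\<close> by left multiplication with
  \<open>a # 1\<close> in the first factor and by right multiplication with \<open>a' # 1\<close> in the second.
  Retractions of free modules can be tensored, so it is enough that \<open>B\<close> is projective both as
  a left and as a right \<open>A\<close>-module (\<open>projective_tensor_algebra\<close>).

  Since \<open>H\<close> is projective over \<open>K\<close>, the tensor product \<open>A \<otimes> H\<close> is
  projective over \<open>A\<close> for left multiplication in the first factor and over
  \<open>A\<^sup>o\<^sup>p\<close> for right multiplication (\<open>projective_base_change\<close>, applied to
  \<open>A\<close> and to its opposite). It remains to exhibit \<open>B\<close> as a retract in both cases.

  On the left, right multiplication with \<open>e = 1 \<otimes> 1\<close> is an idempotent
  \<open>A\<close>-linear map of \<open>A \<otimes> H\<close> with image \<open>B\<close>.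

  On the right, the map \<open>a \<otimes> h \<mapsto> (1 \<otimes> h) (a \<otimes> 1) = h\<^sub>1 \<cdot> a \<otimes> h\<^sub>2\<close>
  from \<open>A \<otimes> H\<close> to \<open>B\<close>, called \<open>twist\<close>, is right
  \<open>A\<close>-linear. Its section is the restriction to \<open>B\<close> of \<open>untwist\<close>,
  \<open>a \<otimes> h \<mapsto> S h\<^sub>1 \<cdot> a \<otimes> h\<^sub>2\<close>. Two identities make this work:

    \<^item> \<open>S h\<^sub>1 \<cdot> (b (h\<^sub>2 \<cdot> a)) = (S h \<cdot> b) a\<close>, so that \<open>untwist\<close> is
      right \<open>A\<close>-linear;
    \<^item> \<open>h\<^sub>2 \<cdot> (S h\<^sub>1 \<cdot> a) = a (h \<cdot> 1)\<close>, so that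
      \<open>twist \<circ> untwist\<close> is multiplication with \<open>e\<close>.

  The first rests on \<open>\<Delta> (S h) = S h\<^sub>1 \<otimes> S h\<^sub>2\<close>, valid by cocommutativity; the
  second on the symmetry axiom of the action and cocommutativity.

  All identities in Sweedler notation are equations between iterated lifts of multilinear maps;
  coassociativity and the other axioms become rewrite rules for such lifts once multilinearity is
  checked, which follows the syntax of the terms.\<close>

section \<open>Linear maps\<close>

lemma mod_homI:
  assumes "\<And>x. x \<in> carrier M \<Longrightarrow> f x \<in> carrier N"
    and "\<And>x y. \<lbrakk>x \<in> carrier M; y \<in> carrier M\<rbrakk> \<Longrightarrow> f (x \<oplus>\<^bsub>M\<^esub> y) = f x \<oplus>\<^bsub>N\<^esub> f y"
    and "\<And>r x. \<lbrakk>r \<in> carrier R; x \<in> carrier M\<rbrakk> \<Longrightarrow> f (r \<odot>\<^bsub>M\<^esub> x) = r \<odot>\<^bsub>N\<^esub> f x"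
  shows "f \<in> mod_hom R M N"
  using assms by (auto simp: mod_hom_def)

lemma mod_hom_closed: "f \<in> mod_hom R M N \<Longrightarrow> x \<in> carrier M \<Longrightarrow> f x \<in> carrier N"
  and mod_hom_add: "f \<in> mod_hom R M N \<Longrightarrow> x \<in> carrier M \<Longrightarrow> y \<in> carrier M \<Longrightarrow>
    f (x \<oplus>\<^bsub>M\<^esub> y) = f x \<oplus>\<^bsub>N\<^esub> f y"
  and mod_hom_smult: "f \<in> mod_hom R M N \<Longrightarrow> r \<in> carrier R \<Longrightarrow> x \<in> carrier M \<Longrightarrow>
    f (r \<odot>\<^bsub>M\<^esub> x) = r \<odot>\<^bsub>N\<^esub> f x"
  by (auto simp: mod_hom_def)

lemma mod_hom_zero:
  assumes "left_module R M" "left_module R N" "f \<in> mod_hom R M N"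
  shows "f \<zero>\<^bsub>M\<^esub> = \<zero>\<^bsub>N\<^esub>"
proof -
  interpret M: left_module R M by fact
  interpret N: left_module R N by fact
  have "f (\<zero>\<^bsub>R\<^esub> \<odot>\<^bsub>M\<^esub> \<zero>\<^bsub>M\<^esub>) = \<zero>\<^bsub>R\<^esub> \<odot>\<^bsub>N\<^esub> f \<zero>\<^bsub>M\<^esub>"
    by (intro mod_hom_smult[OF assms(3)]) auto
  then show ?thesis
    using mod_hom_closed[OF assms(3)] by (simp add: M.smult_l_null N.smult_l_null)
qed

lemma mod_hom_finsum:
  assumes "left_module R M" "left_module R N" "f \<in> mod_hom R M N" "u \<in> U \<rightarrow> carrier M"
  shows "f (finsum M u U) = finsum N (\<lambda>x. f (u x)) U"
proof -
  interpret M: left_module R M by fact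
  interpret N: left_module R N by fact
  show ?thesis
    using assms(4)
  proof (induct U rule: infinite_finite_induct)
    case (insert x U)
    then have "u \<in> U \<rightarrow> carrier M" "u x \<in> carrier M" by auto
    with insert show ?case
      by (subst M.M.finsum_insert N.M.finsum_insert;
          auto simp: mod_hom_add[OF assms(3)] intro!: mod_hom_closed[OF assms(3)])+
  qed (auto simp: mod_hom_zero[OF assms(1-3)])
qed

lemma mod_hom_lincomb:
  assumes "left_module R M" "left_module R N" "f \<in> mod_hom R M N"
    and "u \<in> X \<rightarrow> carrier M" "c \<in> carrier (free_module R X)"
  shows "f (lincomb R M u c) = lincomb R N (\<lambda>x. f (u x)) c"
proof -
  interpret M: left_module R M by fact
  interpret N: left_module R N by fact
  have *: "u x \<in> carrier M" "c x \<in> carrier R" if "c x \<noteq> \<zero>\<^bsub>R\<^esub>" for x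
    using that assms(4,5) by (auto simp: free_module_def)
  have "f (lincomb R M u c) = finsum N (\<lambda>x. f (c x \<odot>\<^bsub>M\<^esub> u x)) {x. c x \<noteq> \<zero>\<^bsub>R\<^esub>}"
    unfolding lincomb_def
    by (rule mod_hom_finsum[OF assms(1-3)]) (use * in \<open>auto intro!: M.smult_closed\<close>)
  also have "\<dots> = lincomb R N (\<lambda>x. f (u x)) c"
    unfolding lincomb_def
    by (rule N.M.finsum_cong')
      (use * in \<open>auto simp: mod_hom_smult[OF assms(3)]
        intro!: N.smult_closed mod_hom_closed[OF assms(3)]\<close>)
  finally show ?thesis .
qed

text \<open>The rules in \<open>lin\<close> establish linearity of a term in one of its variables by following
  the term's structure. A variable of a multilinear term occurs exactly once, so at most one rule
  applies at each step and \<open>intro\<close> finds the proof without search.\<close>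

named_theorems lin

lemma mod_hom_id [lin]: "(\<lambda>x. x) \<in> mod_hom R M M"
  by (auto simp: mod_hom_def)

lemma bilinear_mapI [lin]:
  assumes "\<And>m. m \<in> carrier M \<Longrightarrow> (\<lambda>n. \<beta> m n) \<in> mod_hom K N P"
    and "\<And>n. n \<in> carrier N \<Longrightarrow> (\<lambda>m. \<beta> m n) \<in> mod_hom K M P"
  shows "bilinear_map K M N P \<beta>"
  using assms by (auto simp: bilinear_map_def)

lemma bilinear_map_left: "bilinear_map K M N P \<beta> \<Longrightarrow> n \<in> carrier N \<Longrightarrow> (\<lambda>m. \<beta> m n) \<in> mod_hom K M P"
  and bilinear_map_right: "bilinear_map K M N P \<beta> \<Longrightarrow> m \<in> carrier M \<Longrightarrow> \<beta> m \<in> mod_hom K N P"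
  by (auto simp: bilinear_map_def)

lemma bilinear_map_closed:
  "bilinear_map K M N P \<beta> \<Longrightarrow> m \<in> carrier M \<Longrightarrow> n \<in> carrier N \<Longrightarrow> \<beta> m n \<in> carrier P"
  by (auto simp: bilinear_map_def mod_hom_def)

lemma mod_hom_smult_linear [lin]:
  assumes "module K P" "r \<in> carrier K" "f \<in> mod_hom K M P"
  shows "(\<lambda>x. r \<odot>\<^bsub>P\<^esub> f x) \<in> mod_hom K M P"
proof -
  interpret P: module K P by fact
  show ?thesis
    using assms(2,3) mod_hom_closed[OF assms(3)]
    by (auto intro!: mod_homI simp: mod_hom_add mod_hom_smult P.smult_r_distr
        P.smult_assoc1[symmetric] P.R.m_comm)
qed

text \<open>For scalars that depend on the variable, such as values of the counit.\<close>

lemma mod_hom_scalar_linear [lin]: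
  assumes "module K P" "y \<in> carrier P" "f \<in> mod_hom K M (ground_algebra K)"
  shows "(\<lambda>x. f x \<odot>\<^bsub>P\<^esub> y) \<in> mod_hom K M P"
proof -
  interpret P: module K P by fact
  show ?thesis
    using assms(2,3) mod_hom_closed[OF assms(3)]
    by (auto intro!: mod_homI simp: mod_hom_add mod_hom_smult P.smult_l_distr
        P.smult_assoc1[symmetric] ground_algebra_def)
qed

section \<open>Tensor products\<close>

lemma
  assumes M: "module K M" and N: "submodule N K M"
  shows abelian_subgroup_submodule: "abelian_subgroup N M"
    and quot_module_carrier: "carrier (quot_module M N) = (\<lambda>x. N +>\<^bsub>M\<^esub> x) ` carrier M"
    and quot_module_add: "\<lbrakk>x \<in> carrier M; y \<in> carrier M\<rbrakk> \<Longrightarrow>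
      (N +>\<^bsub>M\<^esub> x) \<oplus>\<^bsub>quot_module M N\<^esub> (N +>\<^bsub>M\<^esub> y) = N +>\<^bsub>M\<^esub> (x \<oplus>\<^bsub>M\<^esub> y)"
    and quot_module_smult: "\<lbrakk>r \<in> carrier K; x \<in> carrier M\<rbrakk> \<Longrightarrow>
      r \<odot>\<^bsub>quot_module M N\<^esub> (N +>\<^bsub>M\<^esub> x) = N +>\<^bsub>M\<^esub> (r \<odot>\<^bsub>M\<^esub> x)"
    and quot_module_module: "module K (quot_module M N)"
proof -
  interpret M: module K M by (rule M)
  interpret S: submodule N K M by (rule N)
  have ag: "abelian_group M" by (rule M.abelian_group_axioms)
  interpret A: abelian_subgroup N M
    by (rule abelian_subgroupI3)
      (auto simp: additive_subgroup_def intro: ag S.subgroup_axioms)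
  show "abelian_subgroup N M" by (rule A.abelian_subgroup_axioms)
  show car: "carrier (quot_module M N) = (\<lambda>x. N +>\<^bsub>M\<^esub> x) ` carrier M"
    by (auto simp: quot_module_def A_RCOSETS_def')
  have add: "(N +>\<^bsub>M\<^esub> x) \<oplus>\<^bsub>quot_module M N\<^esub> (N +>\<^bsub>M\<^esub> y) = N +>\<^bsub>M\<^esub> (x \<oplus>\<^bsub>M\<^esub> y)"
    if "x \<in> carrier M" "y \<in> carrier M" for x y
    using that by (simp add: quot_module_def A.a_rcos_sum)
  then show "\<lbrakk>x \<in> carrier M; y \<in> carrier M\<rbrakk> \<Longrightarrow>
      (N +>\<^bsub>M\<^esub> x) \<oplus>\<^bsub>quot_module M N\<^esub> (N +>\<^bsub>M\<^esub> y) = N +>\<^bsub>M\<^esub> (x \<oplus>\<^bsub>M\<^esub> y)" .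
  have eq: "N +>\<^bsub>M\<^esub> (r \<odot>\<^bsub>M\<^esub> z) = N +>\<^bsub>M\<^esub> (r \<odot>\<^bsub>M\<^esub> x)"
    if r: "r \<in> carrier K" and x: "x \<in> carrier M" and z: "z \<in> N +>\<^bsub>M\<^esub> x" for r x z
  proof -
    obtain n where n: "n \<in> N" "z = n \<oplus>\<^bsub>M\<^esub> x" using z by (auto simp: a_r_coset_def')
    then have nM: "n \<in> carrier M" using A.a_subset by auto
    have "r \<odot>\<^bsub>M\<^esub> z = r \<odot>\<^bsub>M\<^esub> n \<oplus>\<^bsub>M\<^esub> r \<odot>\<^bsub>M\<^esub> x" using n nM r x by (simp add: M.smult_r_distr)
    then have "r \<odot>\<^bsub>M\<^esub> z \<in> N +>\<^bsub>M\<^esub> (r \<odot>\<^bsub>M\<^esub> x)"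
      using S.smult_closed[OF r n(1)] by (auto simp: a_r_coset_def')
    then show ?thesis using r x by (intro M.M.a_repr_independence[symmetric]) (auto intro: A.a_subgroup)
  qed
  have smult: "r \<odot>\<^bsub>quot_module M N\<^esub> (N +>\<^bsub>M\<^esub> x) = N +>\<^bsub>M\<^esub> (r \<odot>\<^bsub>M\<^esub> x)"
    if r: "r \<in> carrier K" and x: "x \<in> carrier M" for r x
  proof -
    have "(\<Union>z\<in>N +>\<^bsub>M\<^esub> x. N +>\<^bsub>M\<^esub> (r \<odot>\<^bsub>M\<^esub> z)) = (\<Union>z\<in>N +>\<^bsub>M\<^esub> x. N +>\<^bsub>M\<^esub> (r \<odot>\<^bsub>M\<^esub> x))"
      using eq[OF r x] by (rule SUP_cong[OF refl])
    moreover have "N +>\<^bsub>M\<^esub> x \<noteq> {}" using A.a_rcos_self[OF x] by auto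
    ultimately show ?thesis by (simp add: quot_module_def)
  qed
  then show "\<lbrakk>r \<in> carrier K; x \<in> carrier M\<rbrakk> \<Longrightarrow>
      r \<odot>\<^bsub>quot_module M N\<^esub> (N +>\<^bsub>M\<^esub> x) = N +>\<^bsub>M\<^esub> (r \<odot>\<^bsub>M\<^esub> x)" .
  interpret Q: comm_group "M A_Mod N" by (rule A.a_factorgroup_is_comm_group)
  have "carrier (quot_module M N) = carrier (M A_Mod N)" "(\<oplus>\<^bsub>quot_module M N\<^esub>) = (\<otimes>\<^bsub>M A_Mod N\<^esub>)"
    "\<zero>\<^bsub>quot_module M N\<^esub> = \<one>\<^bsub>M A_Mod N\<^esub>"
    by (simp_all add: quot_module_def A_FactGroup_def FactGroup_def A_RCOSETS_def set_add_def)
  then have "comm_group (add_monoid (quot_module M N))"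
    by (intro comm_groupI) (simp_all del: add_A_FactGroup add: Q.m_assoc Q.l_inv_ex, rule Q.m_comm)
  then have "abelian_group (quot_module M N)"
    by (simp add: abelian_group_def abelian_monoid_def abelian_group_axioms_def comm_group_def)
  then show "module K (quot_module M N)"
    by (rule moduleI[OF M.R.is_cring])
      (auto simp: car add smult M.smult_l_distr M.smult_r_distr M.smult_assoc1)
qed

locale tensor_factors = M: module K M + N: module K N
  for K :: "('k, 'c) ring_scheme" and M :: "('k, 'm, 'd) module_scheme"
    and N :: "('k, 'n, 'e) module_scheme"
begin

abbreviation "proj f \<equiv> tensor_null K M N +>\<^bsub>free_pairs K M N\<^esub> f"

interpretation F: module K "free_pairs K M N"
  by (rule free_module_module) (rule M.R.is_cring)

lemmas null = tensor_null_submodule[OF M.module_axioms N.module_axioms]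

lemma free_basis_pair:
  "\<lbrakk>m \<in> carrier M; n \<in> carrier N\<rbrakk> \<Longrightarrow> free_basis K (m, n) \<in> carrier (free_pairs K M N)"
  by (intro free_basis_carrier M.R.ring_axioms) auto

lemma tensor_module: "module K (tensor K M N)"
  unfolding tensor_def by (rule quot_module_module[OF F.module_axioms null])

lemma proj_hom: "proj \<in> mod_hom K (free_pairs K M N) (tensor K M N)"
  by (rule mod_homI)
    (auto simp: tensor_def quot_module_carrier[OF F.module_axioms null]
      quot_module_add[OF F.module_axioms null] quot_module_smult[OF F.module_axioms null])

lemma proj_surj: "t \<in> carrier (tensor K M N) \<Longrightarrow> \<exists>f \<in> carrier (free_pairs K M N). t = proj f"
  by (auto simp: tensor_def quot_module_carrier[OF F.module_axioms null])

lemma proj_self: "f \<in> carrier (free_pairs K M N) \<Longrightarrow> f \<in> proj f"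
  by (rule abelian_subgroup.a_rcos_self[OF abelian_subgroup_submodule[OF F.module_axioms null]])

lemma pure_tensor_closed:
  "\<lbrakk>m \<in> carrier M; n \<in> carrier N\<rbrakk> \<Longrightarrow> pure_tensor K M N m n \<in> carrier (tensor K M N)"
  using mod_hom_closed[OF proj_hom free_basis_pair] by (simp add: pure_tensor_def)

text \<open>Each defining relation of the tensor product is a difference of two elements of the free
  module, whose classes are thereby identified.\<close>

lemma tensor_relationsD:
  assumes "f \<ominus>\<^bsub>free_pairs K M N\<^esub> g \<in> tensor_relations K M N"
    and f: "f \<in> carrier (free_pairs K M N)" and g: "g \<in> carrier (free_pairs K M N)"
  shows "proj f = proj g"
proof -
  interpret A: abelian_subgroup "tensor_null K M N" "free_pairs K M N"
    by (rule abelian_subgroup_submodule[OF F.module_axioms null])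
  have "f \<ominus>\<^bsub>free_pairs K M N\<^esub> g \<in> tensor_null K M N"
    using assms(1) by (auto simp: tensor_null_def generated_submodule_def)
  then have "f \<in> proj g"
    using f g by (simp add: A.a_rcos_module a_minus_def)
  then show ?thesis using F.M.a_repr_independence[OF _ g A.a_subgroup] by auto
qed

lemma pure_tensor_bilinear: "bilinear_map K M N (tensor K M N) (pure_tensor K M N)"
proof -
  note e = free_basis_pair
    and h = mod_hom_add[OF proj_hom, symmetric] mod_hom_smult[OF proj_hom, symmetric]
  have "proj (free_basis K (m \<oplus>\<^bsub>M\<^esub> m', n)) =
      proj (free_basis K (m, n) \<oplus>\<^bsub>free_pairs K M N\<^esub> free_basis K (m', n))"
    if "m \<in> carrier M" "m' \<in> carrier M" "n \<in> carrier N" for m m' n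
    by (rule tensor_relationsD, unfold tensor_relations_def Let_def) (use that in \<open>blast, simp_all add: e\<close>)
  moreover have "proj (free_basis K (m, n \<oplus>\<^bsub>N\<^esub> n')) =
      proj (free_basis K (m, n) \<oplus>\<^bsub>free_pairs K M N\<^esub> free_basis K (m, n'))"
    if "m \<in> carrier M" "n \<in> carrier N" "n' \<in> carrier N" for m n n'
    by (rule tensor_relationsD, unfold tensor_relations_def Let_def) (use that in \<open>blast, simp_all add: e\<close>)
  moreover have "proj (free_basis K (r \<odot>\<^bsub>M\<^esub> m, n)) = proj (r \<odot>\<^bsub>free_pairs K M N\<^esub> free_basis K (m, n))"
    if "r \<in> carrier K" "m \<in> carrier M" "n \<in> carrier N" for r m n
    by (rule tensor_relationsD, unfold tensor_relations_def Let_def) (use that in \<open>blast, simp_all add: e\<close>)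
  moreover have "proj (free_basis K (m, r \<odot>\<^bsub>N\<^esub> n)) = proj (r \<odot>\<^bsub>free_pairs K M N\<^esub> free_basis K (m, n))"
    if "r \<in> carrier K" "m \<in> carrier M" "n \<in> carrier N" for r m n
    by (rule tensor_relationsD, unfold tensor_relations_def Let_def) (use that in \<open>blast, simp_all add: e\<close>)
  ultimately show ?thesis
    by (intro bilinear_mapI mod_homI pure_tensor_closed) (simp_all add: pure_tensor_def h e)
qed

lemma tensor_lift_proj:
  assumes "module K P" "bilinear_map K M N P \<beta>" "f \<in> carrier (free_pairs K M N)"
  shows "tensor_lift K P \<beta> (proj f) = lincomb K P (\<lambda>(m, n). \<beta> m n) f"
  using assms(3) by (intro tensor_lift_eq[OF M.module_axioms N.module_axioms assms(1,2)])
    (auto intro: proj_self mod_hom_closed[OF proj_hom])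

lemma tensor_lift_hom:
  assumes P: "module K P" and b: "bilinear_map K M N P \<beta>"
  shows "tensor_lift K P \<beta> \<in> mod_hom K (tensor K M N) P"
proof -
  interpret P: left_module K P by (rule module_left_module[OF P])
  have "(\<lambda>(m, n). \<beta> m n) \<in> carrier M \<times> carrier N \<rightarrow> carrier P"
    using b by (auto intro: bilinear_map_closed)
  note l = P.lincomb_hom[OF this]
  show ?thesis
    by (rule mod_homI; (drule proj_surj)+;
      auto simp: tensor_lift_proj[OF P b] mod_hom_add[OF proj_hom, symmetric] mod_hom_smult[OF proj_hom, symmetric]
       mod_hom_add[OF l] mod_hom_smult[OF l] intro: mod_hom_closed[OF l])
qed

text \<open>Every tensor is a sum of pure tensors without scalars, because these can be absorbed into the
  first factor; the empty sum is \<open>0 \<otimes> 0\<close>.\<close>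

lemma tensor_induct [consumes 1, case_names pure add]:
  assumes t: "t \<in> carrier (tensor K M N)"
    and pure: "\<And>m n. \<lbrakk>m \<in> carrier M; n \<in> carrier N\<rbrakk> \<Longrightarrow> Q (pure_tensor K M N m n)"
    and add: "\<And>s t. \<lbrakk>s \<in> carrier (tensor K M N); t \<in> carrier (tensor K M N); Q s; Q t\<rbrakk> \<Longrightarrow>
      Q (s \<oplus>\<^bsub>tensor K M N\<^esub> t)"
  shows "Q t"
proof -
  interpret T: module K "tensor K M N" by (rule tensor_module)
  obtain f where f: "f \<in> carrier (free_pairs K M N)" "t = proj f" using proj_surj[OF t] by auto
  have t: "t = finsum (tensor K M N) (\<lambda>(m, n). pure_tensor K M N (f (m, n) \<odot>\<^bsub>M\<^esub> m) n) {x. f x \<noteq> \<zero>\<^bsub>K\<^esub>}"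
  proof -
    have "t = lincomb K (tensor K M N) (\<lambda>x. proj (free_basis K x)) f"
      using left_module.hom_eq_lincomb[OF module_left_module[OF tensor_module] proj_hom f(1)] f(2) by simp
    also have "\<dots> = finsum (tensor K M N) (\<lambda>(m, n). pure_tensor K M N (f (m, n) \<odot>\<^bsub>M\<^esub> m) n) {x. f x \<noteq> \<zero>\<^bsub>K\<^esub>}"
      unfolding lincomb_def
    proof (rule T.M.finsum_cong')
      fix x assume x: "x \<in> {x. f x \<noteq> \<zero>\<^bsub>K\<^esub>}"
      then obtain m n where "x = (m, n)" "m \<in> carrier M" "n \<in> carrier N" "f (m, n) \<in> carrier K"
        using f(1) by (cases x) (auto simp: free_module_def)
      then show "f x \<odot>\<^bsub>tensor K M N\<^esub> proj (free_basis K x) =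
          (case x of (m, n) \<Rightarrow> pure_tensor K M N (f (m, n) \<odot>\<^bsub>M\<^esub> m) n)"
        using mod_hom_smult[OF bilinear_map_left[OF pure_tensor_bilinear]] by (simp add: pure_tensor_def)
    next
      show "(\<lambda>(m, n). pure_tensor K M N (f (m, n) \<odot>\<^bsub>M\<^esub> m) n) \<in> {x. f x \<noteq> \<zero>\<^bsub>K\<^esub>} \<rightarrow> carrier (tensor K M N)"
        using f(1) by (auto simp: free_module_def intro!: pure_tensor_closed M.smult_closed)
    qed simp
    finally show ?thesis .
  qed
  have z: "Q \<zero>\<^bsub>tensor K M N\<^esub>"
    using pure[of "\<zero>\<^bsub>M\<^esub>" "\<zero>\<^bsub>N\<^esub>"]
      mod_hom_zero[OF module_left_module[OF N.module_axioms] module_left_module[OF tensor_module]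
        bilinear_map_right[OF pure_tensor_bilinear], of "\<zero>\<^bsub>M\<^esub>"] by simp
  have "Q (finsum (tensor K M N) g U) \<and> finsum (tensor K M N) g U \<in> carrier (tensor K M N)"
    if "finite U" "\<And>x. x \<in> U \<Longrightarrow> Q (g x) \<and> g x \<in> carrier (tensor K M N)" for g :: "'m \<times> 'n \<Rightarrow> _" and U
    using that
  proof induct
    case (insert x U)
    then have "g \<in> U \<rightarrow> carrier (tensor K M N)" "g x \<in> carrier (tensor K M N)" by auto
    then show ?case using insert by (simp add: add)
  qed (use z in auto)
  from this[of "{x. f x \<noteq> \<zero>\<^bsub>K\<^esub>}" "\<lambda>(m, n). pure_tensor K M N (f (m, n) \<odot>\<^bsub>M\<^esub> m) n"]
  show ?thesis unfolding t
    using f(1) by (fastforce simp: free_module_def intro!: pure pure_tensor_closed M.smult_closed)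
qed

lemma tensor_hom_eqI:
  assumes "f \<in> mod_hom K (tensor K M N) P" "g \<in> mod_hom K (tensor K M N) P"
    and "\<And>m n. \<lbrakk>m \<in> carrier M; n \<in> carrier N\<rbrakk> \<Longrightarrow> f (pure_tensor K M N m n) = g (pure_tensor K M N m n)"
    and "t \<in> carrier (tensor K M N)"
  shows "f t = g t"
  using assms(4)
  by (induct rule: tensor_induct)
    (simp_all add: assms(3) mod_hom_add[OF assms(1)] mod_hom_add[OF assms(2)])

end

lemma mod_hom_pure_tensor_left [lin]:
  assumes "module K M" "module K N" "n \<in> carrier N" "f \<in> mod_hom K L M"
  shows "(\<lambda>x. pure_tensor K M N (f x) n) \<in> mod_hom K L (tensor K M N)"
proof -
  interpret tensor_factors K M N using assms by (simp add: tensor_factors_def)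
  show ?thesis
    by (rule mod_hom_compose[OF assms(4) bilinear_map_left[OF pure_tensor_bilinear assms(3)]])
qed

lemma mod_hom_pure_tensor_right [lin]:
  assumes "module K M" "module K N" "m \<in> carrier M" "f \<in> mod_hom K L N"
  shows "(\<lambda>x. pure_tensor K M N m (f x)) \<in> mod_hom K L (tensor K M N)"
proof -
  interpret tensor_factors K M N using assms by (simp add: tensor_factors_def)
  show ?thesis
    by (rule mod_hom_compose[OF assms(4) bilinear_map_right[OF pure_tensor_bilinear assms(3)]])
qed

lemma mod_hom_mult_left [lin]:
  assumes "unital_algebra K A" "b \<in> carrier A" "f \<in> mod_hom K L A"
  shows "(\<lambda>x. f x \<otimes>\<^bsub>A\<^esub> b) \<in> mod_hom K L A"
proof -
  interpret unital_algebra K A by fact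
  show ?thesis using assms(2,3)
    by (auto intro!: mod_homI simp: mod_hom_closed mod_hom_add mod_hom_smult A.l_distr smult_mult_left)
qed

lemma mod_hom_mult_right [lin]:
  assumes "unital_algebra K A" "b \<in> carrier A" "f \<in> mod_hom K L A"
  shows "(\<lambda>x. b \<otimes>\<^bsub>A\<^esub> f x) \<in> mod_hom K L A"
proof -
  interpret unital_algebra K A by fact
  show ?thesis using assms(2,3)
    by (auto intro!: mod_homI simp: mod_hom_closed mod_hom_add mod_hom_smult A.r_distr smult_mult_right)
qed

lemma mod_hom_addf [lin]:
  assumes "module K P" "f \<in> mod_hom K M P" "g \<in> mod_hom K M P"
  shows "(\<lambda>x. f x \<oplus>\<^bsub>P\<^esub> g x) \<in> mod_hom K M P"
proof -
  interpret module K P by fact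
  show ?thesis using assms(2,3)
    by (intro mod_homI) (auto simp: mod_hom_closed mod_hom_add mod_hom_smult smult_r_distr M.a_ac)
qed

context tensor_factors
begin

interpretation T: module K "tensor K M N" by (rule tensor_module)

lemma tensor_lift_pure:
  "\<lbrakk>module K P; bilinear_map K M N P \<beta>; m \<in> carrier M; n \<in> carrier N\<rbrakk> \<Longrightarrow>
    tensor_lift K P \<beta> (pure_tensor K M N m n) = \<beta> m n"
  by (rule tensor_lift_pure_tensor[OF M.module_axioms N.module_axioms])

lemma tensor_lift_closed:
  "\<lbrakk>module K P; bilinear_map K M N P \<beta>; t \<in> carrier (tensor K M N)\<rbrakk> \<Longrightarrow> tensor_lift K P \<beta> t \<in> carrier P"
  by (rule mod_hom_closed[OF tensor_lift_hom])

lemma tensor_lift_cong: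
  assumes P: "module K P" and b: "bilinear_map K M N P \<beta>" and t: "t \<in> carrier (tensor K M N)"
    and eq: "\<And>m n. \<lbrakk>m \<in> carrier M; n \<in> carrier N\<rbrakk> \<Longrightarrow> \<gamma> m n = \<beta> m n"
  shows "tensor_lift K P \<gamma> t = tensor_lift K P \<beta> t"
proof (rule tensor_hom_eqI[OF tensor_lift_hom[OF P] tensor_lift_hom[OF P b] _ t])
  show c: "bilinear_map K M N P \<gamma>"
    using b by (auto simp: bilinear_map_def mod_hom_def eq Pi_def)
  show "tensor_lift K P \<gamma> (pure_tensor K M N m n) = tensor_lift K P \<beta> (pure_tensor K M N m n)"
    if "m \<in> carrier M" "n \<in> carrier N" for m n
    using that by (simp add: tensor_lift_pure P b c eq)
qed

text \<open>On Sweedler expressions this reads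
  \<open>g (\<beta> h\<^sub>1 h\<^sub>2) = (g \<circ> \<beta>) h\<^sub>1 h\<^sub>2\<close>; it is implicit whenever a
  factor is moved in or out of a Sweedler sum.\<close>

lemma hom_tensor_lift:
  assumes P: "module K P" and Q: "module K Q" and b: "bilinear_map K M N P \<beta>"
    and g: "g \<in> mod_hom K P Q" and t: "t \<in> carrier (tensor K M N)"
  shows "g (tensor_lift K P \<beta> t) = tensor_lift K Q (\<lambda>m n. g (\<beta> m n)) t"
proof (rule tensor_hom_eqI[OF mod_hom_compose[OF tensor_lift_hom[OF P b] g] tensor_lift_hom[OF Q] _ t])
  show c: "bilinear_map K M N Q (\<lambda>m n. g (\<beta> m n))"
    by (intro bilinear_mapI mod_hom_compose[OF bilinear_map_left[OF b] g]
        mod_hom_compose[OF bilinear_map_right[OF b] g])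
  show "g (tensor_lift K P \<beta> (pure_tensor K M N m n)) =
      tensor_lift K Q (\<lambda>m n. g (\<beta> m n)) (pure_tensor K M N m n)"
    if "m \<in> carrier M" "n \<in> carrier N" for m n
    using that by (simp add: tensor_lift_pure P Q b c)
qed

lemma tensor_lift_param_linear:
  assumes L: "module K L" and P: "module K P"
    and lin: "\<And>m n. \<lbrakk>m \<in> carrier M; n \<in> carrier N\<rbrakk> \<Longrightarrow> (\<lambda>x. F x m n) \<in> mod_hom K L P"
    and b: "\<And>x. x \<in> carrier L \<Longrightarrow> bilinear_map K M N P (F x)"
    and t: "t \<in> carrier (tensor K M N)"
  shows "(\<lambda>x. tensor_lift K P (F x) t) \<in> mod_hom K L P"
proof (rule mod_homI)
  interpret L: module K L by (rule L)
  interpret P: module K P by (rule P)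
  note l = tensor_lift_hom[OF P b]
  show "tensor_lift K P (F x) t \<in> carrier P" if "x \<in> carrier L" for x
    using that t by (rule mod_hom_closed[OF l])
  show "tensor_lift K P (F (x \<oplus>\<^bsub>L\<^esub> y)) t = tensor_lift K P (F x) t \<oplus>\<^bsub>P\<^esub> tensor_lift K P (F y) t"
    if x: "x \<in> carrier L" and y: "y \<in> carrier L" for x y
    by (rule tensor_hom_eqI[OF l mod_hom_addf[OF P l l] _ t])
      (use x y in \<open>simp_all add: tensor_lift_pure P b mod_hom_add[OF lin]\<close>)
  show "tensor_lift K P (F (r \<odot>\<^bsub>L\<^esub> x)) t = r \<odot>\<^bsub>P\<^esub> tensor_lift K P (F x) t"
    if r: "r \<in> carrier K" and x: "x \<in> carrier L" for r x
    by (rule tensor_hom_eqI[OF l mod_hom_smult_linear[OF P r l] _ t])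
      (use r x in \<open>simp_all add: tensor_lift_pure P b mod_hom_smult[OF lin]\<close>)
qed

lemma tensor_lift_arg_linear:
  "\<lbrakk>module K P; bilinear_map K M N P \<beta>; g \<in> mod_hom K L (tensor K M N)\<rbrakk> \<Longrightarrow>
    (\<lambda>x. tensor_lift K P \<beta> (g x)) \<in> mod_hom K L P"
  by (rule mod_hom_compose[OF _ tensor_lift_hom])

text \<open>A Fubini rule: for fixed \<open>s\<close>, both sides are linear in \<open>t\<close>, hence
  compared on pure tensors.\<close>

lemma tensor_lift_swap:
  assumes P: "module K P" and V: "tensor_factors K V W"
    and s: "s \<in> carrier (tensor K M N)" and t: "t \<in> carrier (tensor K V W)"
    and 1: "\<And>n v w. \<lbrakk>n \<in> carrier N; v \<in> carrier V; w \<in> carrier W\<rbrakk> \<Longrightarrow> (\<lambda>m. F m n v w) \<in> mod_hom K M P"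
    and 2: "\<And>m v w. \<lbrakk>m \<in> carrier M; v \<in> carrier V; w \<in> carrier W\<rbrakk> \<Longrightarrow> (\<lambda>n. F m n v w) \<in> mod_hom K N P"
    and 3: "\<And>m n w. \<lbrakk>m \<in> carrier M; n \<in> carrier N; w \<in> carrier W\<rbrakk> \<Longrightarrow> (\<lambda>v. F m n v w) \<in> mod_hom K V P"
    and 4: "\<And>m n v. \<lbrakk>m \<in> carrier M; n \<in> carrier N; v \<in> carrier V\<rbrakk> \<Longrightarrow> (\<lambda>w. F m n v w) \<in> mod_hom K W P"
  shows "tensor_lift K P (\<lambda>m n. tensor_lift K P (\<lambda>v w. F m n v w) t) s =
    tensor_lift K P (\<lambda>v w. tensor_lift K P (\<lambda>m n. F m n v w) s) t"
proof -
  interpret V: tensor_factors K V W by (rule V)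
  have a: "bilinear_map K V W P (\<lambda>v w. F m n v w)" if "m \<in> carrier M" "n \<in> carrier N" for m n
    using that by (intro bilinear_mapI 3 4)
  have b: "bilinear_map K M N P (\<lambda>m n. F m n v w)" if "v \<in> carrier V" "w \<in> carrier W" for v w
    using that by (intro bilinear_mapI 1 2)
  have c: "bilinear_map K M N P (\<lambda>m n. tensor_lift K P (\<lambda>v w. F m n v w) t)"
    if "t \<in> carrier (tensor K V W)" for t
    using that by (intro bilinear_mapI V.tensor_lift_param_linear a 1 2 P M.module_axioms N.module_axioms)
  have d: "bilinear_map K V W P (\<lambda>v w. tensor_lift K P (\<lambda>m n. F m n v w) s)"
    by (intro bilinear_mapI tensor_lift_param_linear b 3 4 P s V.M.module_axioms V.N.module_axioms)
  have "(\<lambda>t. tensor_lift K P (\<lambda>m n. tensor_lift K P (\<lambda>v w. F m n v w) t) s) \<in> mod_hom K (tensor K V W) P"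
    by (intro tensor_lift_param_linear V.tensor_module P V.tensor_lift_hom a c s)
  then show ?thesis
    using V.tensor_lift_hom[OF P d]
  proof (rule V.tensor_hom_eqI)
    fix v w assume vw: "v \<in> carrier V" "w \<in> carrier W"
    have "tensor_lift K P (\<lambda>m n. tensor_lift K P (\<lambda>v w. F m n v w) (pure_tensor K V W v w)) s =
        tensor_lift K P (\<lambda>m n. F m n v w) s"
      by (rule tensor_lift_cong[OF P b[OF vw] s]) (simp add: V.tensor_lift_pure[OF P a] vw)
    also have "\<dots> = tensor_lift K P (\<lambda>v w. tensor_lift K P (\<lambda>m n. F m n v w) s) (pure_tensor K V W v w)"
      by (simp add: V.tensor_lift_pure[OF P d] vw)
    finally show "tensor_lift K P (\<lambda>m n. tensor_lift K P (\<lambda>v w. F m n v w) (pure_tensor K V W v w)) s =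
        tensor_lift K P (\<lambda>v w. tensor_lift K P (\<lambda>m n. F m n v w) s) (pure_tensor K V W v w)" .
  qed (rule t)
qed

end

lemma (in unital_algebra) module: "module K A" ..

section \<open>Tensor products of algebras\<close>

lemma tensor_algebra_simps [simp]:
  "carrier (tensor_algebra K A B) = carrier (tensor K A B)"
  "(\<oplus>\<^bsub>tensor_algebra K A B\<^esub>) = (\<oplus>\<^bsub>tensor K A B\<^esub>)"
  "\<zero>\<^bsub>tensor_algebra K A B\<^esub> = \<zero>\<^bsub>tensor K A B\<^esub>"
  "(\<odot>\<^bsub>tensor_algebra K A B\<^esub>) = (\<odot>\<^bsub>tensor K A B\<^esub>)"
  "\<one>\<^bsub>tensor_algebra K A B\<^esub> = pure_tensor K A B \<one>\<^bsub>A\<^esub> \<one>\<^bsub>B\<^esub>"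
  by (simp_all add: tensor_algebra_def Let_def)

lemma mod_hom_tensor_algebra [simp]:
  "mod_hom K (tensor_algebra K A B) P = mod_hom K (tensor K A B) P"
  "mod_hom K P (tensor_algebra K A B) = mod_hom K P (tensor K A B)"
  by (simp_all add: mod_hom_def)

lemma abelian_group_cong:
  assumes "abelian_group M" "carrier M' = carrier M" "(\<oplus>\<^bsub>M'\<^esub>) = (\<oplus>\<^bsub>M\<^esub>)" "\<zero>\<^bsub>M'\<^esub> = \<zero>\<^bsub>M\<^esub>"
  shows "abelian_group M'"
proof -
  interpret abelian_group M by fact
  show ?thesis
    by (rule abelian_groupI) (auto simp: assms(2-4) a_assoc intro: a_comm l_neg)
qed

lemma module_cong:
  assumes "module K M" "carrier M' = carrier M" "(\<oplus>\<^bsub>M'\<^esub>) = (\<oplus>\<^bsub>M\<^esub>)" "\<zero>\<^bsub>M'\<^esub> = \<zero>\<^bsub>M\<^esub>"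
    "(\<odot>\<^bsub>M'\<^esub>) = (\<odot>\<^bsub>M\<^esub>)"
  shows "module K M'"
proof -
  interpret module K M by fact
  have "abelian_group M'" by (rule abelian_group_cong[OF M.abelian_group_axioms assms(2-4)])
  then show ?thesis
    by (intro moduleI R.is_cring)
      (auto simp: assms(2-5) smult_l_distr smult_r_distr smult_assoc1)
qed

lemma unital_algebraI:
  assumes "module K A"
    and "\<And>x y. \<lbrakk>x \<in> carrier A; y \<in> carrier A\<rbrakk> \<Longrightarrow> x \<otimes>\<^bsub>A\<^esub> y \<in> carrier A"
    and "\<one>\<^bsub>A\<^esub> \<in> carrier A"
    and "\<And>x y z. \<lbrakk>x \<in> carrier A; y \<in> carrier A; z \<in> carrier A\<rbrakk> \<Longrightarrow>
      (x \<otimes>\<^bsub>A\<^esub> y) \<otimes>\<^bsub>A\<^esub> z = x \<otimes>\<^bsub>A\<^esub> (y \<otimes>\<^bsub>A\<^esub> z)"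
    and "\<And>x. x \<in> carrier A \<Longrightarrow> \<one>\<^bsub>A\<^esub> \<otimes>\<^bsub>A\<^esub> x = x" "\<And>x. x \<in> carrier A \<Longrightarrow> x \<otimes>\<^bsub>A\<^esub> \<one>\<^bsub>A\<^esub> = x"
    and left: "\<And>y. y \<in> carrier A \<Longrightarrow> (\<lambda>x. x \<otimes>\<^bsub>A\<^esub> y) \<in> mod_hom K A A"
    and right: "\<And>x. x \<in> carrier A \<Longrightarrow> (\<lambda>y. x \<otimes>\<^bsub>A\<^esub> y) \<in> mod_hom K A A"
  shows "unital_algebra K A"
proof -
  interpret module K A by fact
  have "ring A"
    by (intro ringI monoidI M.abelian_group_axioms assms mod_hom_add[OF left] mod_hom_add[OF right])
  then show ?thesis
    by (intro unital_algebra.intro unital_algebra_axioms.intro assms(1) mod_hom_smult[OF left] mod_hom_smult[OF right])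
qed

locale tensor_algebras = A: unital_algebra K A + B: unital_algebra K B
  for K :: "('k, 'c) ring_scheme" and A :: "('k, 'a, 'd) module_scheme"
    and B :: "('k, 'b, 'e) module_scheme"
begin

sublocale tensor_factors K A B ..

abbreviation "TA \<equiv> tensor_algebra K A B"

lemma mult_inner_bilinear:
  "\<lbrakk>a \<in> carrier A; b \<in> carrier B\<rbrakk> \<Longrightarrow>
    bilinear_map K A B (tensor K A B) (\<lambda>a' b'. pure_tensor K A B (a \<otimes>\<^bsub>A\<^esub> a') (b \<otimes>\<^bsub>B\<^esub> b'))"
  by (intro lin A.module B.module A.unital_algebra_axioms B.unital_algebra_axioms A.A.m_closed B.A.m_closed)

lemma mult_outer_bilinear:
  "t \<in> carrier (tensor K A B) \<Longrightarrow> bilinear_map K A B (tensor K A B)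
    (\<lambda>a b. tensor_lift K (tensor K A B) (\<lambda>a' b'. pure_tensor K A B (a \<otimes>\<^bsub>A\<^esub> a') (b \<otimes>\<^bsub>B\<^esub> b')) t)"
  by (intro lin tensor_lift_param_linear tensor_module A.module B.module A.unital_algebra_axioms
      B.unital_algebra_axioms A.A.m_closed B.A.m_closed)

lemma tensor_mult_left_linear: "t \<in> carrier TA \<Longrightarrow> (\<lambda>s. s \<otimes>\<^bsub>TA\<^esub> t) \<in> mod_hom K TA TA"
  using tensor_lift_hom[OF tensor_module mult_outer_bilinear, of t]
  by (simp add: tensor_algebra_def Let_def del: tensor_algebra_simps) (simp add: mod_hom_def)

lemma tensor_mult_right_linear: "s \<in> carrier TA \<Longrightarrow> (\<lambda>t. s \<otimes>\<^bsub>TA\<^esub> t) \<in> mod_hom K TA TA"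
proof -
  assume "s \<in> carrier TA"
  then have "(\<lambda>t. tensor_lift K (tensor K A B) (\<lambda>a b. tensor_lift K (tensor K A B)
      (\<lambda>a' b'. pure_tensor K A B (a \<otimes>\<^bsub>A\<^esub> a') (b \<otimes>\<^bsub>B\<^esub> b')) t) s) \<in> mod_hom K (tensor K A B) (tensor K A B)"
    by (intro tensor_lift_param_linear tensor_module mult_outer_bilinear tensor_lift_hom mult_inner_bilinear) auto
  then show ?thesis
    by (simp add: tensor_algebra_def Let_def del: tensor_algebra_simps) (simp add: mod_hom_def)
qed

lemma tensor_mult_pure:
  assumes "a \<in> carrier A" "b \<in> carrier B" "a' \<in> carrier A" "b' \<in> carrier B"
  shows "pure_tensor K A B a b \<otimes>\<^bsub>TA\<^esub> pure_tensor K A B a' b' =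
    pure_tensor K A B (a \<otimes>\<^bsub>A\<^esub> a') (b \<otimes>\<^bsub>B\<^esub> b')"
  using assms
  by (simp add: tensor_algebra_def Let_def del: tensor_algebra_simps)
    (simp add: tensor_lift_pure tensor_module mult_outer_bilinear mult_inner_bilinear pure_tensor_closed)

lemma unital_algebra_tensor: "unital_algebra K TA"
proof (rule unital_algebraI)
  interpret T: module K "tensor K A B" by (rule tensor_module)
  show "module K TA" by (rule module_cong[OF tensor_module]) auto
  note l = tensor_mult_left_linear and r = tensor_mult_right_linear
  note la = mod_hom_add[OF l, simplified] and ra = mod_hom_add[OF r, simplified]
  show c: "s \<otimes>\<^bsub>TA\<^esub> t \<in> carrier TA" if "s \<in> carrier TA" "t \<in> carrier TA" for s t
    using that by (rule mod_hom_closed[OF r])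
  show "(s \<otimes>\<^bsub>TA\<^esub> t) \<otimes>\<^bsub>TA\<^esub> u = s \<otimes>\<^bsub>TA\<^esub> (t \<otimes>\<^bsub>TA\<^esub> u)"
    if s: "s \<in> carrier TA" and t: "t \<in> carrier TA" and u: "u \<in> carrier TA" for s t u
    using s[simplified]
  proof (induct rule: tensor_induct)
    case (pure a b)
    show ?case using t[simplified]
    proof (induct rule: tensor_induct)
      case (pure a' b')
      show ?case using u[simplified]
      proof (induct rule: tensor_induct)
        case (pure a'' b'')
        show ?case
          by (simp add: tensor_mult_pure pure \<open>a \<in> _\<close> \<open>b \<in> _\<close> \<open>a' \<in> _\<close> \<open>b' \<in> _\<close> A.A.m_assoc B.A.m_assoc)
      qed (use pure \<open>a \<in> _\<close> \<open>b \<in> _\<close> c in \<open>simp add: ra pure_tensor_closed\<close>)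
    qed (use u pure c in \<open>simp add: la ra pure_tensor_closed\<close>)
  qed (use t u c in \<open>simp add: la\<close>)
  show "\<one>\<^bsub>TA\<^esub> \<otimes>\<^bsub>TA\<^esub> t = t" if "t \<in> carrier TA" for t
    using that[simplified]
    by (induct rule: tensor_induct) (simp_all add: tensor_mult_pure ra pure_tensor_closed)
  show "t \<otimes>\<^bsub>TA\<^esub> \<one>\<^bsub>TA\<^esub> = t" if "t \<in> carrier TA" for t
    using that[simplified]
    by (induct rule: tensor_induct) (simp_all add: tensor_mult_pure la pure_tensor_closed)
qed (auto simp: pure_tensor_closed simp del: mod_hom_tensor_algebra intro: tensor_mult_left_linear tensor_mult_right_linear)

end

lemma (in unital_algebra) unital_algebra_opposite: "unital_algebra K (opposite_algebra A)"
proof -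
  have "module K (opposite_algebra A)"
    by (rule module_cong[OF module]) (simp_all add: opposite_algebra_def)
  moreover have "mod_hom K (opposite_algebra A) (opposite_algebra A) = mod_hom K A A"
    by (simp add: mod_hom_def opposite_algebra_def)
  ultimately show ?thesis
    using mod_hom_mult_left[OF unital_algebra_axioms _ mod_hom_id] mod_hom_mult_right[OF unital_algebra_axioms _ mod_hom_id]
    by (intro unital_algebraI) (simp_all add: opposite_algebra_def A.m_assoc)
qed

lemma alg_hom_opposite:
  "alg_hom K (opposite_algebra A) (opposite_algebra B) = alg_hom K A B"
  by (auto simp: alg_hom_def ring_hom_def mod_hom_def opposite_algebra_def)

text \<open>Multiplicativity is biadditive in the two arguments and clear on pure tensors.\<close>

lemma tensor_map_ring_hom:
  assumes 1: "tensor_algebras K A A'" and 2: "tensor_algebras K B B'"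
    and f: "f \<in> alg_hom K A B" and g: "g \<in> alg_hom K A' B'"
  shows "tensor_map K B B' f g \<in> ring_hom (tensor_algebra K A A') (tensor_algebra K B B')"
    and "\<lbrakk>a \<in> carrier A; a' \<in> carrier A'\<rbrakk> \<Longrightarrow>
      tensor_map K B B' f g (pure_tensor K A A' a a') = pure_tensor K B B' (f a) (g a')"
proof -
  interpret A: tensor_algebras K A A' by (rule 1)
  interpret B: tensor_algebras K B B' by (rule 2)
  interpret TB: unital_algebra K "tensor_algebra K B B'" by (rule B.unital_algebra_tensor)
  let ?f = "tensor_map K B B' f g"
  have fh: "f \<in> mod_hom K A B" "g \<in> mod_hom K A' B'" "f \<in> ring_hom A B" "g \<in> ring_hom A' B'"
    using f g by (auto simp: alg_hom_def)
  note cl = mod_hom_closed[OF fh(1)] mod_hom_closed[OF fh(2)]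
  have b: "bilinear_map K A A' (tensor K B B') (\<lambda>a b. pure_tensor K B B' (f a) (g b))"
    by (intro lin B.A.module B.B.module fh cl)
  have h: "?f \<in> mod_hom K (tensor K A A') (tensor K B B')"
    unfolding tensor_map_def by (rule A.tensor_lift_hom[OF B.tensor_module b])
  have p: "?f (pure_tensor K A A' a a') = pure_tensor K B B' (f a) (g a')"
    if "a \<in> carrier A" "a' \<in> carrier A'" for a a'
    using that by (simp add: tensor_map_def A.tensor_lift_pure[OF B.tensor_module b])
  then show "\<lbrakk>a \<in> carrier A; a' \<in> carrier A'\<rbrakk> \<Longrightarrow>
      ?f (pure_tensor K A A' a a') = pure_tensor K B B' (f a) (g a')" .
  note fa = mod_hom_add[OF h] and fc = mod_hom_closed[OF h]
  note la = mod_hom_add[OF A.tensor_mult_left_linear, simplified] mod_hom_add[OF B.tensor_mult_left_linear, simplified]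
   and ra = mod_hom_add[OF A.tensor_mult_right_linear, simplified] mod_hom_add[OF B.tensor_mult_right_linear, simplified]
   and ac = mod_hom_closed[OF A.tensor_mult_left_linear, simplified]
  have m: "?f (s \<otimes>\<^bsub>A.TA\<^esub> t) = ?f s \<otimes>\<^bsub>B.TA\<^esub> ?f t"
    if s: "s \<in> carrier (tensor K A A')" and t: "t \<in> carrier (tensor K A A')" for s t
    using s
  proof (induct rule: A.tensor_induct)
    case (pure a b)
    show ?case using t
    proof (induct rule: A.tensor_induct)
      case (pure a' b')
      with \<open>a \<in> _\<close> \<open>b \<in> _\<close> show ?case
        using ring_hom_mult[OF fh(3)] ring_hom_mult[OF fh(4)] cl
        by (simp add: A.tensor_mult_pure B.tensor_mult_pure p)
    next
      case (add t u)
      with pure show ?case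
        by (simp add: ra fa fc ac A.pure_tensor_closed)
    qed
  qed (use t in \<open>simp add: la fa fc ac\<close>)
  show "?f \<in> ring_hom A.TA B.TA"
  proof (rule ring_hom_memI)
    show "?f \<one>\<^bsub>A.TA\<^esub> = \<one>\<^bsub>B.TA\<^esub>"
      using ring_hom_one[OF fh(3)] ring_hom_one[OF fh(4)] by (simp add: p)
  qed (auto simp: fa fc m)
qed

section \<open>Projective modules\<close>

text \<open>The definition of projectivity restricts the index set of the basis to the type of
  \<open>P\<close>. Going through the lifting property removes this restriction, which is needed
  for bases indexed by pairs or taken from another module.\<close>

lemma projective_moduleI_retract_of_free:
  fixes P :: "('r, 'p, 'd) module_scheme" and X :: "'x set"
  assumes P: "left_module R P" and i: "i \<in> mod_hom R P (free_module R X)"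
    and q: "q \<in> mod_hom R (free_module R X) P" and qi: "\<And>x. x \<in> carrier P \<Longrightarrow> q (i x) = x"
  shows "projective_module R P"
proof (rule projective_moduleI[OF P])
  interpret P: left_module R P by (rule P)
  fix M :: "('r, 'p \<Rightarrow> 'r) module" and g
  assume M: "left_module R M" and g: "g \<in> mod_hom R M P" "g ` carrier M = carrier P"
  interpret M: left_module R M by (rule M)
  have e: "free_basis R x \<in> carrier (free_module R X)" if "x \<in> X" for x
    by (rule free_basis_carrier[OF P.R.ring_axioms that])
  have "\<exists>m. m \<in> carrier M \<and> g m = q (free_basis R x)" if "x \<in> X" for x
    using mod_hom_closed[OF q e[OF that]] g(2) by (metis imageE)
  \<comment> \<open>A lift of \<open>q\<close> through \<open>g\<close>, on basis vectors.\<close>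
  then obtain u where u: "\<And>x. x \<in> X \<Longrightarrow> u x \<in> carrier M \<and> g (u x) = q (free_basis R x)"
    by metis
  have uX: "u \<in> X \<rightarrow> carrier M" using u by auto
  note l = M.lincomb_hom[OF uX]
  have "g (lincomb R M u (i x)) = x" if x: "x \<in> carrier P" for x
  proof -
    have ix: "i x \<in> carrier (free_module R X)" by (rule mod_hom_closed[OF i x])
    have "g (lincomb R M u (i x)) = lincomb R P (\<lambda>x. g (u x)) (i x)"
      by (rule mod_hom_lincomb[OF M P g(1) uX ix])
    also have "\<dots> = lincomb R P (\<lambda>x. q (free_basis R x)) (i x)"
      unfolding lincomb_def
    proof (rule P.M.finsum_cong')
      fix y assume "y \<in> {y. i x y \<noteq> \<zero>\<^bsub>R\<^esub>}"
      then have "y \<in> X" using ix by (auto simp: free_module_def)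
      then show "i x y \<odot>\<^bsub>P\<^esub> g (u y) = i x y \<odot>\<^bsub>P\<^esub> q (free_basis R y)" using u by simp
    next
      show "(\<lambda>y. i x y \<odot>\<^bsub>P\<^esub> q (free_basis R y)) \<in> {y. i x y \<noteq> \<zero>\<^bsub>R\<^esub>} \<rightarrow> carrier P"
        using ix by (auto simp: free_module_def intro!: P.smult_closed mod_hom_closed[OF q] e)
    qed simp
    also have "\<dots> = x" using P.hom_eq_lincomb[OF q ix] qi[OF x] by simp
    finally show ?thesis .
  qed
  then show "\<exists>h\<in>mod_hom R P M. \<forall>x\<in>carrier P. g (h x) = x"
    by (intro bexI[of _ "\<lambda>x. lincomb R M u (i x)"] ballI mod_hom_compose[OF i l])
qed

lemma projective_module_retract:
  fixes Q :: "('r, 'q, 'e) module_scheme"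
  assumes Q: "projective_module R Q" and P: "left_module R P"
    and i: "i \<in> mod_hom R P Q" and q: "q \<in> mod_hom R Q P" and qi: "\<And>x. x \<in> carrier P \<Longrightarrow> q (i x) = x"
  shows "projective_module R P"
proof -
  obtain X :: "'q set" and j p where j: "j \<in> mod_hom R Q (free_module R X)" and p: "p \<in> mod_hom R (free_module R X) Q"
    and pj: "\<And>x. x \<in> carrier Q \<Longrightarrow> p (j x) = x"
    using Q unfolding projective_module_def by auto
  show ?thesis
    by (rule projective_moduleI_retract_of_free[OF P mod_hom_compose[OF i j] mod_hom_compose[OF p q]])
      (simp add: pj mod_hom_closed[OF i] qi)
qed

text \<open>The tensor product \<open>A \<otimes> M\<close> over \<open>K\<close>, with scalars in
  \<open>A\<close> instead of \<open>K\<close>.\<close>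

definition base_change ::
  "('k, 'c) ring_scheme \<Rightarrow> ('k, 'a, 'd) module_scheme \<Rightarrow> ('k, 'm, 'e) module_scheme \<Rightarrow>
   ('a, ('a \<times> 'm \<Rightarrow> 'k) set) module"
  where "base_change K A M = (let T = tensor K A M in
    \<lparr>carrier = carrier T, mult = undefined, one = undefined, zero = zero T, add = add T,
     smult = (\<lambda>a. tensor_lift K T (\<lambda>b m. pure_tensor K A M (a \<otimes>\<^bsub>A\<^esub> b) m))\<rparr>)"

lemma base_change_simps [simp]:
  "carrier (base_change K A M) = carrier (tensor K A M)"
  "(\<oplus>\<^bsub>base_change K A M\<^esub>) = (\<oplus>\<^bsub>tensor K A M\<^esub>)"
  "\<zero>\<^bsub>base_change K A M\<^esub> = \<zero>\<^bsub>tensor K A M\<^esub>"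
  by (simp_all add: base_change_def Let_def)

lemma bilinear_map_finsum:
  assumes "module K M" "module K N" "module K P" "bilinear_map K M N P \<beta>"
    and "finite U" "finite V" "u \<in> U \<rightarrow> carrier M" "v \<in> V \<rightarrow> carrier N"
  shows "\<beta> (finsum M u U) (finsum N v V) = finsum P (\<lambda>(x, y). \<beta> (u x) (v y)) (U \<times> V)"
proof -
  interpret M: module K M by fact
  interpret N: module K N by fact
  interpret P: module K P by fact
  note lm = module_left_module[OF assms(1)] module_left_module[OF assms(2)] module_left_module[OF assms(3)]
  have v: "finsum N v V \<in> carrier N" using assms(8) by simp
  show ?thesis
    using assms(5,7)
  proof induct
    case empty
    then show ?case
      using mod_hom_zero[OF lm(1,3) bilinear_map_left[OF assms(4) v]] by simp
  next
    case (insert x U)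
    then have u: "u x \<in> carrier M" "u \<in> U \<rightarrow> carrier M" by auto
    have b: "\<beta> (u x') (v y) \<in> carrier P" if "x' \<in> insert x U" "y \<in> V" for x' y
      using that insert.prems assms(8) by (auto intro!: bilinear_map_closed[OF assms(4)])
    have "finsum P (\<lambda>(x, y). \<beta> (u x) (v y)) (insert x U \<times> V) =
        finsum P (\<lambda>(x, y). \<beta> (u x) (v y)) (Pair x ` V \<union> U \<times> V)"
      by (rule arg_cong) auto
    also have "\<dots> = finsum P (\<lambda>(x, y). \<beta> (u x) (v y)) (Pair x ` V) \<oplus>\<^bsub>P\<^esub>
        finsum P (\<lambda>(x, y). \<beta> (u x) (v y)) (U \<times> V)"
      using insert(1,2) assms(6) b by (intro P.M.finsum_Un_disjoint) auto
    also have "finsum P (\<lambda>(x, y). \<beta> (u x) (v y)) (Pair x ` V) = finsum P (\<lambda>y. \<beta> (u x) (v y)) V"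
      using b by (subst P.M.finsum_reindex) (auto simp: inj_on_def)
    also have "\<dots> = \<beta> (u x) (finsum N v V)"
      by (rule mod_hom_finsum[OF lm(2,3) bilinear_map_right[OF assms(4) u(1)] assms(8), symmetric])
    also have "finsum P (\<lambda>(x, y). \<beta> (u x) (v y)) (U \<times> V) = \<beta> (finsum M u U) (finsum N v V)"
      using insert(3)[OF u(2)] by simp
    finally show ?case
      using mod_hom_add[OF bilinear_map_left[OF assms(4) v] u(1)] u insert(1,2) by simp
  qed
qed

text \<open>If \<open>M\<close> is a retract of \<open>K\<^bsup>(X)\<^esup>\<close> through \<open>i\<close> and
  \<open>q\<close>, then \<open>A \<otimes> M\<close> is a retract of \<open>A\<^bsup>(X)\<^esup>\<close>: the coordinates of
  \<open>a \<otimes> m\<close> are \<open>(i m x) a\<close>, and the basis vector of \<open>x\<close> goes to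
  \<open>1 \<otimes> q x\<close>.\<close>

lemma projective_base_change:
  fixes M :: "('k, 'm, 'e) module_scheme"
  assumes A: "unital_algebra K A" and M: "module K M" and proj: "projective_module K M"
  shows "projective_module A (base_change K A M)"
proof -
  interpret A: unital_algebra K A by (rule A)
  interpret M: module K M by (rule M)
  interpret tensor_factors K A M ..
  interpret T: module K "tensor K A M" by (rule tensor_module)
  let ?T = "tensor K A M" and ?B = "base_change K A M"
  have sb: "bilinear_map K A M ?T (\<lambda>b m. pure_tensor K A M (a \<otimes>\<^bsub>A\<^esub> b) m)" if "a \<in> carrier A" for a
    using that by (intro lin A.module M A.A.m_closed A)
  have sh: "(\<lambda>t. a \<odot>\<^bsub>?B\<^esub> t) \<in> mod_hom K ?T ?T" if "a \<in> carrier A" for a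
    using tensor_lift_hom[OF tensor_module sb[OF that]] by (simp add: base_change_def Let_def)
  have sp: "a \<odot>\<^bsub>?B\<^esub> pure_tensor K A M b m = pure_tensor K A M (a \<otimes>\<^bsub>A\<^esub> b) m"
    if "a \<in> carrier A" "b \<in> carrier A" "m \<in> carrier M" for a b m
    using that by (simp add: base_change_def Let_def tensor_lift_pure tensor_module sb)
  note pt = pure_tensor_bilinear
  note pl = mod_hom_add[OF bilinear_map_left[OF pt]]
  have sc: "a \<odot>\<^bsub>?B\<^esub> t \<in> carrier ?T" if "a \<in> carrier A" "t \<in> carrier ?T" for a t
    using that by (rule mod_hom_closed[OF sh])
  have ag: "abelian_group ?B"
    by (rule abelian_group_cong[OF T.M.abelian_group_axioms]) simp_all
  have lm: "left_module A ?B"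
  proof (intro left_module.intro left_module_axioms.intro ag A.A.ring_axioms)
    fix a b t assume a: "a \<in> carrier A" and b: "b \<in> carrier A" and "t \<in> carrier ?B"
    then have t: "t \<in> carrier ?T" by simp
    show "(a \<oplus>\<^bsub>A\<^esub> b) \<odot>\<^bsub>?B\<^esub> t = a \<odot>\<^bsub>?B\<^esub> t \<oplus>\<^bsub>?B\<^esub> b \<odot>\<^bsub>?B\<^esub> t"
      unfolding base_change_simps
      by (rule tensor_hom_eqI[OF sh mod_hom_addf[OF tensor_module sh sh] _ t])
        (use a b in \<open>simp_all add: sp A.A.l_distr pl\<close>)
    show "(a \<otimes>\<^bsub>A\<^esub> b) \<odot>\<^bsub>?B\<^esub> t = a \<odot>\<^bsub>?B\<^esub> (b \<odot>\<^bsub>?B\<^esub> t)"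
      by (rule tensor_hom_eqI[OF sh mod_hom_compose[OF sh sh] _ t])
        (use a b in \<open>simp_all add: sp A.A.m_assoc\<close>)
  next
    fix t assume "t \<in> carrier ?B"
    then have t: "t \<in> carrier ?T" by simp
    show "\<one>\<^bsub>A\<^esub> \<odot>\<^bsub>?B\<^esub> t = t"
      by (rule tensor_hom_eqI[OF sh mod_hom_id _ t]) (simp_all add: sp)
  qed (simp_all add: sc mod_hom_add[OF sh])
  interpret B: left_module A ?B by (rule lm)
  obtain X :: "'m set" and i q where i: "i \<in> mod_hom K M (free_module K X)"
    and q: "q \<in> mod_hom K (free_module K X) M" and qi: "\<And>x. x \<in> carrier M \<Longrightarrow> q (i x) = x"
    using proj unfolding projective_module_def by auto
  have iX: "i m x \<in> carrier K" "x \<notin> X \<Longrightarrow> i m x = \<zero>\<^bsub>K\<^esub>" "finite {x. i m x \<noteq> \<zero>\<^bsub>K\<^esub>}"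
    if "m \<in> carrier M" for m x
    using mod_hom_closed[OF i that] by (cases "x \<in> X"; auto simp: free_module_def)+
  have ih: "(\<lambda>m. i m x) \<in> mod_hom K M (ground_algebra K)" for x
    by (rule mod_homI)
      (simp_all add: ground_algebra_def iX mod_hom_add[OF i] mod_hom_smult[OF i], simp_all add: free_module_def)
  let ?I = "\<lambda>t x. tensor_lift K A (\<lambda>a m. i m x \<odot>\<^bsub>A\<^esub> a) t"
  have ib: "bilinear_map K A M A (\<lambda>a m. i m x \<odot>\<^bsub>A\<^esub> a)" for x
    by (intro lin A.module ih iX)
  note Ih = tensor_lift_hom[OF A.module ib] and Ip = tensor_lift_pure[OF A.module ib]
  have If: "?I t \<in> carrier (free_module A X)" if "t \<in> carrier ?T" for t
  proof -
    have "finite {x. ?I t x \<noteq> \<zero>\<^bsub>A\<^esub>} \<and> (\<forall>x. x \<notin> X \<longrightarrow> ?I t x = \<zero>\<^bsub>A\<^esub>)"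
      using that
    proof (induct rule: tensor_induct)
      case (pure a m)
      have "{x. ?I (pure_tensor K A M a m) x \<noteq> \<zero>\<^bsub>A\<^esub>} \<subseteq> {x. i m x \<noteq> \<zero>\<^bsub>K\<^esub>}"
        using pure by (auto simp: Ip)
      then show ?case using pure iX(2,3) by (auto simp: Ip intro: finite_subset)
    next
      case (add s t)
      have "{x. ?I (s \<oplus>\<^bsub>?T\<^esub> t) x \<noteq> \<zero>\<^bsub>A\<^esub>} \<subseteq> {x. ?I s x \<noteq> \<zero>\<^bsub>A\<^esub>} \<union> {x. ?I t x \<noteq> \<zero>\<^bsub>A\<^esub>}"
        using add by (auto simp: mod_hom_add[OF Ih])
      then show ?case using add by (auto simp: mod_hom_add[OF Ih] intro: finite_subset)
    qed
    then show ?thesis using mod_hom_closed[OF Ih that] by (auto simp: free_module_def)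
  qed
  have Im: "?I \<in> mod_hom A ?B (free_module A X)"
  proof (rule mod_homI)
    fix a t assume a: "a \<in> carrier A" and "t \<in> carrier ?B"
    then have t: "t \<in> carrier ?T" by simp
    have "?I (a \<odot>\<^bsub>?B\<^esub> t) x = a \<otimes>\<^bsub>A\<^esub> ?I t x" for x
      by (rule tensor_hom_eqI[OF mod_hom_compose[OF sh Ih] mod_hom_mult_right[OF A a Ih] _ t])
        (simp_all add: a sp Ip iX A.smult_mult_right)
    then show "?I (a \<odot>\<^bsub>?B\<^esub> t) = a \<odot>\<^bsub>free_module A X\<^esub> ?I t" by (simp add: free_module_def)
  qed (simp_all add: If mod_hom_add[OF Ih], simp add: free_module_def)
  let ?u = "\<lambda>x. pure_tensor K A M \<one>\<^bsub>A\<^esub> (q (free_basis K x))"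
  have e: "q (free_basis K x) \<in> carrier M" if "x \<in> X" for x
    by (rule mod_hom_closed[OF q free_basis_carrier[OF A.R.ring_axioms that]])
  have u: "?u \<in> X \<rightarrow> carrier ?B" by (simp add: pure_tensor_closed e)
  note l = B.lincomb_hom[OF u]
  have qI: "lincomb A ?B ?u (?I t) = t" if "t \<in> carrier ?T" for t
    using that
  proof (induct rule: tensor_induct)
    case (pure a m)
    let ?U = "{x. i m x \<noteq> \<zero>\<^bsub>K\<^esub>}"
    have U: "finite ?U" "?U \<subseteq> X" using iX pure by auto
    have "lincomb A ?B ?u (?I (pure_tensor K A M a m)) =
        finsum ?B (\<lambda>x. ?I (pure_tensor K A M a m) x \<odot>\<^bsub>?B\<^esub> ?u x) ?U"
      by (rule B.lincomb_superset[OF u If]) (use pure U in \<open>auto simp: Ip pure_tensor_closed\<close>)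
    also have "\<dots> = finsum ?B (\<lambda>x. pure_tensor K A M a (i m x \<odot>\<^bsub>M\<^esub> q (free_basis K x))) ?U"
    proof (rule B.M.finsum_cong'[OF refl])
      show "(\<lambda>x. pure_tensor K A M a (i m x \<odot>\<^bsub>M\<^esub> q (free_basis K x))) \<in> ?U \<rightarrow> carrier ?B"
        using pure U e iX by (auto intro!: pure_tensor_closed)
      fix x assume "x \<in> ?U"
      then have x: "x \<in> X" using U by auto
      show "?I (pure_tensor K A M a m) x \<odot>\<^bsub>?B\<^esub> ?u x = pure_tensor K A M a (i m x \<odot>\<^bsub>M\<^esub> q (free_basis K x))"
        using pure e[OF x] iX mod_hom_smult[OF bilinear_map_right[OF pt]] mod_hom_smult[OF bilinear_map_left[OF pt]]
        by (simp add: Ip sp)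
    qed
    also have "\<dots> = finsum ?T (\<lambda>x. pure_tensor K A M a (i m x \<odot>\<^bsub>M\<^esub> q (free_basis K x))) ?U"
      by (simp add: finsum_def finprod_def)
    also have "\<dots> = pure_tensor K A M a (finsum M (\<lambda>x. i m x \<odot>\<^bsub>M\<^esub> q (free_basis K x)) ?U)"
      using U e iX pure
      by (intro mod_hom_finsum[OF module_left_module[OF M] module_left_module[OF tensor_module]
        bilinear_map_right[OF pt pure(1)], symmetric]) auto
    also have "finsum M (\<lambda>x. i m x \<odot>\<^bsub>M\<^esub> q (free_basis K x)) ?U = m"
      using left_module.hom_eq_lincomb[OF module_left_module[OF M] q mod_hom_closed[OF i pure(2)]] qi[OF pure(2)]
      by (simp add: lincomb_def)
    finally show ?case .
  next
    case (add s t)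
    have "?I (s \<oplus>\<^bsub>?T\<^esub> t) = ?I s \<oplus>\<^bsub>free_module A X\<^esub> ?I t"
      using add mod_hom_add[OF Im, of s t] by simp
    then show ?case using add mod_hom_add[OF l If If] by simp
  qed
  show ?thesis
    by (rule projective_moduleI_retract_of_free[OF lm Im l]) (simp add: qI)
qed

lemma module_along_simps [simp]:
  "carrier (module_along \<phi> B) = carrier B" "(\<oplus>\<^bsub>module_along \<phi> B\<^esub>) = (\<oplus>\<^bsub>B\<^esub>)"
  "\<zero>\<^bsub>module_along \<phi> B\<^esub> = \<zero>\<^bsub>B\<^esub>" "r \<odot>\<^bsub>module_along \<phi> B\<^esub> x = \<phi> r \<otimes>\<^bsub>B\<^esub> x"
  by (simp_all add: module_along_def)

lemma finsum_module_along: "finsum (module_along \<phi> B) u U = finsum B u U"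
  by (simp add: finsum_def finprod_def)

lemma left_module_along:
  assumes "ring A" "ring B" and h: "\<phi> \<in> ring_hom A B"
  shows "left_module A (module_along \<phi> B)"
proof -
  interpret A: ring A by fact
  interpret B: ring B by fact
  have "abelian_group (module_along \<phi> B)"
    by (rule abelian_group_cong[OF B.abelian_group_axioms]) simp_all
  then show ?thesis
    using ring_hom_closed[OF h] ring_hom_add[OF h] ring_hom_mult[OF h] ring_hom_one[OF h]
    by (intro left_module.intro left_module_axioms.intro assms(1)) (simp_all add: B.l_distr B.r_distr B.m_assoc)
qed

text \<open>Retractions \<open>A\<^bsup>(X)\<^esup> \<rightarrow> B\<close> and
  \<open>A'\<^bsup>(X')\<^esup> \<rightarrow> B'\<close> tensor to a retraction
  \<open>(A \<otimes> A')\<^bsup>(X \<times> X')\<^esup> \<rightarrow> B \<otimes> B'\<close>: the coordinate of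
  \<open>b \<otimes> b'\<close> at \<open>(x, y)\<close> is the tensor product of the coordinate of
  \<open>b\<close> at \<open>x\<close> and that of \<open>b'\<close> at \<open>y\<close>. For these
  coordinates to be well defined on tensors, those of \<open>b\<close> and \<open>b'\<close> have to be
  \<open>K\<close>-linear, which follows from their linearity over \<open>A\<close> and
  \<open>A'\<close>.\<close>

lemma projective_tensor_algebra:
  fixes B :: "('k, 'b, 'e) module_scheme" and B' :: "('k, 'b', 'e') module_scheme"
  assumes A: "tensor_algebras K A A'" and B: "tensor_algebras K B B'"
    and f: "f \<in> alg_hom K A B" and g: "g \<in> alg_hom K A' B'"
    and P: "projective_module A (module_along f B)" and P': "projective_module A' (module_along g B')"
  shows "projective_module (tensor_algebra K A A') (module_along (tensor_map K B B' f g) (tensor_algebra K B B'))"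
proof -
  interpret A: tensor_algebras K A A' by (rule A)
  interpret B: tensor_algebras K B B' by (rule B)
  interpret TA: unital_algebra K A.TA by (rule A.unital_algebra_tensor)
  interpret TB: unital_algebra K B.TA by (rule B.unital_algebra_tensor)
  let ?\<Phi> = "tensor_map K B B' f g"
  let ?T = "tensor K B B'" and ?M = "module_along ?\<Phi> B.TA"
  note Fh = tensor_map_ring_hom(1)[OF A B f g] and Fp = tensor_map_ring_hom(2)[OF A B f g]
  have lm: "left_module A.TA ?M" by (rule left_module_along[OF TA.A.ring_axioms TB.A.ring_axioms Fh])
  interpret M: left_module A.TA ?M by (rule lm)
  have coord: "(\<lambda>b. i b x) \<in> mod_hom K C D"
    if C: "unital_algebra K C" and D: "unital_algebra K D" and h: "h \<in> alg_hom K D C"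
      and i: "i \<in> mod_hom D (module_along h C) (free_module D X)"
    for C :: "('k, 'x, 'y) module_scheme" and D :: "('k, 'z, 'w) module_scheme" and h i X and x :: 'u
  proof (rule mod_homI)
    interpret C: unital_algebra K C by (rule C)
    interpret D: unital_algebra K D by (rule D)
    have h: "h \<in> mod_hom K D C" "h \<in> ring_hom D C" using h by (auto simp: alg_hom_def)
    have c: "i b x \<in> carrier D" if "b \<in> carrier C" for b x
      using mod_hom_closed[OF i] that by (cases "x \<in> X") (auto simp: free_module_def)
    then show "i b x \<in> carrier D" if "b \<in> carrier C" for b using that .
    show "i (b \<oplus>\<^bsub>C\<^esub> b') x = i b x \<oplus>\<^bsub>D\<^esub> i b' x" if "b \<in> carrier C" "b' \<in> carrier C" for b b'
      using mod_hom_add[OF i, of b b'] that by (simp add: free_module_def)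
    show "i (r \<odot>\<^bsub>C\<^esub> b) x = r \<odot>\<^bsub>D\<^esub> i b x" if r: "r \<in> carrier K" and b: "b \<in> carrier C" for r b
    proof -
      \<comment> \<open>The scalar \<open>r\<close> of \<open>K\<close> acts like the element \<open>r 1\<close> of
        the acting algebra.\<close>
      have "r \<odot>\<^bsub>C\<^esub> b = (r \<odot>\<^bsub>D\<^esub> \<one>\<^bsub>D\<^esub>) \<odot>\<^bsub>module_along h C\<^esub> b"
        using r b ring_hom_one[OF h(2)] by (simp add: mod_hom_smult[OF h(1)] C.smult_mult_left)
      then have "i (r \<odot>\<^bsub>C\<^esub> b) x = (r \<odot>\<^bsub>D\<^esub> \<one>\<^bsub>D\<^esub>) \<otimes>\<^bsub>D\<^esub> i b x"
        using mod_hom_smult[OF i, of "r \<odot>\<^bsub>D\<^esub> \<one>\<^bsub>D\<^esub>" b] r b by (simp add: free_module_def)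
      then show ?thesis using r c[OF b] by (simp add: D.smult_mult_left)
    qed
  qed
  obtain X :: "'b set" and i q where i: "i \<in> mod_hom A (module_along f B) (free_module A X)"
    and q: "q \<in> mod_hom A (free_module A X) (module_along f B)" and qi: "\<And>x. x \<in> carrier B \<Longrightarrow> q (i x) = x"
    using P unfolding projective_module_def by auto
  obtain X' :: "'b' set" and i' q' where i': "i' \<in> mod_hom A' (module_along g B') (free_module A' X')"
    and q': "q' \<in> mod_hom A' (free_module A' X') (module_along g B')" and qi': "\<And>x. x \<in> carrier B' \<Longrightarrow> q' (i' x) = x"
    using P' unfolding projective_module_def by auto
  note c = coord[OF B.A.unital_algebra_axioms A.A.unital_algebra_axioms f i]
    and c' = coord[OF B.B.unital_algebra_axioms A.B.unital_algebra_axioms g i']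
  have iX: "i b x \<in> carrier A" "x \<notin> X \<Longrightarrow> i b x = \<zero>\<^bsub>A\<^esub>" "finite {x. i b x \<noteq> \<zero>\<^bsub>A\<^esub>}" if "b \<in> carrier B" for b x
    using mod_hom_closed[OF i, of b] that by (cases "x \<in> X"; auto simp: free_module_def)+
  have iX': "i' b x \<in> carrier A'" "x \<notin> X' \<Longrightarrow> i' b x = \<zero>\<^bsub>A'\<^esub>" "finite {x. i' b x \<noteq> \<zero>\<^bsub>A'\<^esub>}" if "b \<in> carrier B'" for b x
    using mod_hom_closed[OF i', of b] that by (cases "x \<in> X'"; auto simp: free_module_def)+
  have im: "i (f a \<otimes>\<^bsub>B\<^esub> b) x = a \<otimes>\<^bsub>A\<^esub> i b x" if "a \<in> carrier A" "b \<in> carrier B" for a b x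
    using mod_hom_smult[OF i, of a b] that by (simp add: free_module_def)
  have im': "i' (g a \<otimes>\<^bsub>B'\<^esub> b) x = a \<otimes>\<^bsub>A'\<^esub> i' b x" if "a \<in> carrier A'" "b \<in> carrier B'" for a b x
    using mod_hom_smult[OF i', of a b] that by (simp add: free_module_def)
  have fg: "a \<in> carrier A \<Longrightarrow> f a \<in> carrier B" "a' \<in> carrier A' \<Longrightarrow> g a' \<in> carrier B'" for a a'
    using f g by (auto simp: alg_hom_def intro: mod_hom_closed)
  let ?I = "\<lambda>t (x, y). tensor_lift K (tensor K A A') (\<lambda>b b'. pure_tensor K A A' (i b x) (i' b' y)) t"
  let ?F = "free_module A.TA (X \<times> X')"
  have ib: "bilinear_map K B B' (tensor K A A') (\<lambda>b b'. pure_tensor K A A' (i b x) (i' b' y))" for x y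
    by (intro lin A.A.module A.B.module c c' iX iX')
  note Ih = B.tensor_lift_hom[OF A.tensor_module ib] and Ip = B.tensor_lift_pure[OF A.tensor_module ib]
  have z: "pure_tensor K A A' \<zero>\<^bsub>A\<^esub> a' = \<zero>\<^bsub>tensor K A A'\<^esub>" if "a' \<in> carrier A'" for a'
    by (rule mod_hom_zero[OF module_left_module[OF A.A.module] module_left_module[OF A.tensor_module]
      bilinear_map_left[OF A.pure_tensor_bilinear that]])
  have z': "pure_tensor K A A' a \<zero>\<^bsub>A'\<^esub> = \<zero>\<^bsub>tensor K A A'\<^esub>" if "a \<in> carrier A" for a
    by (rule mod_hom_zero[OF module_left_module[OF A.B.module] module_left_module[OF A.tensor_module]
      bilinear_map_right[OF A.pure_tensor_bilinear that]])
  have Ic: "?I t xy \<in> carrier (tensor K A A')" if "t \<in> carrier ?T" for t xy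
    by (cases xy) (simp add: mod_hom_closed[OF Ih that])
  have Ia: "?I (s \<oplus>\<^bsub>?T\<^esub> t) xy = ?I s xy \<oplus>\<^bsub>tensor K A A'\<^esub> ?I t xy" if "s \<in> carrier ?T" "t \<in> carrier ?T" for s t xy
    by (cases xy) (simp add: mod_hom_add[OF Ih that])
  interpret TAm: module K "tensor K A A'" by (rule A.tensor_module)
  interpret TBm: module K ?T by (rule B.tensor_module)
  have If: "?I t \<in> carrier ?F" if "t \<in> carrier ?T" for t
  proof -
    have "finite {x. ?I t x \<noteq> \<zero>\<^bsub>tensor K A A'\<^esub>} \<and> (\<forall>x. x \<notin> X \<times> X' \<longrightarrow> ?I t x = \<zero>\<^bsub>tensor K A A'\<^esub>)"
      using that
    proof (induct rule: B.tensor_induct)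
      case (pure b b')
      have "{x. ?I (pure_tensor K B B' b b') x \<noteq> \<zero>\<^bsub>tensor K A A'\<^esub>} \<subseteq> {x. i b x \<noteq> \<zero>\<^bsub>A\<^esub>} \<times> {x. i' b' x \<noteq> \<zero>\<^bsub>A'\<^esub>}"
        using pure iX(1) iX'(1) by (auto simp: Ip z z')
      then have "finite {x. ?I (pure_tensor K B B' b b') x \<noteq> \<zero>\<^bsub>tensor K A A'\<^esub>}"
        by (rule finite_subset) (use pure iX(3) iX'(3) in auto)
      then show ?case using pure iX(1,2) iX'(1,2) by (auto simp: Ip z z')
    next
      case (add s t)
      have "{x. ?I (s \<oplus>\<^bsub>?T\<^esub> t) x \<noteq> \<zero>\<^bsub>tensor K A A'\<^esub>} \<subseteq>
          {x. ?I s x \<noteq> \<zero>\<^bsub>tensor K A A'\<^esub>} \<union> {x. ?I t x \<noteq> \<zero>\<^bsub>tensor K A A'\<^esub>}"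
        using add by (auto simp: mod_hom_add[OF Ih])
      then have "finite {x. ?I (s \<oplus>\<^bsub>?T\<^esub> t) x \<noteq> \<zero>\<^bsub>tensor K A A'\<^esub>}"
        by (rule finite_subset) (use add in auto)
      moreover have "?I (s \<oplus>\<^bsub>?T\<^esub> t) x = \<zero>\<^bsub>tensor K A A'\<^esub>" if "x \<notin> X \<times> X'" for x
        using that add by (cases x) (simp add: mod_hom_add[OF Ih])
      ultimately show ?case by blast
    qed
    then show ?thesis using Ic[OF that] by (auto simp: free_module_def)
  qed
  have ext: "s = t" if "\<And>x y. s (x, y) = t (x, y)" for s t :: "'b \<times> 'b' \<Rightarrow> _" using that by auto
  have Im: "?I \<in> mod_hom A.TA ?M ?F"
  proof (rule mod_homI)
    fix r t assume "r \<in> carrier A.TA" "t \<in> carrier ?M"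
    then have r: "r \<in> carrier (tensor K A A')" and t: "t \<in> carrier ?T" by simp_all
    note la = A.tensor_mult_left_linear[simplified] B.tensor_mult_left_linear[simplified]
      and ra = A.tensor_mult_right_linear[simplified] B.tensor_mult_right_linear[simplified]
    have "?I (?\<Phi> r \<otimes>\<^bsub>B.TA\<^esub> t) (x, y) = r \<otimes>\<^bsub>A.TA\<^esub> ?I t (x, y)" for x y
      using r
    proof (induct rule: A.tensor_induct)
      case (pure a a')
      have F: "?\<Phi> (pure_tensor K A A' a a') \<in> carrier ?T"
        using ring_hom_closed[OF Fh] pure by (simp add: A.pure_tensor_closed)
      show ?case unfolding prod.case
      proof (rule B.tensor_hom_eqI[OF mod_hom_compose[OF ra(2)[OF F] Ih] mod_hom_compose[OF Ih ra(1)] _ t])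
        show "pure_tensor K A A' a a' \<in> carrier (tensor K A A')" by (rule A.pure_tensor_closed[OF pure])
      qed (use pure iX iX' in \<open>simp add: Fp B.tensor_mult_pure fg Ip im im' A.tensor_mult_pure\<close>)
    next
      case (add r s)
      have F: "?\<Phi> r \<in> carrier ?T" "?\<Phi> s \<in> carrier ?T"
        using ring_hom_closed[OF Fh] add by simp_all
      have "?\<Phi> (r \<oplus>\<^bsub>tensor K A A'\<^esub> s) = ?\<Phi> r \<oplus>\<^bsub>?T\<^esub> ?\<Phi> s"
        using ring_hom_add[OF Fh] add by simp
      then show ?case
        using add F t Ic[OF t, of "(x, y)"] mod_hom_closed[OF la(2)[OF t]]
        by (simp add: mod_hom_add[OF la(1)] mod_hom_add[OF la(2)] mod_hom_add[OF Ih])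
    qed
    then show "?I (r \<odot>\<^bsub>?M\<^esub> t) = r \<odot>\<^bsub>?F\<^esub> ?I t" by (intro ext) (simp add: free_module_def)
  next
    fix s t assume "s \<in> carrier ?M" "t \<in> carrier ?M"
    then show "?I (s \<oplus>\<^bsub>?M\<^esub> t) = ?I s \<oplus>\<^bsub>?F\<^esub> ?I t"
      by (intro ext) (simp add: free_module_def mod_hom_add[OF Ih])
  qed (use If in simp)
  let ?u = "\<lambda>(x, y). pure_tensor K B B' (q (free_basis A x)) (q' (free_basis A' y))"
  have e: "q (free_basis A x) \<in> carrier B" if "x \<in> X" for x
    using mod_hom_closed[OF q free_basis_carrier[OF A.A.A.ring_axioms that]] by simp
  have e': "q' (free_basis A' x) \<in> carrier B'" if "x \<in> X'" for x
    using mod_hom_closed[OF q' free_basis_carrier[OF A.B.A.ring_axioms that]] by simp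
  have u: "?u \<in> X \<times> X' \<rightarrow> carrier ?M" using e e' by (auto intro!: B.pure_tensor_closed)
  note l = M.lincomb_hom[OF u]
  have lmB: "left_module A (module_along f B)" "left_module A' (module_along g B')"
    using P P' by (auto simp: projective_module_def)
  have qI: "lincomb A.TA ?M ?u (?I t) = t" if "t \<in> carrier ?T" for t
    using that
  proof (induct rule: B.tensor_induct)
    case (pure b b')
    let ?U = "{x. i b x \<noteq> \<zero>\<^bsub>A\<^esub>}" and ?V = "{x. i' b' x \<noteq> \<zero>\<^bsub>A'\<^esub>}"
    let ?v = "\<lambda>x. f (i b x) \<otimes>\<^bsub>B\<^esub> q (free_basis A x)" and ?v' = "\<lambda>x. g (i' b' x) \<otimes>\<^bsub>B'\<^esub> q' (free_basis A' x)"
    have U: "finite ?U" "?U \<subseteq> X" "finite ?V" "?V \<subseteq> X'" using iX[OF pure(1)] iX'[OF pure(2)] by auto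
    have v: "?v \<in> ?U \<rightarrow> carrier B" "?v' \<in> ?V \<rightarrow> carrier B'"
      using U e e' fg iX[OF pure(1)] iX'[OF pure(2)] A.A.A.one_closed A.B.A.one_closed
      by (auto intro!: B.A.A.m_closed B.B.A.m_closed)
    have "lincomb A.TA ?M ?u (?I (pure_tensor K B B' b b')) =
        finsum ?M (\<lambda>x. ?I (pure_tensor K B B' b b') x \<odot>\<^bsub>?M\<^esub> ?u x) (?U \<times> ?V)"
      by (rule M.lincomb_superset[OF u If])
        (use pure U iX(1) iX'(1) in \<open>auto simp: Ip z z' B.pure_tensor_closed\<close>)
    also have "\<dots> = finsum ?M (\<lambda>(x, y). pure_tensor K B B' (?v x) (?v' y)) (?U \<times> ?V)"
    proof (rule M.M.finsum_cong'[OF refl])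
      show "(\<lambda>(x, y). pure_tensor K B B' (?v x) (?v' y)) \<in> ?U \<times> ?V \<rightarrow> carrier ?M"
        using v by (auto intro!: B.pure_tensor_closed)
      fix xy assume "xy \<in> ?U \<times> ?V"
      then obtain x y where xy: "xy = (x, y)" "x \<in> X" "y \<in> X'" using U by auto
      then show "?I (pure_tensor K B B' b b') xy \<odot>\<^bsub>?M\<^esub> ?u xy = (case xy of (x, y) \<Rightarrow> pure_tensor K B B' (?v x) (?v' y))"
        using pure e e' iX iX' fg by (simp add: Ip Fp B.tensor_mult_pure)
    qed
    also have "\<dots> = finsum ?T (\<lambda>(x, y). pure_tensor K B B' (?v x) (?v' y)) (?U \<times> ?V)"
      by (simp add: finsum_def finprod_def)
    also have "\<dots> = pure_tensor K B B' (finsum B ?v ?U) (finsum B' ?v' ?V)"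
      by (rule bilinear_map_finsum[OF B.A.module B.B.module B.tensor_module B.pure_tensor_bilinear U(1,3) v, symmetric])
    also have "finsum B ?v ?U = b"
      using left_module.hom_eq_lincomb[OF lmB(1) q mod_hom_closed[OF i]] qi pure
      by (simp add: lincomb_def finsum_module_along)
    also have "finsum B' ?v' ?V = b'"
      using left_module.hom_eq_lincomb[OF lmB(2) q' mod_hom_closed[OF i']] qi' pure
      by (simp add: lincomb_def finsum_module_along)
    finally show ?case .
  next
    case (add s t)
    have "?I (s \<oplus>\<^bsub>?T\<^esub> t) = ?I s \<oplus>\<^bsub>?F\<^esub> ?I t"
      using add mod_hom_add[OF Im, of s t] by simp
    then show ?case using add mod_hom_add[OF l If If] by simp
  qed
  show ?thesis
    by (rule projective_moduleI_retract_of_free[OF lm Im l]) (simp add: qI)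
qed

section \<open>Sweedler calculus\<close>

lemma tensor_lift_tensor_algebra [simp]:
  "tensor_lift K (tensor_algebra K A B) = tensor_lift K (tensor K A B)"
  by (simp add: fun_eq_iff tensor_lift_def lincomb_def finsum_def finprod_def)

context hopf_algebra
begin

sublocale HH: tensor_algebras K H H ..

lemma comult_linear: "\<Delta> \<in> mod_hom K H (tensor K H H)"
  and comult_ring_hom: "\<Delta> \<in> ring_hom H (tensor_algebra K H H)"
  using comult_hom by (auto simp: alg_hom_def)

lemma comult_closed: "h \<in> carrier H \<Longrightarrow> \<Delta> h \<in> carrier (tensor K H H)"
  by (rule mod_hom_closed[OF comult_linear])

lemma counit_linear: "\<epsilon> \<in> mod_hom K H (ground_algebra K)"
  using counit_hom by (auto simp: alg_hom_def)

lemma counit_closed: "h \<in> carrier H \<Longrightarrow> \<epsilon> h \<in> carrier K"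
  using mod_hom_closed[OF counit_linear] by (simp add: ground_algebra_def)

lemma antipode_closed: "h \<in> carrier H \<Longrightarrow> S h \<in> carrier H"
  by (rule mod_hom_closed[OF antipode_linear])

lemmas [lin] = mod_hom_compose[OF _ comult_linear] mod_hom_compose[OF _ antipode_linear]
  mod_hom_compose[OF _ counit_linear]

lemmas tensor_mult_lin [lin] =
  mod_hom_mult_left[OF HH.unital_algebra_tensor, simplified]
  mod_hom_mult_right[OF HH.unital_algebra_tensor, simplified]

text \<open>The expression \<open>\<beta> h\<^sub>1 h\<^sub>2\<close>. Further indices are obtained by nesting:
  \<open>F h\<^sub>1 h\<^sub>2 h\<^sub>3\<close> has the two forms related by \<open>sweedler_coassoc\<close>.\<close>

definition sweedler :: "('k, 'p, 'f) module_scheme \<Rightarrow> ('h \<Rightarrow> 'h \<Rightarrow> 'p) \<Rightarrow> 'h \<Rightarrow> 'p"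
  where "sweedler P \<beta> h = tensor_lift K P \<beta> (\<Delta> h)"

lemma sweedler_linear_arg [lin]:
  "\<lbrakk>module K P; bilinear_map K H H P \<beta>; g \<in> mod_hom K L H\<rbrakk> \<Longrightarrow> (\<lambda>x. sweedler P \<beta> (g x)) \<in> mod_hom K L P"
  unfolding sweedler_def by (intro HH.tensor_lift_arg_linear mod_hom_compose[OF _ comult_linear])

lemma sweedler_linear_param [lin]:
  "\<lbrakk>module K L; module K P;
    \<And>u v. \<lbrakk>u \<in> carrier H; v \<in> carrier H\<rbrakk> \<Longrightarrow> (\<lambda>x. F x u v) \<in> mod_hom K L P;
    \<And>x. x \<in> carrier L \<Longrightarrow> bilinear_map K H H P (F x); h \<in> carrier H\<rbrakk> \<Longrightarrow>
    (\<lambda>x. sweedler P (F x) h) \<in> mod_hom K L P"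
  unfolding sweedler_def by (intro HH.tensor_lift_param_linear comult_closed)

lemma sweedler_closed:
  "\<lbrakk>module K P; bilinear_map K H H P \<beta>; h \<in> carrier H\<rbrakk> \<Longrightarrow> sweedler P \<beta> h \<in> carrier P"
  unfolding sweedler_def by (intro HH.tensor_lift_closed comult_closed)

lemma sweedler_cong:
  "\<lbrakk>module K P; bilinear_map K H H P \<beta>; h \<in> carrier H;
    \<And>x y. \<lbrakk>x \<in> carrier H; y \<in> carrier H\<rbrakk> \<Longrightarrow> \<gamma> x y = \<beta> x y\<rbrakk> \<Longrightarrow> sweedler P \<gamma> h = sweedler P \<beta> h"
  unfolding sweedler_def by (rule HH.tensor_lift_cong[OF _ _ comult_closed])

lemma hom_sweedler:
  "\<lbrakk>module K P; module K Q; bilinear_map K H H P \<beta>; g \<in> mod_hom K P Q; h \<in> carrier H\<rbrakk> \<Longrightarrow>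
    g (sweedler P \<beta> h) = sweedler Q (\<lambda>x y. g (\<beta> x y)) h"
  unfolding sweedler_def by (rule HH.hom_tensor_lift[OF _ _ _ _ comult_closed])

lemma sweedler_swap:
  assumes P: "module K P" and "h \<in> carrier H" "k \<in> carrier H"
    and 1: "\<And>n v w. \<lbrakk>n \<in> carrier H; v \<in> carrier H; w \<in> carrier H\<rbrakk> \<Longrightarrow> (\<lambda>m. F m n v w) \<in> mod_hom K H P"
    and 2: "\<And>m v w. \<lbrakk>m \<in> carrier H; v \<in> carrier H; w \<in> carrier H\<rbrakk> \<Longrightarrow> (\<lambda>n. F m n v w) \<in> mod_hom K H P"
    and 3: "\<And>m n w. \<lbrakk>m \<in> carrier H; n \<in> carrier H; w \<in> carrier H\<rbrakk> \<Longrightarrow> (\<lambda>v. F m n v w) \<in> mod_hom K H P"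
    and 4: "\<And>m n v. \<lbrakk>m \<in> carrier H; n \<in> carrier H; v \<in> carrier H\<rbrakk> \<Longrightarrow> (\<lambda>w. F m n v w) \<in> mod_hom K H P"
  shows "sweedler P (\<lambda>m n. sweedler P (\<lambda>v w. F m n v w) k) h =
    sweedler P (\<lambda>v w. sweedler P (\<lambda>m n. F m n v w) h) k"
  unfolding sweedler_def
  by (rule HH.tensor_lift_swap[OF P HH.tensor_factors_axioms comult_closed comult_closed])
    (use assms in auto)

text \<open>The trilinear \<open>F\<close> induces a linear map \<open>G\<close> on
  \<open>H \<otimes> (H \<otimes> H)\<close>; this is \<open>G\<close> applied to both sides of the coassociativity
  axiom.\<close>

lemma sweedler_coassoc:
  assumes P: "module K P" and h: "h \<in> carrier H"
    and 1: "\<And>y z. \<lbrakk>y \<in> carrier H; z \<in> carrier H\<rbrakk> \<Longrightarrow> (\<lambda>x. F x y z) \<in> mod_hom K H P"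
    and 2: "\<And>x z. \<lbrakk>x \<in> carrier H; z \<in> carrier H\<rbrakk> \<Longrightarrow> (\<lambda>y. F x y z) \<in> mod_hom K H P"
    and 3: "\<And>x y. \<lbrakk>x \<in> carrier H; y \<in> carrier H\<rbrakk> \<Longrightarrow> (\<lambda>z. F x y z) \<in> mod_hom K H P"
  shows "sweedler P (\<lambda>x z. sweedler P (\<lambda>u v. F u v z) x) h =
    sweedler P (\<lambda>x y. sweedler P (\<lambda>u v. F x u v) y) h"
proof -
  let ?H2 = "tensor K H H"
  have m: "module K H" by (rule module)
  have m2: "module K ?H2" by (rule HH.tensor_module)
  interpret L: tensor_factors K ?H2 H using m m2 by (simp add: tensor_factors_def)
  interpret R: tensor_factors K H ?H2 using m m2 by (simp add: tensor_factors_def)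
  let ?H3 = "tensor K H ?H2"
  note m3 = R.tensor_module
  have bF: "bilinear_map K H H P (\<lambda>u v. F x u v)" if "x \<in> carrier H" for x
    using that by (intro lin 2 3)
  have bF': "bilinear_map K H H P (\<lambda>u v. F u v z)" if "z \<in> carrier H" for z
    using that by (intro lin 1 2)
  let ?g = "\<lambda>x t. tensor_lift K P (\<lambda>u v. F x u v) t"
  have bg: "bilinear_map K H ?H2 P ?g"
    by (intro lin HH.tensor_lift_param_linear HH.tensor_lift_hom P m 1 bF)
  let ?G = "tensor_lift K P ?g"
  have G: "?G \<in> mod_hom K ?H3 P" by (rule R.tensor_lift_hom[OF P bg])
  have Gp: "?G (pure_tensor K H ?H2 x t) = ?g x t" if "x \<in> carrier H" "t \<in> carrier ?H2" for x t
    using that by (rule R.tensor_lift_pure[OF P bg])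
  let ?\<alpha> = "\<lambda>s n. tensor_lift K ?H3 (\<lambda>l m. pure_tensor K H ?H2 l (pure_tensor K H H m n)) s"
  have ba: "bilinear_map K H H ?H3 (\<lambda>l m. pure_tensor K H ?H2 l (pure_tensor K H H m n))"
    if "n \<in> carrier H" for n
    using that by (intro lin m m2 HH.pure_tensor_closed)
  have b\<alpha>: "bilinear_map K ?H2 H ?H3 ?\<alpha>"
    by (intro lin HH.tensor_lift_hom HH.tensor_lift_param_linear m m2 m3 ba HH.pure_tensor_closed)
  have \<alpha>: "tensor_assoc K H H H = tensor_lift K ?H3 ?\<alpha>" by (simp add: tensor_assoc_def Let_def)
  have A: "tensor_assoc K H H H \<in> mod_hom K (tensor K ?H2 H) ?H3"
    unfolding \<alpha> by (rule L.tensor_lift_hom[OF m3 b\<alpha>])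
  have bl: "bilinear_map K H H (tensor K ?H2 H) (\<lambda>a b. pure_tensor K ?H2 H (\<Delta> a) (id b))"
    unfolding id_def by (intro lin m m2 comult_closed)
  have br: "bilinear_map K H H ?H3 (\<lambda>a b. pure_tensor K H ?H2 (id a) (\<Delta> b))"
    unfolding id_def by (intro lin m m2 comult_closed)
  have bL: "bilinear_map K H H P (\<lambda>x z. sweedler P (\<lambda>u v. F u v z) x)"
    by (intro lin P m 1 2 3)
  have bR: "bilinear_map K H H P (\<lambda>x y. sweedler P (\<lambda>u v. F x u v) y)"
    by (intro lin P m 1 2 3)
  have "?G (tensor_assoc K H H H (tensor_map K ?H2 H \<Delta> id (\<Delta> h))) =
      sweedler P (\<lambda>a b. ?G (tensor_assoc K H H H (pure_tensor K ?H2 H (\<Delta> a) (id b)))) h"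
    unfolding tensor_map_def sweedler_def
    by (rule HH.hom_tensor_lift[OF L.tensor_module P bl mod_hom_compose[OF A G] comult_closed[OF h]])
  also have "\<dots> = sweedler P (\<lambda>x z. sweedler P (\<lambda>u v. F u v z) x) h"
  proof (rule sweedler_cong[OF P bL h])
    fix a b assume a: "a \<in> carrier H" and b: "b \<in> carrier H"
    have "?G (tensor_assoc K H H H (pure_tensor K ?H2 H (\<Delta> a) (id b))) = ?G (?\<alpha> (\<Delta> a) b)"
      unfolding \<alpha> using a b by (simp add: L.tensor_lift_pure[OF m3 b\<alpha>] comult_closed)
    also have "\<dots> = tensor_lift K P (\<lambda>l m. ?G (pure_tensor K H ?H2 l (pure_tensor K H H m b))) (\<Delta> a)"
      by (rule HH.hom_tensor_lift[OF m3 P ba[OF b] G comult_closed[OF a]])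
    also have "\<dots> = tensor_lift K P (\<lambda>u v. F u v b) (\<Delta> a)"
      by (rule HH.tensor_lift_cong[OF P bF'[OF b] comult_closed[OF a]])
        (simp add: Gp HH.pure_tensor_closed b HH.tensor_lift_pure[OF P bF])
    finally show "?G (tensor_assoc K H H H (pure_tensor K ?H2 H (\<Delta> a) (id b))) = sweedler P (\<lambda>u v. F u v b) a"
      by (simp add: sweedler_def)
  qed
  finally have "?G (tensor_assoc K H H H (tensor_map K ?H2 H \<Delta> id (\<Delta> h))) =
    sweedler P (\<lambda>x z. sweedler P (\<lambda>u v. F u v z) x) h" .
  moreover have "?G (tensor_map K H ?H2 id \<Delta> (\<Delta> h)) = sweedler P (\<lambda>a b. ?G (pure_tensor K H ?H2 (id a) (\<Delta> b))) h"
    unfolding tensor_map_def sweedler_def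
    by (rule HH.hom_tensor_lift[OF R.tensor_module P br G comult_closed[OF h]])
  moreover have "\<dots> = sweedler P (\<lambda>x y. sweedler P (\<lambda>u v. F x u v) y) h"
    by (rule sweedler_cong[OF P bR h]) (simp add: Gp comult_closed sweedler_def)
  ultimately show ?thesis using coassoc[OF h] by simp
qed

lemma sweedler_counit_left:
  assumes P: "module K P" and g: "g \<in> mod_hom K H P" and h: "h \<in> carrier H"
  shows "sweedler P (\<lambda>x y. \<epsilon> x \<odot>\<^bsub>P\<^esub> g y) h = g h"
proof -
  have b: "bilinear_map K H H P (\<lambda>x y. \<epsilon> x \<odot>\<^bsub>P\<^esub> g y)"
    by (intro lin P g counit_closed mod_hom_closed[OF g])
  have b': "bilinear_map K H H H (\<lambda>x y. \<epsilon> x \<odot>\<^bsub>H\<^esub> y)"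
    by (intro lin module counit_closed)
  have "g h = g (sweedler H (\<lambda>x y. \<epsilon> x \<odot>\<^bsub>H\<^esub> y) h)"
    using counit_left[OF h] by (simp add: sweedler_def)
  also have "\<dots> = sweedler P (\<lambda>x y. g (\<epsilon> x \<odot>\<^bsub>H\<^esub> y)) h"
    by (rule hom_sweedler[OF module P b' g h])
  also have "\<dots> = sweedler P (\<lambda>x y. \<epsilon> x \<odot>\<^bsub>P\<^esub> g y) h"
    by (rule sweedler_cong[OF P b h]) (simp add: mod_hom_smult[OF g] counit_closed)
  finally show ?thesis by simp
qed

lemma sweedler_counit_right:
  assumes P: "module K P" and g: "g \<in> mod_hom K H P" and h: "h \<in> carrier H"
  shows "sweedler P (\<lambda>x y. \<epsilon> y \<odot>\<^bsub>P\<^esub> g x) h = g h"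
proof -
  have b: "bilinear_map K H H P (\<lambda>x y. \<epsilon> y \<odot>\<^bsub>P\<^esub> g x)"
    by (intro lin P g counit_closed mod_hom_closed[OF g])
  have b': "bilinear_map K H H H (\<lambda>x y. \<epsilon> y \<odot>\<^bsub>H\<^esub> x)"
    by (intro lin module counit_closed)
  have "g h = g (sweedler H (\<lambda>x y. \<epsilon> y \<odot>\<^bsub>H\<^esub> x) h)"
    using counit_right[OF h] by (simp add: sweedler_def)
  also have "\<dots> = sweedler P (\<lambda>x y. g (\<epsilon> y \<odot>\<^bsub>H\<^esub> x)) h"
    by (rule hom_sweedler[OF module P b' g h])
  also have "\<dots> = sweedler P (\<lambda>x y. \<epsilon> y \<odot>\<^bsub>P\<^esub> g x) h"
    by (rule sweedler_cong[OF P b h]) (simp add: mod_hom_smult[OF g] counit_closed)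
  finally show ?thesis by simp
qed

lemma sweedler_antipode_left:
  assumes P: "module K P" and g: "g \<in> mod_hom K H P" and h: "h \<in> carrier H"
  shows "sweedler P (\<lambda>x y. g (S x \<otimes>\<^bsub>H\<^esub> y)) h = \<epsilon> h \<odot>\<^bsub>P\<^esub> g \<one>\<^bsub>H\<^esub>"
proof -
  have b: "bilinear_map K H H H (\<lambda>x y. S x \<otimes>\<^bsub>H\<^esub> y)"
    by (intro lin unital_algebra_axioms antipode_closed)
  have "sweedler P (\<lambda>x y. g (S x \<otimes>\<^bsub>H\<^esub> y)) h = g (sweedler H (\<lambda>x y. S x \<otimes>\<^bsub>H\<^esub> y) h)"
    by (rule hom_sweedler[OF module P b g h, symmetric])
  also have "\<dots> = \<epsilon> h \<odot>\<^bsub>P\<^esub> g \<one>\<^bsub>H\<^esub>"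
    using antipode_left[OF h] by (simp add: sweedler_def mod_hom_smult[OF g] counit_closed h)
  finally show ?thesis .
qed

lemma sweedler_antipode_right:
  assumes P: "module K P" and g: "g \<in> mod_hom K H P" and h: "h \<in> carrier H"
  shows "sweedler P (\<lambda>x y. g (x \<otimes>\<^bsub>H\<^esub> S y)) h = \<epsilon> h \<odot>\<^bsub>P\<^esub> g \<one>\<^bsub>H\<^esub>"
proof -
  have b: "bilinear_map K H H H (\<lambda>x y. x \<otimes>\<^bsub>H\<^esub> S y)"
    by (intro lin unital_algebra_axioms antipode_closed)
  have "sweedler P (\<lambda>x y. g (x \<otimes>\<^bsub>H\<^esub> S y)) h = g (sweedler H (\<lambda>x y. x \<otimes>\<^bsub>H\<^esub> S y) h)"
    by (rule hom_sweedler[OF module P b g h, symmetric])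
  also have "\<dots> = \<epsilon> h \<odot>\<^bsub>P\<^esub> g \<one>\<^bsub>H\<^esub>"
    using antipode_right[OF h] by (simp add: sweedler_def mod_hom_smult[OF g] counit_closed h)
  finally show ?thesis .
qed

lemma sweedler_one:
  assumes P: "module K P" and b: "bilinear_map K H H P \<beta>"
  shows "sweedler P \<beta> \<one>\<^bsub>H\<^esub> = \<beta> \<one>\<^bsub>H\<^esub> \<one>\<^bsub>H\<^esub>"
  using ring_hom_one[OF comult_ring_hom] by (simp add: sweedler_def HH.tensor_lift_pure[OF P b])

lemma sweedler_mult:
  assumes P: "module K P" and b: "bilinear_map K H H P \<beta>" and h: "h \<in> carrier H" and k: "k \<in> carrier H"
  shows "sweedler P \<beta> (h \<otimes>\<^bsub>H\<^esub> k) = sweedler P (\<lambda>x y. sweedler P (\<lambda>u v. \<beta> (x \<otimes>\<^bsub>H\<^esub> u) (y \<otimes>\<^bsub>H\<^esub> v)) k) h"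
proof -
  let ?T = "tensor K H H"
  note bl = HH.tensor_lift_hom[OF P b]
  note inner = HH.mult_inner_bilinear and outer = HH.mult_outer_bilinear[OF comult_closed[OF k]]
  have inner': "bilinear_map K H H P (\<lambda>u v. \<beta> (x \<otimes>\<^bsub>H\<^esub> u) (y \<otimes>\<^bsub>H\<^esub> v))" if "x \<in> carrier H" "y \<in> carrier H" for x y
    using that by (intro bilinear_mapI mod_hom_compose[OF _ bilinear_map_left[OF b]]
       mod_hom_compose[OF _ bilinear_map_right[OF b]] lin unital_algebra_axioms A.m_closed)
  have outer': "bilinear_map K H H P (\<lambda>x y. sweedler P (\<lambda>u v. \<beta> (x \<otimes>\<^bsub>H\<^esub> u) (y \<otimes>\<^bsub>H\<^esub> v)) k)"
    by (intro bilinear_mapI sweedler_linear_param P k inner' module mod_hom_compose[OF _ bilinear_map_left[OF b]]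
       mod_hom_compose[OF _ bilinear_map_right[OF b]] mod_hom_mult_left unital_algebra_axioms mod_hom_id A.m_closed)
  have "\<Delta> (h \<otimes>\<^bsub>H\<^esub> k) = \<Delta> h \<otimes>\<^bsub>tensor_algebra K H H\<^esub> \<Delta> k"
    by (rule ring_hom_mult[OF comult_ring_hom h k])
  also have "\<dots> = sweedler ?T (\<lambda>x y. sweedler ?T (\<lambda>u v. pure_tensor K H H (x \<otimes>\<^bsub>H\<^esub> u) (y \<otimes>\<^bsub>H\<^esub> v)) k) h"
    by (simp add: tensor_algebra_def Let_def sweedler_def)
  finally have "sweedler P \<beta> (h \<otimes>\<^bsub>H\<^esub> k) =
      tensor_lift K P \<beta> (sweedler ?T (\<lambda>x y. sweedler ?T (\<lambda>u v. pure_tensor K H H (x \<otimes>\<^bsub>H\<^esub> u) (y \<otimes>\<^bsub>H\<^esub> v)) k) h)"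
    by (simp add: sweedler_def)
  also have "\<dots> = sweedler P (\<lambda>x y. tensor_lift K P \<beta> (sweedler ?T (\<lambda>u v. pure_tensor K H H (x \<otimes>\<^bsub>H\<^esub> u) (y \<otimes>\<^bsub>H\<^esub> v)) k)) h"
    using outer by (intro hom_sweedler[OF HH.tensor_module P _ bl h]) (simp add: sweedler_def)
  also have "\<dots> = sweedler P (\<lambda>x y. sweedler P (\<lambda>u v. \<beta> (x \<otimes>\<^bsub>H\<^esub> u) (y \<otimes>\<^bsub>H\<^esub> v)) k) h"
  proof (rule sweedler_cong[OF P outer' h])
    fix x y assume xy: "x \<in> carrier H" "y \<in> carrier H"
    have "tensor_lift K P \<beta> (sweedler ?T (\<lambda>u v. pure_tensor K H H (x \<otimes>\<^bsub>H\<^esub> u) (y \<otimes>\<^bsub>H\<^esub> v)) k) =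
        sweedler P (\<lambda>u v. tensor_lift K P \<beta> (pure_tensor K H H (x \<otimes>\<^bsub>H\<^esub> u) (y \<otimes>\<^bsub>H\<^esub> v))) k"
      by (rule hom_sweedler[OF HH.tensor_module P inner[OF xy] bl k])
    also have "\<dots> = sweedler P (\<lambda>u v. \<beta> (x \<otimes>\<^bsub>H\<^esub> u) (y \<otimes>\<^bsub>H\<^esub> v)) k"
      by (rule sweedler_cong[OF P inner'[OF xy] k]) (simp add: HH.tensor_lift_pure[OF P b] xy)
    finally show "tensor_lift K P \<beta> (sweedler ?T (\<lambda>u v. pure_tensor K H H (x \<otimes>\<^bsub>H\<^esub> u) (y \<otimes>\<^bsub>H\<^esub> v)) k) =
      sweedler P (\<lambda>u v. \<beta> (x \<otimes>\<^bsub>H\<^esub> u) (y \<otimes>\<^bsub>H\<^esub> v)) k" .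
  qed
  finally show ?thesis .
qed

lemma sweedler_pure_tensor:
  assumes h: "h \<in> carrier H" shows "sweedler (tensor K H H) (pure_tensor K H H) h = \<Delta> h"
  unfolding sweedler_def
  by (rule HH.tensor_hom_eqI[OF HH.tensor_lift_hom[OF HH.tensor_module HH.pure_tensor_bilinear] mod_hom_id _ comult_closed[OF h]])
    (simp add: HH.tensor_lift_pure HH.tensor_module HH.pure_tensor_bilinear)

text \<open>The usual argument \<open>L = L * (M * R) = (L * M) * R = R\<close>, for the convolution product
  of linear maps from \<open>H\<close> to \<open>A\<close>.\<close>

lemma convolution_inverse_unique:
  assumes A: "unital_algebra K A"
    and L: "L \<in> mod_hom K H A" and M: "M \<in> mod_hom K H A" and R: "R \<in> mod_hom K H A"
    and LM: "\<And>h. h \<in> carrier H \<Longrightarrow> sweedler A (\<lambda>x y. L x \<otimes>\<^bsub>A\<^esub> M y) h = \<epsilon> h \<odot>\<^bsub>A\<^esub> \<one>\<^bsub>A\<^esub>"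
    and MR: "\<And>h. h \<in> carrier H \<Longrightarrow> sweedler A (\<lambda>x y. M x \<otimes>\<^bsub>A\<^esub> R y) h = \<epsilon> h \<odot>\<^bsub>A\<^esub> \<one>\<^bsub>A\<^esub>"
    and h: "h \<in> carrier H"
  shows "L h = R h"
proof -
  interpret A': unital_algebra K A by (rule A)
  note c = mod_hom_closed[OF L] mod_hom_closed[OF M] mod_hom_closed[OF R]
  note l = lin L M R c A A'.module module A'.A.m_closed mod_hom_compose[OF _ L] mod_hom_compose[OF _ M] mod_hom_compose[OF _ R]
  have "sweedler A (\<lambda>x y. sweedler A (\<lambda>u v. L x \<otimes>\<^bsub>A\<^esub> (M u \<otimes>\<^bsub>A\<^esub> R v)) y) h =
      sweedler A (\<lambda>x y. \<epsilon> y \<odot>\<^bsub>A\<^esub> L x) h"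
  proof (rule sweedler_cong[OF A'.module _ h])
    show "bilinear_map K H H A (\<lambda>x y. \<epsilon> y \<odot>\<^bsub>A\<^esub> L x)" by (intro l counit_closed)
    fix x y assume x: "x \<in> carrier H" and y: "y \<in> carrier H"
    have "sweedler A (\<lambda>u v. L x \<otimes>\<^bsub>A\<^esub> (M u \<otimes>\<^bsub>A\<^esub> R v)) y = L x \<otimes>\<^bsub>A\<^esub> sweedler A (\<lambda>u v. M u \<otimes>\<^bsub>A\<^esub> R v) y"
      using x y by (intro hom_sweedler[OF A'.module A'.module, symmetric] l)
    then show "sweedler A (\<lambda>u v. L x \<otimes>\<^bsub>A\<^esub> (M u \<otimes>\<^bsub>A\<^esub> R v)) y = \<epsilon> y \<odot>\<^bsub>A\<^esub> L x"
      by (simp add: MR x y c counit_closed A'.smult_mult_right)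
  qed
  moreover have "sweedler A (\<lambda>x z. sweedler A (\<lambda>u v. L u \<otimes>\<^bsub>A\<^esub> (M v \<otimes>\<^bsub>A\<^esub> R z)) x) h =
      sweedler A (\<lambda>x y. \<epsilon> x \<odot>\<^bsub>A\<^esub> R y) h"
  proof (rule sweedler_cong[OF A'.module _ h])
    show "bilinear_map K H H A (\<lambda>x y. \<epsilon> x \<odot>\<^bsub>A\<^esub> R y)" by (intro l counit_closed)
    fix x z assume x: "x \<in> carrier H" and z: "z \<in> carrier H"
    have "sweedler A (\<lambda>u v. L u \<otimes>\<^bsub>A\<^esub> (M v \<otimes>\<^bsub>A\<^esub> R z)) x = sweedler A (\<lambda>u v. (L u \<otimes>\<^bsub>A\<^esub> M v) \<otimes>\<^bsub>A\<^esub> R z) x"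
    proof (rule sweedler_cong[OF A'.module _ x])
      show "bilinear_map K H H A (\<lambda>u v. (L u \<otimes>\<^bsub>A\<^esub> M v) \<otimes>\<^bsub>A\<^esub> R z)" using z by (intro l)
    qed (simp add: A'.A.m_assoc c z)
    also have "\<dots> = sweedler A (\<lambda>u v. L u \<otimes>\<^bsub>A\<^esub> M v) x \<otimes>\<^bsub>A\<^esub> R z"
      using x z by (intro hom_sweedler[where g = "\<lambda>a. a \<otimes>\<^bsub>A\<^esub> R z", OF A'.module A'.module, symmetric] l)
    finally show "sweedler A (\<lambda>u v. L u \<otimes>\<^bsub>A\<^esub> (M v \<otimes>\<^bsub>A\<^esub> R z)) x = \<epsilon> x \<odot>\<^bsub>A\<^esub> R z"
      by (simp add: LM x z c counit_closed A'.smult_mult_left)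
  qed
  moreover have "sweedler A (\<lambda>x z. sweedler A (\<lambda>u v. L u \<otimes>\<^bsub>A\<^esub> (M v \<otimes>\<^bsub>A\<^esub> R z)) x) h =
      sweedler A (\<lambda>x y. sweedler A (\<lambda>u v. L x \<otimes>\<^bsub>A\<^esub> (M u \<otimes>\<^bsub>A\<^esub> R v)) y) h"
    by (rule sweedler_coassoc[OF A'.module h]) (intro l; assumption)+
  ultimately show ?thesis
    by (simp add: sweedler_counit_left sweedler_counit_right A'.module L R h)
qed


text \<open>Both \<open>h \<mapsto> \<Delta> (S h)\<close> and \<open>h \<mapsto> S h\<^sub>2 \<otimes> S h\<^sub>1\<close> are
  convolution inverses of \<open>\<Delta>\<close> among the linear maps from \<open>H\<close> to \<open>H \<otimes> H\<close>: the
  former because \<open>\<Delta>\<close> is multiplicative, the latter because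
  \<open>h\<^sub>1 S h\<^sub>4 \<otimes> h\<^sub>2 S h\<^sub>3\<close> collapses from the inside.\<close>

lemma comult_antipode:
  assumes h: "h \<in> carrier H"
  shows "\<Delta> (S h) = sweedler (tensor K H H) (\<lambda>x y. pure_tensor K H H (S y) (S x)) h"
proof -
  let ?T = "tensor K H H" and ?A = "tensor_algebra K H H" and ?p = "pure_tensor K H H"
  note m = HH.tensor_module module
  interpret TA: unital_algebra K ?A by (rule HH.unital_algebra_tensor)
  note c = comult_closed antipode_closed counit_closed HH.pure_tensor_closed A.m_closed A.one_closed
  note l = lin m c unital_algebra_axioms
  have bS: "bilinear_map K H H ?T (\<lambda>x y. ?p (S y) (S x))" by (intro l)
  let ?R = "\<lambda>h. sweedler ?T (\<lambda>x y. ?p (S y) (S x)) h"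
  have sA: "sweedler ?A = sweedler ?T" by (simp add: fun_eq_iff sweedler_def)
  have Rc: "?R z \<in> carrier ?T" if "z \<in> carrier H" for z
    using that by (intro sweedler_closed bS m)
  have Rl: "?R \<in> mod_hom K H ?T" by (intro sweedler_linear_arg bS m lin)
  note Rcomp = mod_hom_compose[OF _ Rl]
  have 1: "sweedler ?T (\<lambda>x y. \<Delta> (S x) \<otimes>\<^bsub>?A\<^esub> \<Delta> y) h = \<epsilon> h \<odot>\<^bsub>?A\<^esub> \<one>\<^bsub>?A\<^esub>" if h: "h \<in> carrier H" for h
  proof -
    have "sweedler ?T (\<lambda>x y. \<Delta> (S x) \<otimes>\<^bsub>?A\<^esub> \<Delta> y) h = sweedler ?T (\<lambda>x y. \<Delta> (S x \<otimes>\<^bsub>H\<^esub> y)) h"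
    proof (rule sweedler_cong[OF m(1) _ h])
      show "bilinear_map K H H ?T (\<lambda>x y. \<Delta> (S x \<otimes>\<^bsub>H\<^esub> y))" by (intro l)
    qed (simp add: ring_hom_mult[OF comult_ring_hom] c)
    also have "\<dots> = \<epsilon> h \<odot>\<^bsub>?T\<^esub> \<Delta> \<one>\<^bsub>H\<^esub>" by (rule sweedler_antipode_left[OF m(1) comult_linear h])
    finally show ?thesis using ring_hom_one[OF comult_ring_hom] by simp
  qed
  have 2: "sweedler ?T (\<lambda>x y. \<Delta> x \<otimes>\<^bsub>?A\<^esub> ?R y) h = \<epsilon> h \<odot>\<^bsub>?A\<^esub> \<one>\<^bsub>?A\<^esub>" if h: "h \<in> carrier H" for h
  proof -
    have "sweedler ?T (\<lambda>x y. \<Delta> x \<otimes>\<^bsub>?A\<^esub> ?R y) h = sweedler ?T (\<lambda>x y. sweedler ?T (\<lambda>p q. ?p p q \<otimes>\<^bsub>?A\<^esub> ?R y) x) h"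
    proof (rule sweedler_cong[OF m(1) _ h])
      show "bilinear_map K H H ?T (\<lambda>x y. sweedler ?T (\<lambda>p q. ?p p q \<otimes>\<^bsub>?A\<^esub> ?R y) x)"
        by (intro l Rc)
      fix x y assume "x \<in> carrier H" and y: "y \<in> carrier H"
      then show "\<Delta> x \<otimes>\<^bsub>?A\<^esub> ?R y = sweedler ?T (\<lambda>p q. ?p p q \<otimes>\<^bsub>?A\<^esub> ?R y) x"
        using hom_sweedler[OF m(1,1) HH.pure_tensor_bilinear mod_hom_mult_left[OF TA.unital_algebra_axioms _ mod_hom_id, of "?R y", simplified]] Rc[OF y]
        by (simp add: sweedler_pure_tensor)
    qed
    also have "\<dots> = sweedler ?T (\<lambda>p z. sweedler ?T (\<lambda>q w. ?p p q \<otimes>\<^bsub>?A\<^esub> ?R w) z) h"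
      by (rule sweedler_coassoc[OF m(1) h]) (intro l Rc; assumption)+
    \<comment> \<open>Keep \<open>p = h\<^sub>1\<close> and collapse \<open>h\<^sub>2 S h\<^sub>3\<close> in the second factor.\<close>
    also have "\<dots> = sweedler ?T (\<lambda>p z. ?p (p \<otimes>\<^bsub>H\<^esub> S z) \<one>\<^bsub>H\<^esub>) h"
    proof (rule sweedler_cong[OF m(1) _ h])
      show "bilinear_map K H H ?T (\<lambda>p z. ?p (p \<otimes>\<^bsub>H\<^esub> S z) \<one>\<^bsub>H\<^esub>)" by (intro l)
      fix p z assume p: "p \<in> carrier H" and z: "z \<in> carrier H"
      have "sweedler ?T (\<lambda>q w. ?p p q \<otimes>\<^bsub>?A\<^esub> ?R w) z =
          sweedler ?T (\<lambda>q w. sweedler ?T (\<lambda>r s. ?p (p \<otimes>\<^bsub>H\<^esub> S s) (q \<otimes>\<^bsub>H\<^esub> S r)) w) z"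
      proof (rule sweedler_cong[OF m(1) _ z])
        show "bilinear_map K H H ?T (\<lambda>q w. sweedler ?T (\<lambda>r s. ?p (p \<otimes>\<^bsub>H\<^esub> S s) (q \<otimes>\<^bsub>H\<^esub> S r)) w)"
          using p by (intro l)
        fix q w assume q: "q \<in> carrier H" and w: "w \<in> carrier H"
        have "?p p q \<otimes>\<^bsub>?A\<^esub> ?R w = sweedler ?T (\<lambda>r s. ?p p q \<otimes>\<^bsub>?A\<^esub> ?p (S s) (S r)) w"
          using p q by (intro hom_sweedler[OF m(1,1) bS _ w] l)
        also have "\<dots> = sweedler ?T (\<lambda>r s. ?p (p \<otimes>\<^bsub>H\<^esub> S s) (q \<otimes>\<^bsub>H\<^esub> S r)) w"
        proof (rule sweedler_cong[OF m(1) _ w])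
          show "bilinear_map K H H ?T (\<lambda>r s. ?p (p \<otimes>\<^bsub>H\<^esub> S s) (q \<otimes>\<^bsub>H\<^esub> S r))"
            using p q by (intro l)
        qed (simp add: HH.tensor_mult_pure c p q)
        finally show "?p p q \<otimes>\<^bsub>?A\<^esub> ?R w = sweedler ?T (\<lambda>r s. ?p (p \<otimes>\<^bsub>H\<^esub> S s) (q \<otimes>\<^bsub>H\<^esub> S r)) w" .
      qed
      also have "\<dots> = sweedler ?T (\<lambda>w s. sweedler ?T (\<lambda>q r. ?p (p \<otimes>\<^bsub>H\<^esub> S s) (q \<otimes>\<^bsub>H\<^esub> S r)) w) z"
        by (rule sweedler_coassoc[OF m(1) z, symmetric]) (insert p, intro l; assumption)+
      also have "\<dots> = sweedler ?T (\<lambda>w s. \<epsilon> w \<odot>\<^bsub>?T\<^esub> ?p (p \<otimes>\<^bsub>H\<^esub> S s) \<one>\<^bsub>H\<^esub>) z"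
      proof (rule sweedler_cong[OF m(1) _ z])
        show "bilinear_map K H H ?T (\<lambda>w s. \<epsilon> w \<odot>\<^bsub>?T\<^esub> ?p (p \<otimes>\<^bsub>H\<^esub> S s) \<one>\<^bsub>H\<^esub>)"
          using p by (intro l)
        fix w s assume w: "w \<in> carrier H" and s: "s \<in> carrier H"
        show "sweedler ?T (\<lambda>q r. ?p (p \<otimes>\<^bsub>H\<^esub> S s) (q \<otimes>\<^bsub>H\<^esub> S r)) w = \<epsilon> w \<odot>\<^bsub>?T\<^esub> ?p (p \<otimes>\<^bsub>H\<^esub> S s) \<one>\<^bsub>H\<^esub>"
          using p s by (intro sweedler_antipode_right[OF m(1) _ w] l)
      qed
      also have "\<dots> = ?p (p \<otimes>\<^bsub>H\<^esub> S z) \<one>\<^bsub>H\<^esub>"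
        using p by (intro sweedler_counit_left[OF m(1) _ z] l)
      finally show "sweedler ?T (\<lambda>q w. ?p p q \<otimes>\<^bsub>?A\<^esub> ?R w) z = ?p (p \<otimes>\<^bsub>H\<^esub> S z) \<one>\<^bsub>H\<^esub>" .
    qed
    also have "\<dots> = \<epsilon> h \<odot>\<^bsub>?T\<^esub> ?p \<one>\<^bsub>H\<^esub> \<one>\<^bsub>H\<^esub>"
      by (intro sweedler_antipode_right[OF m(1) _ h] l)
    finally show ?thesis by simp
  qed
  show ?thesis
    by (rule convolution_inverse_unique[OF TA.unital_algebra_axioms, of "\<lambda>h. \<Delta> (S h)" \<Delta> ?R])
      (simp_all add: sA 1 2 comult_linear Rl mod_hom_compose[OF antipode_linear comult_linear] h)
qed

end

lemma (in cocommutative_hopf_algebra) sweedler_cocommutative: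
  assumes P: "module K P" and b: "bilinear_map K H H P \<beta>" and h: "h \<in> carrier H"
  shows "sweedler P (\<lambda>x y. \<beta> y x) h = sweedler P \<beta> h"
proof -
  have b': "bilinear_map K H H P (\<lambda>x y. \<beta> y x)" using b by (auto simp: bilinear_map_def)
  have bf: "bilinear_map K H H (tensor K H H) (\<lambda>x y. pure_tensor K H H y x)"
    by (intro lin module)
  have "sweedler P \<beta> h = tensor_lift K P \<beta> (sweedler (tensor K H H) (\<lambda>x y. pure_tensor K H H y x) h)"
    using cocommutative[OF h] by (simp add: sweedler_def tensor_flip_def)
  also have "\<dots> = sweedler P (\<lambda>x y. tensor_lift K P \<beta> (pure_tensor K H H y x)) h"
    by (rule hom_sweedler[OF HH.tensor_module P bf HH.tensor_lift_hom[OF P b] h])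
  also have "\<dots> = sweedler P (\<lambda>x y. \<beta> y x) h"
    by (rule sweedler_cong[OF P b' h]) (simp add: HH.tensor_lift_pure[OF P b])
  finally show ?thesis by simp
qed

text \<open>The antipode reverses the comultiplication, and cocommutativity undoes the
  reversal.\<close>

lemma (in cocommutative_hopf_algebra) sweedler_antipode:
  assumes P: "module K P" and b: "bilinear_map K H H P \<beta>" and h: "h \<in> carrier H"
  shows "sweedler P \<beta> (S h) = sweedler P (\<lambda>x y. \<beta> (S x) (S y)) h"
proof -
  have b': "bilinear_map K H H P (\<lambda>x y. \<beta> (S x) (S y))"
    by (intro bilinear_mapI mod_hom_compose[OF _ bilinear_map_left[OF b]]
       mod_hom_compose[OF _ bilinear_map_right[OF b]] antipode_linear antipode_closed)
  then have b'': "bilinear_map K H H P (\<lambda>x y. \<beta> (S y) (S x))" by (auto simp: bilinear_map_def)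
  have bf: "bilinear_map K H H (tensor K H H) (\<lambda>x y. pure_tensor K H H (S y) (S x))"
    by (intro lin module antipode_closed)
  have "sweedler P \<beta> (S h) = tensor_lift K P \<beta> (sweedler (tensor K H H) (\<lambda>x y. pure_tensor K H H (S y) (S x)) h)"
    using comult_antipode[OF h] by (simp add: sweedler_def)
  also have "\<dots> = sweedler P (\<lambda>x y. tensor_lift K P \<beta> (pure_tensor K H H (S y) (S x))) h"
    by (rule hom_sweedler[OF HH.tensor_module P bf HH.tensor_lift_hom[OF P b] h])
  also have "\<dots> = sweedler P (\<lambda>x y. \<beta> (S y) (S x)) h"
    by (rule sweedler_cong[OF P b'' h]) (simp add: HH.tensor_lift_pure[OF P b] antipode_closed)
  also have "\<dots> = sweedler P (\<lambda>x y. \<beta> (S x) (S y)) h"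
    by (rule sweedler_cocommutative[OF P b' h])
  finally show ?thesis .
qed

section \<open>The partial smash product as an algebra\<close>

lemma smash_tensor_simps [simp]:
  "carrier (smash_tensor K H \<Delta> A act) = carrier (tensor K A H)"
  "(\<oplus>\<^bsub>smash_tensor K H \<Delta> A act\<^esub>) = (\<oplus>\<^bsub>tensor K A H\<^esub>)"
  "\<zero>\<^bsub>smash_tensor K H \<Delta> A act\<^esub> = \<zero>\<^bsub>tensor K A H\<^esub>"
  "(\<odot>\<^bsub>smash_tensor K H \<Delta> A act\<^esub>) = (\<odot>\<^bsub>tensor K A H\<^esub>)"
  by (simp_all add: smash_tensor_def Let_def)

lemma (in module) fixed_points_submodule:
  assumes f: "f \<in> mod_hom R M M"
  shows "submodule {x \<in> carrier M. f x = x} R M"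
proof (rule submoduleI)
  have lm: "left_module R M" by (rule module_left_module) (rule module_axioms)
  show "\<zero>\<^bsub>M\<^esub> \<in> {x \<in> carrier M. f x = x}" using mod_hom_zero[OF lm lm f] by simp
  fix x assume x: "x \<in> {x \<in> carrier M. f x = x}"
  then have "f ((\<ominus> \<one>) \<odot>\<^bsub>M\<^esub> x) = (\<ominus> \<one>) \<odot>\<^bsub>M\<^esub> x" by (simp add: mod_hom_smult[OF f])
  then show "\<ominus>\<^bsub>M\<^esub> x \<in> {x \<in> carrier M. f x = x}" using x by (simp add: smult_l_minus)
qed (auto simp: mod_hom_add[OF f] mod_hom_smult[OF f])

context symmetric_partial_action
begin

sublocale AH: tensor_factors K A H ..

abbreviation "sw \<equiv> H.sweedler"
abbreviation "T \<equiv> tensor K A H"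
abbreviation "p \<equiv> pure_tensor K A H"
abbreviation smash_mult (infixl \<open>\<star>\<close> 70) where "s \<star> t \<equiv> s \<otimes>\<^bsub>smash_tensor K H \<Delta> A act\<^esub> t"
abbreviation "e \<equiv> p \<one>\<^bsub>A\<^esub> \<one>\<^bsub>H\<^esub>"
abbreviation "B \<equiv> partial_smash K H \<Delta> A act"
abbreviation "\<phi> \<equiv> smash_incl K H \<Delta> A act"

lemma act_closed: "\<lbrakk>h \<in> carrier H; a \<in> carrier A\<rbrakk> \<Longrightarrow> act h a \<in> carrier A"
  by (rule bilinear_map_closed[OF act_bilinear])

lemmas act_lin = mod_hom_compose[OF _ bilinear_map_left[OF act_bilinear]]
  mod_hom_compose[OF _ bilinear_map_right[OF act_bilinear]]

lemmas mods = AH.tensor_module A.module H.module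
lemmas closed_facts = act_closed A.A.m_closed H.A.m_closed H.antipode_closed H.counit_closed AH.pure_tensor_closed
  A.A.one_closed H.A.one_closed
lemmas multilin = act_lin lin mods closed_facts A.unital_algebra_axioms H.unital_algebra_axioms

lemma act_mult_sweedler:
  "\<lbrakk>h \<in> carrier H; a \<in> carrier A; b \<in> carrier A\<rbrakk> \<Longrightarrow>
    act h (a \<otimes>\<^bsub>A\<^esub> b) = sw A (\<lambda>x y. act x a \<otimes>\<^bsub>A\<^esub> act y b) h"
  by (simp add: act_mult H.sweedler_def)

lemma act_act_sweedler:
  "\<lbrakk>h \<in> carrier H; k \<in> carrier H; a \<in> carrier A\<rbrakk> \<Longrightarrow>
    act h (act k a) = sw A (\<lambda>x y. act x \<one>\<^bsub>A\<^esub> \<otimes>\<^bsub>A\<^esub> act (y \<otimes>\<^bsub>H\<^esub> k) a) h"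
  by (simp add: act_act H.sweedler_def)

lemma act_act_symmetric_sweedler:
  "\<lbrakk>h \<in> carrier H; k \<in> carrier H; a \<in> carrier A\<rbrakk> \<Longrightarrow>
    act h (act k a) = sw A (\<lambda>x y. act (x \<otimes>\<^bsub>H\<^esub> k) a \<otimes>\<^bsub>A\<^esub> act y \<one>\<^bsub>A\<^esub>) h"
  by (simp add: act_act_symmetric H.sweedler_def)

text \<open>Expanding \<open>h\<^sub>2 \<cdot> (k \<cdot> c)\<close> produces an additional factor \<open>h\<^sub>2 \<cdot> 1\<close>,
  which is absorbed since \<open>(h\<^sub>1 \<cdot> b) (h\<^sub>2 \<cdot> 1) = h \<cdot> b\<close>. Thus, behind another
  factor, the action composes like a global one; this is the identity behind associativity of the
  smash product.\<close>

lemma act_mult_act: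
  assumes h: "h \<in> carrier H" and k: "k \<in> carrier H" and b: "b \<in> carrier A" and c: "c \<in> carrier A"
  shows "act h (b \<otimes>\<^bsub>A\<^esub> act k c) = sw A (\<lambda>x y. act x b \<otimes>\<^bsub>A\<^esub> act (y \<otimes>\<^bsub>H\<^esub> k) c) h"
proof -
  note P = A.module
  have "act h (b \<otimes>\<^bsub>A\<^esub> act k c) = sw A (\<lambda>x y. act x b \<otimes>\<^bsub>A\<^esub> act y (act k c)) h"
    using h k b c by (simp add: act_mult_sweedler closed_facts)
  also have "\<dots> = sw A (\<lambda>x y. sw A (\<lambda>u v. act x b \<otimes>\<^bsub>A\<^esub> (act u \<one>\<^bsub>A\<^esub> \<otimes>\<^bsub>A\<^esub> act (v \<otimes>\<^bsub>H\<^esub> k) c)) y) h"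
  proof (rule H.sweedler_cong[OF P _ h])
    show "bilinear_map K H H A (\<lambda>x y. sw A (\<lambda>u v. act x b \<otimes>\<^bsub>A\<^esub> (act u \<one>\<^bsub>A\<^esub> \<otimes>\<^bsub>A\<^esub> act (v \<otimes>\<^bsub>H\<^esub> k) c)) y)"
      using k b c by (intro multilin)
    fix x y assume x: "x \<in> carrier H" and y: "y \<in> carrier H"
    show "act x b \<otimes>\<^bsub>A\<^esub> act y (act k c) =
        sw A (\<lambda>u v. act x b \<otimes>\<^bsub>A\<^esub> (act u \<one>\<^bsub>A\<^esub> \<otimes>\<^bsub>A\<^esub> act (v \<otimes>\<^bsub>H\<^esub> k) c)) y"
      unfolding act_act_sweedler[OF y k c]
      using x y k b c by (intro H.hom_sweedler[OF P P] multilin)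
  qed
  also have "\<dots> = sw A (\<lambda>x y. sw A (\<lambda>u v. act u b \<otimes>\<^bsub>A\<^esub> (act v \<one>\<^bsub>A\<^esub> \<otimes>\<^bsub>A\<^esub> act (y \<otimes>\<^bsub>H\<^esub> k) c)) x) h"
    by (rule H.sweedler_coassoc[OF P h, symmetric]) (insert k b c, intro multilin; assumption)+
  also have "\<dots> = sw A (\<lambda>x y. act x b \<otimes>\<^bsub>A\<^esub> act (y \<otimes>\<^bsub>H\<^esub> k) c) h"
  proof (rule H.sweedler_cong[OF P _ h])
    show "bilinear_map K H H A (\<lambda>x y. act x b \<otimes>\<^bsub>A\<^esub> act (y \<otimes>\<^bsub>H\<^esub> k) c)"
      using k b c by (intro multilin)
    fix x y assume x: "x \<in> carrier H" and y: "y \<in> carrier H"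
    have "act x b \<otimes>\<^bsub>A\<^esub> act (y \<otimes>\<^bsub>H\<^esub> k) c = sw A (\<lambda>u v. act u b \<otimes>\<^bsub>A\<^esub> act v \<one>\<^bsub>A\<^esub>) x \<otimes>\<^bsub>A\<^esub> act (y \<otimes>\<^bsub>H\<^esub> k) c"
      using act_mult_sweedler[OF x b A.A.one_closed] b by simp
    also have "\<dots> = sw A (\<lambda>u v. (act u b \<otimes>\<^bsub>A\<^esub> act v \<one>\<^bsub>A\<^esub>) \<otimes>\<^bsub>A\<^esub> act (y \<otimes>\<^bsub>H\<^esub> k) c) x"
      using x y k b c by (intro H.hom_sweedler[where g = "\<lambda>z. z \<otimes>\<^bsub>A\<^esub> act (y \<otimes>\<^bsub>H\<^esub> k) c", OF P P] multilin)
    also have "\<dots> = sw A (\<lambda>u v. act u b \<otimes>\<^bsub>A\<^esub> (act v \<one>\<^bsub>A\<^esub> \<otimes>\<^bsub>A\<^esub> act (y \<otimes>\<^bsub>H\<^esub> k) c)) x"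
    proof (rule H.sweedler_cong[OF P _ x])
      show "bilinear_map K H H A (\<lambda>u v. act u b \<otimes>\<^bsub>A\<^esub> (act v \<one>\<^bsub>A\<^esub> \<otimes>\<^bsub>A\<^esub> act (y \<otimes>\<^bsub>H\<^esub> k) c))"
        using y k b c by (intro multilin)
    qed (simp add: A.A.m_assoc closed_facts b c k y)
    finally show "sw A (\<lambda>u v. act u b \<otimes>\<^bsub>A\<^esub> (act v \<one>\<^bsub>A\<^esub> \<otimes>\<^bsub>A\<^esub> act (y \<otimes>\<^bsub>H\<^esub> k) c)) x =
        act x b \<otimes>\<^bsub>A\<^esub> act (y \<otimes>\<^bsub>H\<^esub> k) c" by simp
  qed
  finally show ?thesis .
qed

lemma smash_mult_eq:
  "s \<star> t = tensor_lift K T (\<lambda>a h. tensor_lift K T (\<lambda>b k.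
     sw T (\<lambda>x y. p (a \<otimes>\<^bsub>A\<^esub> act x b) (y \<otimes>\<^bsub>H\<^esub> k)) h) t) s"
  by (simp add: smash_tensor_def Let_def H.sweedler_def del: smash_tensor_simps)

lemma smash_inner_bilinear:
  "\<lbrakk>a \<in> carrier A; h \<in> carrier H\<rbrakk> \<Longrightarrow>
    bilinear_map K A H T (\<lambda>b k. sw T (\<lambda>x y. p (a \<otimes>\<^bsub>A\<^esub> act x b) (y \<otimes>\<^bsub>H\<^esub> k)) h)"
  by (intro multilin)

lemma smash_outer_bilinear:
  "t \<in> carrier T \<Longrightarrow> bilinear_map K A H T (\<lambda>a h. tensor_lift K T (\<lambda>b k.
     sw T (\<lambda>x y. p (a \<otimes>\<^bsub>A\<^esub> act x b) (y \<otimes>\<^bsub>H\<^esub> k)) h) t)"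
  by (intro AH.tensor_lift_param_linear multilin)

lemma smash_mult_left_linear: "t \<in> carrier T \<Longrightarrow> (\<lambda>s. s \<star> t) \<in> mod_hom K T T"
  unfolding smash_mult_eq by (rule AH.tensor_lift_hom[OF mods(1) smash_outer_bilinear])

lemma smash_mult_right_linear: "s \<in> carrier T \<Longrightarrow> (\<lambda>t. s \<star> t) \<in> mod_hom K T T"
  unfolding smash_mult_eq
  by (intro AH.tensor_lift_param_linear smash_outer_bilinear mods AH.tensor_lift_hom smash_inner_bilinear)

lemma smash_mult_pure:
  assumes "a \<in> carrier A" "h \<in> carrier H" "b \<in> carrier A" "k \<in> carrier H"
  shows "p a h \<star> p b k = sw T (\<lambda>x y. p (a \<otimes>\<^bsub>A\<^esub> act x b) (y \<otimes>\<^bsub>H\<^esub> k)) h"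
  using assms
  by (simp add: smash_mult_eq AH.tensor_lift_pure mods smash_outer_bilinear smash_inner_bilinear AH.pure_tensor_closed)

lemma smash_mult_closed: "\<lbrakk>s \<in> carrier T; t \<in> carrier T\<rbrakk> \<Longrightarrow> s \<star> t \<in> carrier T"
  by (rule mod_hom_closed[OF smash_mult_right_linear])

lemma smash_mult_assoc_pure:
  assumes a: "a \<in> carrier A" and b: "b \<in> carrier A" and c: "c \<in> carrier A"
    and h: "h \<in> carrier H" and k: "k \<in> carrier H" and r: "r \<in> carrier H"
  shows "(p a h \<star> p b k) \<star> p c r = p a h \<star> (p b k \<star> p c r)"
proof -
  note P = mods(1)
  note abc = a b c h k r
  \<comment> \<open>Both sides are \<open>a (h\<^sub>1 \<cdot> b) (h\<^sub>2 k\<^sub>1 \<cdot> c) \<otimes> h\<^sub>3 k\<^sub>2 r\<close>.\<close>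
  let ?F = "\<lambda>x y z k1 k2. p (a \<otimes>\<^bsub>A\<^esub> (act x b \<otimes>\<^bsub>A\<^esub> act (y \<otimes>\<^bsub>H\<^esub> k1) c)) (z \<otimes>\<^bsub>H\<^esub> (k2 \<otimes>\<^bsub>H\<^esub> r))"
  have "(p a h \<star> p b k) \<star> p c r = sw T (\<lambda>x y. p (a \<otimes>\<^bsub>A\<^esub> act x b) (y \<otimes>\<^bsub>H\<^esub> k)) h \<star> p c r"
    by (simp add: smash_mult_pure abc)
  also have "\<dots> = sw T (\<lambda>x y. p (a \<otimes>\<^bsub>A\<^esub> act x b) (y \<otimes>\<^bsub>H\<^esub> k) \<star> p c r) h"
    using abc by (intro H.hom_sweedler[where g = "\<lambda>z. z \<star> p c r", OF P P] multilin smash_mult_left_linear)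
  also have "\<dots> = sw T (\<lambda>x y. sw T (\<lambda>u v. sw T (\<lambda>k1 k2. ?F x u v k1 k2) k) y) h"
  proof (rule H.sweedler_cong[OF P _ h])
    show "bilinear_map K H H T (\<lambda>x y. sw T (\<lambda>u v. sw T (\<lambda>k1 k2. ?F x u v k1 k2) k) y)"
      using abc by (intro multilin)
    fix x y assume x: "x \<in> carrier H" and y: "y \<in> carrier H"
    have "p (a \<otimes>\<^bsub>A\<^esub> act x b) (y \<otimes>\<^bsub>H\<^esub> k) \<star> p c r =
        sw T (\<lambda>u v. p ((a \<otimes>\<^bsub>A\<^esub> act x b) \<otimes>\<^bsub>A\<^esub> act u c) (v \<otimes>\<^bsub>H\<^esub> r)) (y \<otimes>\<^bsub>H\<^esub> k)"
      by (simp add: smash_mult_pure abc x y closed_facts)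
    also have "\<dots> = sw T (\<lambda>u v. sw T (\<lambda>k1 k2. p ((a \<otimes>\<^bsub>A\<^esub> act x b) \<otimes>\<^bsub>A\<^esub> act (u \<otimes>\<^bsub>H\<^esub> k1) c)
        ((v \<otimes>\<^bsub>H\<^esub> k2) \<otimes>\<^bsub>H\<^esub> r)) k) y"
      using abc x y by (intro H.sweedler_mult[OF P _ y k] multilin)
    also have "\<dots> = sw T (\<lambda>u v. sw T (\<lambda>k1 k2. ?F x u v k1 k2) k) y"
    proof (rule H.sweedler_cong[OF P _ y])
      show "bilinear_map K H H T (\<lambda>u v. sw T (\<lambda>k1 k2. ?F x u v k1 k2) k)"
        using abc x by (intro multilin)
      fix u v assume u: "u \<in> carrier H" and v: "v \<in> carrier H"
      show "sw T (\<lambda>k1 k2. p ((a \<otimes>\<^bsub>A\<^esub> act x b) \<otimes>\<^bsub>A\<^esub> act (u \<otimes>\<^bsub>H\<^esub> k1) c) ((v \<otimes>\<^bsub>H\<^esub> k2) \<otimes>\<^bsub>H\<^esub> r)) k =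
          sw T (\<lambda>k1 k2. ?F x u v k1 k2) k"
      proof (rule H.sweedler_cong[OF P _ k])
        show "bilinear_map K H H T (\<lambda>k1 k2. ?F x u v k1 k2)"
          using abc x u v by (intro multilin)
      qed (simp add: abc x u v closed_facts A.A.m_assoc H.A.m_assoc)
    qed
    finally show "p (a \<otimes>\<^bsub>A\<^esub> act x b) (y \<otimes>\<^bsub>H\<^esub> k) \<star> p c r =
      sw T (\<lambda>u v. sw T (\<lambda>k1 k2. ?F x u v k1 k2) k) y" .
  qed
  also have "\<dots> = sw T (\<lambda>x z. sw T (\<lambda>u v. sw T (\<lambda>k1 k2. ?F u v z k1 k2) k) x) h"
    by (rule H.sweedler_coassoc[OF P h, symmetric]) (insert abc, intro multilin; assumption)+
  also have "\<dots> = sw T (\<lambda>x z. sw T (\<lambda>k1 k2. sw T (\<lambda>u v. ?F u v z k1 k2) x) k) h"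
  proof (rule H.sweedler_cong[OF P _ h])
    show "bilinear_map K H H T (\<lambda>x z. sw T (\<lambda>k1 k2. sw T (\<lambda>u v. ?F u v z k1 k2) x) k)"
      using abc by (intro multilin)
    fix x z assume x: "x \<in> carrier H" and z: "z \<in> carrier H"
    show "sw T (\<lambda>u v. sw T (\<lambda>k1 k2. ?F u v z k1 k2) k) x = sw T (\<lambda>k1 k2. sw T (\<lambda>u v. ?F u v z k1 k2) x) k"
      by (rule H.sweedler_swap[OF P x k]) (insert abc z, intro multilin; assumption)+
  qed
  also have "\<dots> = sw T (\<lambda>x z. sw T (\<lambda>k1 k2. p (a \<otimes>\<^bsub>A\<^esub> act x (b \<otimes>\<^bsub>A\<^esub> act k1 c)) (z \<otimes>\<^bsub>H\<^esub> (k2 \<otimes>\<^bsub>H\<^esub> r))) k) h"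
  proof (rule H.sweedler_cong[OF P _ h])
    show "bilinear_map K H H T (\<lambda>x z. sw T (\<lambda>k1 k2. p (a \<otimes>\<^bsub>A\<^esub> act x (b \<otimes>\<^bsub>A\<^esub> act k1 c)) (z \<otimes>\<^bsub>H\<^esub> (k2 \<otimes>\<^bsub>H\<^esub> r))) k)"
      using abc by (intro multilin)
    fix x z assume x: "x \<in> carrier H" and z: "z \<in> carrier H"
    show "sw T (\<lambda>k1 k2. sw T (\<lambda>u v. ?F u v z k1 k2) x) k =
      sw T (\<lambda>k1 k2. p (a \<otimes>\<^bsub>A\<^esub> act x (b \<otimes>\<^bsub>A\<^esub> act k1 c)) (z \<otimes>\<^bsub>H\<^esub> (k2 \<otimes>\<^bsub>H\<^esub> r))) k"
    proof (rule H.sweedler_cong[OF P _ k])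
      show "bilinear_map K H H T (\<lambda>k1 k2. p (a \<otimes>\<^bsub>A\<^esub> act x (b \<otimes>\<^bsub>A\<^esub> act k1 c)) (z \<otimes>\<^bsub>H\<^esub> (k2 \<otimes>\<^bsub>H\<^esub> r)))"
        using abc x z by (intro multilin)
      fix k1 k2 assume k12: "k1 \<in> carrier H" "k2 \<in> carrier H"
      show "sw T (\<lambda>u v. ?F u v z k1 k2) x = p (a \<otimes>\<^bsub>A\<^esub> act x (b \<otimes>\<^bsub>A\<^esub> act k1 c)) (z \<otimes>\<^bsub>H\<^esub> (k2 \<otimes>\<^bsub>H\<^esub> r))"
        unfolding act_mult_act[OF x k12(1) b c]
        using abc x z k12
        by (intro H.hom_sweedler[where g = "\<lambda>w. p (a \<otimes>\<^bsub>A\<^esub> w) (z \<otimes>\<^bsub>H\<^esub> (k2 \<otimes>\<^bsub>H\<^esub> r))", OF A.module P, symmetric] multilin)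
    qed
  qed
  also have "\<dots> = sw T (\<lambda>k1 k2. sw T (\<lambda>x z. p (a \<otimes>\<^bsub>A\<^esub> act x (b \<otimes>\<^bsub>A\<^esub> act k1 c)) (z \<otimes>\<^bsub>H\<^esub> (k2 \<otimes>\<^bsub>H\<^esub> r))) h) k"
    by (rule H.sweedler_swap[OF P h k]) (insert abc, intro multilin; assumption)+
  also have "\<dots> = sw T (\<lambda>k1 k2. p a h \<star> p (b \<otimes>\<^bsub>A\<^esub> act k1 c) (k2 \<otimes>\<^bsub>H\<^esub> r)) k"
  proof (rule H.sweedler_cong[OF P _ k])
    show "bilinear_map K H H T (\<lambda>k1 k2. p a h \<star> p (b \<otimes>\<^bsub>A\<^esub> act k1 c) (k2 \<otimes>\<^bsub>H\<^esub> r))"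
      using abc by (intro bilinear_mapI mod_hom_compose[OF _ smash_mult_right_linear[of "p a h"]] multilin)
  qed (simp add: smash_mult_pure abc closed_facts)
  also have "\<dots> = p a h \<star> sw T (\<lambda>k1 k2. p (b \<otimes>\<^bsub>A\<^esub> act k1 c) (k2 \<otimes>\<^bsub>H\<^esub> r)) k"
    using abc by (intro H.hom_sweedler[where g = "\<lambda>z. p a h \<star> z", OF P P, symmetric] multilin smash_mult_right_linear)
  finally show ?thesis by (simp add: smash_mult_pure abc)
qed

lemma smash_mult_assoc:
  assumes s: "s \<in> carrier T" and t: "t \<in> carrier T" and u: "u \<in> carrier T"
  shows "(s \<star> t) \<star> u = s \<star> (t \<star> u)"
proof -
  note la = mod_hom_add[OF smash_mult_left_linear] and ra = mod_hom_add[OF smash_mult_right_linear]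
  note c = smash_mult_closed AH.pure_tensor_closed
  show ?thesis
    using s
  proof (induct rule: AH.tensor_induct)
    case (pure a h)
    show ?case using t
    proof (induct rule: AH.tensor_induct)
      case (pure b k)
      show ?case using u
      proof (induct rule: AH.tensor_induct)
        case (pure c r)
        show ?case
          by (rule smash_mult_assoc_pure) (fact pure \<open>a \<in> _\<close> \<open>h \<in> _\<close> \<open>b \<in> _\<close> \<open>k \<in> _\<close>)+
      qed (use pure \<open>a \<in> _\<close> \<open>h \<in> _\<close> in \<open>simp add: ra c\<close>)
    qed (use u pure in \<open>simp add: la ra c\<close>)
  qed (use t u in \<open>simp add: la c\<close>)
qed

lemma pure_one_mult_pure:
  assumes "a \<in> carrier A" "b \<in> carrier A" "k \<in> carrier H"
  shows "p a \<one>\<^bsub>H\<^esub> \<star> p b k = p (a \<otimes>\<^bsub>A\<^esub> b) k"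
proof -
  have "bilinear_map K H H T (\<lambda>x y. p (a \<otimes>\<^bsub>A\<^esub> act x b) (y \<otimes>\<^bsub>H\<^esub> k))" using assms by (intro multilin)
  from H.sweedler_one[OF mods(1) this] show ?thesis
    using assms by (simp add: smash_mult_pure act_one)
qed

lemma e_closed: "e \<in> carrier T"
  by (intro closed_facts)

lemma e_mult: "t \<in> carrier T \<Longrightarrow> e \<star> t = t"
  by (rule AH.tensor_hom_eqI[OF smash_mult_right_linear[OF e_closed] mod_hom_id])
    (simp_all add: pure_one_mult_pure)

text \<open>Right multiplication with \<open>e\<close> is idempotent because \<open>e\<close> is a left unit, so
  its image is its set of fixed points; membership becomes an equation.\<close>

lemma carrier_smash: "carrier B = {t \<in> carrier T. t \<star> e = t}"
proof -
  have "(t \<star> e) \<star> e = t \<star> e" if "t \<in> carrier T" for t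
    using that by (simp add: smash_mult_assoc e_closed e_mult)
  then show ?thesis
    by (auto simp: partial_smash_def Let_def intro: smash_mult_closed e_closed)
qed

lemma smash_incl_eq: "a \<in> carrier A \<Longrightarrow> \<phi> a = p a \<one>\<^bsub>H\<^esub>"
proof -
  assume a: "a \<in> carrier A"
  then have "bilinear_map K H H T (\<lambda>x y. p (a \<otimes>\<^bsub>A\<^esub> act x \<one>\<^bsub>A\<^esub>) y)" by (intro multilin)
  from H.sweedler_one[OF mods(1) this] show ?thesis
    using a by (simp add: smash_incl_def smash_elem_def H.sweedler_def act_one)
qed

lemma smash_simps:
  "(\<oplus>\<^bsub>B\<^esub>) = (\<oplus>\<^bsub>T\<^esub>)" "\<zero>\<^bsub>B\<^esub> = \<zero>\<^bsub>T\<^esub>" "(\<odot>\<^bsub>B\<^esub>) = (\<odot>\<^bsub>T\<^esub>)" "(\<otimes>\<^bsub>B\<^esub>) = (\<star>)" "\<one>\<^bsub>B\<^esub> = e"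
  using smash_incl_eq[OF A.A.one_closed]
  by (simp_all add: partial_smash_def Let_def smash_incl_def)

lemma unital_algebra_smash: "unital_algebra K B"
proof (rule unital_algebraI)
  interpret T: module K T by (rule mods)
  show "module K B"
    by (rule module_cong[OF submodule.submodule_is_module[OF T.fixed_points_submodule[OF smash_mult_left_linear[OF e_closed]] mods(1)]])
      (simp_all add: smash_simps carrier_smash)
qed (auto simp: smash_simps carrier_smash smash_mult_closed smash_mult_assoc e_closed e_mult
    mod_hom_add[OF smash_mult_left_linear] mod_hom_add[OF smash_mult_right_linear]
    mod_hom_smult[OF smash_mult_left_linear] mod_hom_smult[OF smash_mult_right_linear] intro!: mod_homI)

lemma smash_incl_alg_hom: "\<phi> \<in> alg_hom K A B"
proof -
  note pl = mod_hom_pure_tensor_left[OF A.module H.module H.A.one_closed mod_hom_id]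
  show ?thesis
    unfolding alg_hom_def
    by (auto intro!: ring_hom_memI mod_homI simp: smash_incl_eq smash_simps carrier_smash closed_facts pure_one_mult_pure
      mod_hom_add[OF pl] mod_hom_smult[OF pl])
qed

end

section \<open>Projectivity of the smash product on either side\<close>

context symmetric_partial_action
begin

text \<open>Associativity of the smash multiplication thereby yields \<open>A\<close>-linearity of right
  multiplication with \<open>e\<close>.\<close>

lemma base_change_smult:
  assumes a: "a \<in> carrier A" and t: "t \<in> carrier T"
  shows "a \<odot>\<^bsub>base_change K A H\<^esub> t = p a \<one>\<^bsub>H\<^esub> \<star> t"
proof -
  have b: "bilinear_map K A H T (\<lambda>b h. p (a \<otimes>\<^bsub>A\<^esub> b) h)" using a by (intro multilin)
  have "p a \<one>\<^bsub>H\<^esub> \<in> carrier T" using a by (intro closed_facts)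
  from smash_mult_right_linear[OF this] show ?thesis
    unfolding base_change_def Let_def
    by (simp, intro AH.tensor_hom_eqI[OF AH.tensor_lift_hom[OF mods(1) b] _ _ t])
      (simp_all add: AH.tensor_lift_pure[OF mods(1) b] pure_one_mult_pure a)
qed

text \<open>Right multiplication with \<open>e\<close> is the retraction.\<close>

lemma projective_smash_left:
  assumes "projective_module K H"
  shows "projective_module A (module_along \<phi> B)"
proof -
  interpret B: unital_algebra K B by (rule unital_algebra_smash)
  have "\<phi> \<in> ring_hom A B" using smash_incl_alg_hom by (simp add: alg_hom_def)
  note lm = left_module_along[OF A.A.ring_axioms B.A.ring_axioms this]
  note la = mod_hom_add[OF smash_mult_left_linear[OF e_closed]]
  show ?thesis
  proof (rule projective_module_retract[OF projective_base_change[OF A.unital_algebra_axioms H.module assms] lm])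
    show "(\<lambda>t. t) \<in> mod_hom A (module_along \<phi> B) (base_change K A H)"
      by (rule mod_homI) (auto simp: carrier_smash smash_simps smash_incl_eq base_change_smult)
    show "(\<lambda>t. t \<star> e) \<in> mod_hom A (base_change K A H) (module_along \<phi> B)"
      by (rule mod_homI)
        (auto simp: carrier_smash smash_simps smash_incl_eq base_change_smult smash_mult_assoc smash_mult_closed
          e_closed e_mult la closed_facts)
  qed (simp add: carrier_smash)
qed

end

lemma tensor_opposite_algebra:
  "tensor K (opposite_algebra A) M = tensor K A M"
  "pure_tensor K (opposite_algebra A) M = pure_tensor K A M"
  by (simp_all add: fun_eq_iff tensor_def tensor_null_def tensor_relations_def pure_tensor_def opposite_algebra_def)

locale cocommutative_partial_action =
  symmetric_partial_action K H \<Delta> \<epsilon> S A act + C: cocommutative_hopf_algebra K H \<Delta> \<epsilon> S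
  for K :: "('k, 'c) ring_scheme" and H :: "('k, 'h, 'd) module_scheme" and \<Delta> and \<epsilon> and S
    and A :: "('k, 'a, 'e) module_scheme" and act
begin

text \<open>By \<open>act_mult_act\<close> and \<open>\<Delta> (S h) = S h\<^sub>1 \<otimes> S h\<^sub>2\<close>, the left-hand side
  is \<open>(S h\<^sub>1 \<cdot> b) (S h\<^sub>2 h\<^sub>3 \<cdot> a)\<close>, and \<open>S h\<^sub>2 h\<^sub>3\<close> collapses to the
  counit.\<close>

lemma antipode_act_mult_act:
  assumes h: "h \<in> carrier H" and a: "a \<in> carrier A" and b: "b \<in> carrier A"
  shows "sw A (\<lambda>x y. act (S x) (b \<otimes>\<^bsub>A\<^esub> act y a)) h = act (S h) b \<otimes>\<^bsub>A\<^esub> a"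
proof -
  note P = A.module
  have "sw A (\<lambda>x y. act (S x) (b \<otimes>\<^bsub>A\<^esub> act y a)) h =
      sw A (\<lambda>x y. sw A (\<lambda>u v. act (S u) b \<otimes>\<^bsub>A\<^esub> act (S v \<otimes>\<^bsub>H\<^esub> y) a) x) h"
  proof (rule H.sweedler_cong[OF P _ h])
    show "bilinear_map K H H A (\<lambda>x y. sw A (\<lambda>u v. act (S u) b \<otimes>\<^bsub>A\<^esub> act (S v \<otimes>\<^bsub>H\<^esub> y) a) x)"
      using a b by (intro multilin)
    fix x y assume x: "x \<in> carrier H" and y: "y \<in> carrier H"
    have "act (S x) (b \<otimes>\<^bsub>A\<^esub> act y a) = sw A (\<lambda>u v. act u b \<otimes>\<^bsub>A\<^esub> act (v \<otimes>\<^bsub>H\<^esub> y) a) (S x)"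
      using x y a b by (intro act_mult_act closed_facts)
    also have "\<dots> = sw A (\<lambda>u v. act (S u) b \<otimes>\<^bsub>A\<^esub> act (S v \<otimes>\<^bsub>H\<^esub> y) a) x"
      using y a b by (intro C.sweedler_antipode[OF P _ x] multilin)
    finally show "act (S x) (b \<otimes>\<^bsub>A\<^esub> act y a) = sw A (\<lambda>u v. act (S u) b \<otimes>\<^bsub>A\<^esub> act (S v \<otimes>\<^bsub>H\<^esub> y) a) x" .
  qed
  also have "\<dots> = sw A (\<lambda>x y. sw A (\<lambda>u v. act (S x) b \<otimes>\<^bsub>A\<^esub> act (S u \<otimes>\<^bsub>H\<^esub> v) a) y) h"
    by (rule H.sweedler_coassoc[OF P h]) (insert a b, intro multilin; assumption)+
  also have "\<dots> = sw A (\<lambda>x y. \<epsilon> y \<odot>\<^bsub>A\<^esub> (act (S x) b \<otimes>\<^bsub>A\<^esub> a)) h"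
  proof (rule H.sweedler_cong[OF P _ h])
    show "bilinear_map K H H A (\<lambda>x y. \<epsilon> y \<odot>\<^bsub>A\<^esub> (act (S x) b \<otimes>\<^bsub>A\<^esub> a))"
      using a b by (intro multilin)
    fix x y assume x: "x \<in> carrier H" and y: "y \<in> carrier H"
    have "sw A (\<lambda>u v. act (S x) b \<otimes>\<^bsub>A\<^esub> act (S u \<otimes>\<^bsub>H\<^esub> v) a) y = \<epsilon> y \<odot>\<^bsub>A\<^esub> (act (S x) b \<otimes>\<^bsub>A\<^esub> act \<one>\<^bsub>H\<^esub> a)"
      using x a b by (intro H.sweedler_antipode_left[where g = "\<lambda>z. act (S x) b \<otimes>\<^bsub>A\<^esub> act z a", OF P _ y] multilin)
    then show "sw A (\<lambda>u v. act (S x) b \<otimes>\<^bsub>A\<^esub> act (S u \<otimes>\<^bsub>H\<^esub> v) a) y = \<epsilon> y \<odot>\<^bsub>A\<^esub> (act (S x) b \<otimes>\<^bsub>A\<^esub> a)"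
      by (simp add: act_one a)
  qed
  also have "\<dots> = act (S h) b \<otimes>\<^bsub>A\<^esub> a"
    using a b by (intro H.sweedler_counit_right[where g = "\<lambda>z. act (S z) b \<otimes>\<^bsub>A\<^esub> a", OF P _ h] multilin)
  finally show ?thesis .
qed

text \<open>The symmetry axiom turns the left-hand side into
  \<open>(h\<^sub>2 S h\<^sub>1 \<cdot> a) (h\<^sub>3 \<cdot> 1)\<close>. By cocommutativity \<open>h\<^sub>1\<close> and
  \<open>h\<^sub>2\<close> may be exchanged, after which the antipode axiom applies.\<close>

lemma act_act_antipode:
  assumes h: "h \<in> carrier H" and a: "a \<in> carrier A"
  shows "sw A (\<lambda>x y. act y (act (S x) a)) h = a \<otimes>\<^bsub>A\<^esub> act h \<one>\<^bsub>A\<^esub>"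
proof -
  note P = A.module
  have "sw A (\<lambda>x y. act y (act (S x) a)) h =
      sw A (\<lambda>x y. sw A (\<lambda>u v. act (u \<otimes>\<^bsub>H\<^esub> S x) a \<otimes>\<^bsub>A\<^esub> act v \<one>\<^bsub>A\<^esub>) y) h"
  proof (rule H.sweedler_cong[OF P _ h])
    show "bilinear_map K H H A (\<lambda>x y. sw A (\<lambda>u v. act (u \<otimes>\<^bsub>H\<^esub> S x) a \<otimes>\<^bsub>A\<^esub> act v \<one>\<^bsub>A\<^esub>) y)"
      using a by (intro multilin)
  qed (simp add: act_act_symmetric_sweedler closed_facts a)
  also have "\<dots> = sw A (\<lambda>x y. sw A (\<lambda>u v. act (v \<otimes>\<^bsub>H\<^esub> S u) a \<otimes>\<^bsub>A\<^esub> act y \<one>\<^bsub>A\<^esub>) x) h"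
    by (rule H.sweedler_coassoc[OF P h, symmetric]) (insert a, intro multilin; assumption)+
  also have "\<dots> = sw A (\<lambda>x y. \<epsilon> x \<odot>\<^bsub>A\<^esub> (a \<otimes>\<^bsub>A\<^esub> act y \<one>\<^bsub>A\<^esub>)) h"
  proof (rule H.sweedler_cong[OF P _ h])
    show "bilinear_map K H H A (\<lambda>x y. \<epsilon> x \<odot>\<^bsub>A\<^esub> (a \<otimes>\<^bsub>A\<^esub> act y \<one>\<^bsub>A\<^esub>))"
      using a by (intro multilin)
    fix x y assume x: "x \<in> carrier H" and y: "y \<in> carrier H"
    have "sw A (\<lambda>u v. act (v \<otimes>\<^bsub>H\<^esub> S u) a \<otimes>\<^bsub>A\<^esub> act y \<one>\<^bsub>A\<^esub>) x =
        sw A (\<lambda>u v. act (u \<otimes>\<^bsub>H\<^esub> S v) a \<otimes>\<^bsub>A\<^esub> act y \<one>\<^bsub>A\<^esub>) x"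
      using y a by (intro C.sweedler_cocommutative[where \<beta> = "\<lambda>u v. act (u \<otimes>\<^bsub>H\<^esub> S v) a \<otimes>\<^bsub>A\<^esub> act y \<one>\<^bsub>A\<^esub>", OF P _ x] multilin)
    also have "\<dots> = \<epsilon> x \<odot>\<^bsub>A\<^esub> (act \<one>\<^bsub>H\<^esub> a \<otimes>\<^bsub>A\<^esub> act y \<one>\<^bsub>A\<^esub>)"
      using y a by (intro H.sweedler_antipode_right[where g = "\<lambda>z. act z a \<otimes>\<^bsub>A\<^esub> act y \<one>\<^bsub>A\<^esub>", OF P _ x] multilin)
    finally show "sw A (\<lambda>u v. act (v \<otimes>\<^bsub>H\<^esub> S u) a \<otimes>\<^bsub>A\<^esub> act y \<one>\<^bsub>A\<^esub>) x = \<epsilon> x \<odot>\<^bsub>A\<^esub> (a \<otimes>\<^bsub>A\<^esub> act y \<one>\<^bsub>A\<^esub>)"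
      by (simp add: act_one a)
  qed
  also have "\<dots> = a \<otimes>\<^bsub>A\<^esub> act h \<one>\<^bsub>A\<^esub>"
    using a by (intro H.sweedler_counit_left[where g = "\<lambda>z. a \<otimes>\<^bsub>A\<^esub> act z \<one>\<^bsub>A\<^esub>", OF P _ h] multilin)
  finally show ?thesis .
qed

definition untwist :: "('a \<times> 'h \<Rightarrow> 'k) set \<Rightarrow> ('a \<times> 'h \<Rightarrow> 'k) set"
  where "untwist = tensor_lift K T (\<lambda>a h. sw T (\<lambda>x y. p (act (S x) a) y) h)"

text \<open>The formula as a product makes right \<open>A\<close>-linearity and membership of the values in
  the smash product evident; \<open>twist_pure_sweedler\<close> gives the explicit form.\<close>

definition twist :: "('a \<times> 'h \<Rightarrow> 'k) set \<Rightarrow> ('a \<times> 'h \<Rightarrow> 'k) set"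
  where "twist = tensor_lift K T (\<lambda>a h. p \<one>\<^bsub>A\<^esub> h \<star> p a \<one>\<^bsub>H\<^esub>)"

lemma untwist_linear: "untwist \<in> mod_hom K T T"
  and untwist_pure: "\<lbrakk>a \<in> carrier A; h \<in> carrier H\<rbrakk> \<Longrightarrow> untwist (p a h) = sw T (\<lambda>x y. p (act (S x) a) y) h"
proof -
  have b: "bilinear_map K A H T (\<lambda>a h. sw T (\<lambda>x y. p (act (S x) a) y) h)" by (intro multilin)
  show "untwist \<in> mod_hom K T T" unfolding untwist_def by (rule AH.tensor_lift_hom[OF mods(1) b])
  show "\<lbrakk>a \<in> carrier A; h \<in> carrier H\<rbrakk> \<Longrightarrow> untwist (p a h) = sw T (\<lambda>x y. p (act (S x) a) y) h"
    unfolding untwist_def by (rule AH.tensor_lift_pure[OF mods(1) b])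
qed

lemma twist_linear: "twist \<in> mod_hom K T T"
  and twist_pure: "\<lbrakk>a \<in> carrier A; h \<in> carrier H\<rbrakk> \<Longrightarrow> twist (p a h) = p \<one>\<^bsub>A\<^esub> h \<star> p a \<one>\<^bsub>H\<^esub>"
proof -
  have b: "bilinear_map K A H T (\<lambda>a h. p \<one>\<^bsub>A\<^esub> h \<star> p a \<one>\<^bsub>H\<^esub>)"
    by (intro bilinear_mapI mod_hom_compose[OF _ smash_mult_left_linear] mod_hom_compose[OF _ smash_mult_right_linear] multilin)
  show "twist \<in> mod_hom K T T" unfolding twist_def by (rule AH.tensor_lift_hom[OF mods(1) b])
  show "\<lbrakk>a \<in> carrier A; h \<in> carrier H\<rbrakk> \<Longrightarrow> twist (p a h) = p \<one>\<^bsub>A\<^esub> h \<star> p a \<one>\<^bsub>H\<^esub>"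
    unfolding twist_def by (rule AH.tensor_lift_pure[OF mods(1) b])
qed

lemma twist_pure_sweedler:
  assumes "a \<in> carrier A" "h \<in> carrier H"
  shows "twist (p a h) = sw T (\<lambda>x y. p (act x a) y) h"
proof -
  have b: "bilinear_map K H H T (\<lambda>x y. p (act x a) y)" using assms by (intro multilin)
  show ?thesis
    using assms H.sweedler_cong[OF mods(1) b, of h "\<lambda>x y. p (\<one>\<^bsub>A\<^esub> \<otimes>\<^bsub>A\<^esub> act x a) (y \<otimes>\<^bsub>H\<^esub> \<one>\<^bsub>H\<^esub>)"]
    by (simp add: twist_pure smash_mult_pure closed_facts)
qed

text \<open>For \<open>t = a \<otimes> h\<close> the left-hand side is
  \<open>h\<^sub>2 \<cdot> (S h\<^sub>1 \<cdot> a) \<otimes> h\<^sub>3\<close>, to which \<open>act_act_antipode\<close>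
  applies.\<close>

lemma twist_untwist:
  assumes "t \<in> carrier T" shows "twist (untwist t) = t \<star> e"
proof (rule AH.tensor_hom_eqI[OF mod_hom_compose[OF untwist_linear twist_linear] smash_mult_left_linear[OF e_closed] _ assms])
  fix a h assume a: "a \<in> carrier A" and h: "h \<in> carrier H"
  note P = mods(1)
  have "twist (untwist (p a h)) = sw T (\<lambda>x y. twist (p (act (S x) a) y)) h"
    unfolding untwist_pure[OF a h] using a h by (intro H.hom_sweedler[OF P P _ twist_linear] multilin)
  also have "\<dots> = sw T (\<lambda>x y. sw T (\<lambda>u v. p (act u (act (S x) a)) v) y) h"
  proof (rule H.sweedler_cong[OF P _ h])
    show "bilinear_map K H H T (\<lambda>x y. sw T (\<lambda>u v. p (act u (act (S x) a)) v) y)" using a by (intro multilin)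
  qed (simp add: twist_pure_sweedler closed_facts a)
  also have "\<dots> = sw T (\<lambda>x y. sw T (\<lambda>u v. p (act v (act (S u) a)) y) x) h"
    by (rule H.sweedler_coassoc[OF P h, symmetric]) (insert a, intro multilin; assumption)+
  also have "\<dots> = sw T (\<lambda>x y. p (a \<otimes>\<^bsub>A\<^esub> act x \<one>\<^bsub>A\<^esub>) (y \<otimes>\<^bsub>H\<^esub> \<one>\<^bsub>H\<^esub>)) h"
  proof (rule H.sweedler_cong[OF P _ h])
    show "bilinear_map K H H T (\<lambda>x y. p (a \<otimes>\<^bsub>A\<^esub> act x \<one>\<^bsub>A\<^esub>) (y \<otimes>\<^bsub>H\<^esub> \<one>\<^bsub>H\<^esub>))" using a by (intro multilin)
    fix x y assume x: "x \<in> carrier H" and y: "y \<in> carrier H"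
    have "sw T (\<lambda>u v. p (act v (act (S u) a)) y) x = p (sw A (\<lambda>u v. act v (act (S u) a)) x) y"
      using a x y by (intro H.hom_sweedler[where g = "\<lambda>z. p z y", OF A.module P, symmetric] multilin)
    then show "sw T (\<lambda>u v. p (act v (act (S u) a)) y) x = p (a \<otimes>\<^bsub>A\<^esub> act x \<one>\<^bsub>A\<^esub>) (y \<otimes>\<^bsub>H\<^esub> \<one>\<^bsub>H\<^esub>)"
      using a x y by (simp add: act_act_antipode)
  qed
  also have "\<dots> = p a h \<star> e" by (simp add: smash_mult_pure a h)
  finally show "twist (untwist (p a h)) = p a h \<star> e" .
qed

abbreviation "A_op \<equiv> opposite_algebra A"
abbreviation "B_op \<equiv> opposite_algebra B"

text \<open>The opposite algebra acts on \<open>A \<otimes> H\<close> by right multiplication in the first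
  factor.\<close>

lemma base_change_op_smult:
  assumes a: "a \<in> carrier A"
  shows "(\<lambda>t. a \<odot>\<^bsub>base_change K A_op H\<^esub> t) \<in> mod_hom K T T"
    and "\<lbrakk>b \<in> carrier A; h \<in> carrier H\<rbrakk> \<Longrightarrow> a \<odot>\<^bsub>base_change K A_op H\<^esub> p b h = p (b \<otimes>\<^bsub>A\<^esub> a) h"
proof -
  have b: "bilinear_map K A H T (\<lambda>b h. p (b \<otimes>\<^bsub>A\<^esub> a) h)" using a by (intro multilin)
  have eq: "a \<odot>\<^bsub>base_change K A_op H\<^esub> t = tensor_lift K T (\<lambda>b h. p (b \<otimes>\<^bsub>A\<^esub> a) h) t" for t
    by (simp add: base_change_def Let_def tensor_opposite_algebra) (simp add: opposite_algebra_def)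
  show "(\<lambda>t. a \<odot>\<^bsub>base_change K A_op H\<^esub> t) \<in> mod_hom K T T"
    unfolding eq by (rule AH.tensor_lift_hom[OF mods(1) b])
  show "\<lbrakk>b \<in> carrier A; h \<in> carrier H\<rbrakk> \<Longrightarrow> a \<odot>\<^bsub>base_change K A_op H\<^esub> p b h = p (b \<otimes>\<^bsub>A\<^esub> a) h"
    unfolding eq by (rule AH.tensor_lift_pure[OF mods(1) b])
qed

text \<open>For \<open>t = b \<otimes> h\<close> the left-hand side is
  \<open>S h\<^sub>2 \<cdot> (b (h\<^sub>1 \<cdot> a)) \<otimes> h\<^sub>3\<close>; after exchanging \<open>h\<^sub>1\<close> and
  \<open>h\<^sub>2\<close>, \<open>antipode_act_mult_act\<close> applies.\<close>

lemma untwist_right_linear: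
  assumes a: "a \<in> carrier A" and t: "t \<in> carrier T"
  shows "untwist (t \<star> p a \<one>\<^bsub>H\<^esub>) = a \<odot>\<^bsub>base_change K A_op H\<^esub> untwist t"
proof (rule AH.tensor_hom_eqI[OF mod_hom_compose[OF smash_mult_left_linear untwist_linear]
      mod_hom_compose[OF untwist_linear base_change_op_smult(1)[OF a]] _ t])
  note P = mods(1)
  show "p a \<one>\<^bsub>H\<^esub> \<in> carrier T" using a by (intro closed_facts)
  fix b h assume b: "b \<in> carrier A" and h: "h \<in> carrier H"
  have "untwist (p b h \<star> p a \<one>\<^bsub>H\<^esub>) = untwist (sw T (\<lambda>x y. p (b \<otimes>\<^bsub>A\<^esub> act x a) (y \<otimes>\<^bsub>H\<^esub> \<one>\<^bsub>H\<^esub>)) h)"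
    by (simp add: smash_mult_pure a b h)
  also have "\<dots> = sw T (\<lambda>x y. untwist (p (b \<otimes>\<^bsub>A\<^esub> act x a) (y \<otimes>\<^bsub>H\<^esub> \<one>\<^bsub>H\<^esub>))) h"
    using a b h by (intro H.hom_sweedler[OF P P _ untwist_linear] multilin)
  also have "\<dots> = sw T (\<lambda>x y. sw T (\<lambda>u v. p (act (S u) (b \<otimes>\<^bsub>A\<^esub> act x a)) v) y) h"
  proof (rule H.sweedler_cong[OF P _ h])
    show "bilinear_map K H H T (\<lambda>x y. sw T (\<lambda>u v. p (act (S u) (b \<otimes>\<^bsub>A\<^esub> act x a)) v) y)"
      using a b by (intro multilin)
  qed (simp add: untwist_pure closed_facts a b)
  also have "\<dots> = sw T (\<lambda>x y. sw T (\<lambda>u v. p (act (S v) (b \<otimes>\<^bsub>A\<^esub> act u a)) y) x) h"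
    by (rule H.sweedler_coassoc[OF P h, symmetric]) (insert a b, intro multilin; assumption)+
  also have "\<dots> = sw T (\<lambda>x y. a \<odot>\<^bsub>base_change K A_op H\<^esub> p (act (S x) b) y) h"
  proof (rule H.sweedler_cong[OF P _ h])
    show "bilinear_map K H H T (\<lambda>x y. a \<odot>\<^bsub>base_change K A_op H\<^esub> p (act (S x) b) y)"
      using b by (intro bilinear_mapI mod_hom_compose[OF _ base_change_op_smult(1)[OF a]] multilin)
    fix x y assume x: "x \<in> carrier H" and y: "y \<in> carrier H"
    have "sw T (\<lambda>u v. p (act (S v) (b \<otimes>\<^bsub>A\<^esub> act u a)) y) x = sw T (\<lambda>u v. p (act (S u) (b \<otimes>\<^bsub>A\<^esub> act v a)) y) x"
      using a b y by (intro C.sweedler_cocommutative[where \<beta> = "\<lambda>u v. p (act (S u) (b \<otimes>\<^bsub>A\<^esub> act v a)) y", OF P _ x] multilin)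
    also have "\<dots> = p (sw A (\<lambda>u v. act (S u) (b \<otimes>\<^bsub>A\<^esub> act v a)) x) y"
      using a b x y by (intro H.hom_sweedler[where g = "\<lambda>z. p z y", OF A.module P, symmetric] multilin)
    finally show "sw T (\<lambda>u v. p (act (S v) (b \<otimes>\<^bsub>A\<^esub> act u a)) y) x = a \<odot>\<^bsub>base_change K A_op H\<^esub> p (act (S x) b) y"
      using a b x y by (simp add: antipode_act_mult_act base_change_op_smult(2) closed_facts)
  qed
  also have "\<dots> = a \<odot>\<^bsub>base_change K A_op H\<^esub> sw T (\<lambda>x y. p (act (S x) b) y) h"
    using b h by (intro H.hom_sweedler[OF P P _ base_change_op_smult(1)[OF a], symmetric] multilin)
  finally show "untwist (p b h \<star> p a \<one>\<^bsub>H\<^esub>) = a \<odot>\<^bsub>base_change K A_op H\<^esub> untwist (p b h)"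
    by (simp add: untwist_pure b h)
qed

lemma twist_right_linear:
  assumes a: "a \<in> carrier A" and t: "t \<in> carrier T"
  shows "twist (a \<odot>\<^bsub>base_change K A_op H\<^esub> t) = twist t \<star> p a \<one>\<^bsub>H\<^esub>"
proof (rule AH.tensor_hom_eqI[OF mod_hom_compose[OF base_change_op_smult(1)[OF a] twist_linear]
      mod_hom_compose[OF twist_linear smash_mult_left_linear] _ t])
  show "p a \<one>\<^bsub>H\<^esub> \<in> carrier T" using a by (intro closed_facts)
  show "twist (a \<odot>\<^bsub>base_change K A_op H\<^esub> p b h) = twist (p b h) \<star> p a \<one>\<^bsub>H\<^esub>"
    if "b \<in> carrier A" "h \<in> carrier H" for b h
    using that a by (simp add: base_change_op_smult twist_pure closed_facts smash_mult_assoc pure_one_mult_pure)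
qed

lemma twist_smash:
  assumes t: "t \<in> carrier T" shows "twist t \<in> carrier B"
proof -
  have "twist t \<star> e = twist t"
    by (rule AH.tensor_hom_eqI[OF mod_hom_compose[OF twist_linear smash_mult_left_linear[OF e_closed]] twist_linear _ t])
      (simp add: twist_pure closed_facts smash_mult_assoc pure_one_mult_pure)
  then show ?thesis using mod_hom_closed[OF twist_linear t] by (simp add: carrier_smash)
qed

text \<open>On the smash product \<open>twist \<circ> untwist\<close> is the identity, because right
  multiplication with \<open>e\<close> is.\<close>

lemma projective_smash_right:
  assumes "projective_module K H"
  shows "projective_module A_op (module_along \<phi> B_op)"
proof -
  interpret B: unital_algebra K B by (rule unital_algebra_smash)
  interpret A_op: unital_algebra K A_op by (rule A.unital_algebra_opposite)
  interpret B_op: unital_algebra K B_op by (rule B.unital_algebra_opposite)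
  have "\<phi> \<in> ring_hom A_op B_op" using smash_incl_alg_hom alg_hom_opposite[of K A B] by (auto simp: alg_hom_def)
  note lm = left_module_along[OF A_op.A.ring_axioms B_op.A.ring_axioms this]
  have ops: "carrier A_op = carrier A" "carrier B_op = carrier B" "(\<oplus>\<^bsub>B_op\<^esub>) = (\<oplus>\<^bsub>B\<^esub>)"
    "s \<otimes>\<^bsub>B_op\<^esub> t = t \<otimes>\<^bsub>B\<^esub> s" for s t
    by (simp_all add: opposite_algebra_def)
  show ?thesis
  proof (rule projective_module_retract[OF projective_base_change[OF A_op.unital_algebra_axioms H.module assms] lm])
    show "untwist \<in> mod_hom A_op (module_along \<phi> B_op) (base_change K A_op H)"
      by (rule mod_homI)
        (auto simp: ops tensor_opposite_algebra carrier_smash smash_simps smash_incl_eq untwist_right_linear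
          mod_hom_add[OF untwist_linear] mod_hom_closed[OF untwist_linear])
    show "twist \<in> mod_hom A_op (base_change K A_op H) (module_along \<phi> B_op)"
      by (rule mod_homI)
        (auto simp: ops tensor_opposite_algebra smash_simps smash_incl_eq twist_right_linear twist_smash
          mod_hom_add[OF twist_linear])
  qed (simp add: ops carrier_smash twist_untwist)
qed

theorem projective_enveloping_algebra_smash:
  assumes "projective_module K H"
  shows "projective_module (enveloping_algebra K A)
    (module_along (smash_incl_env K H \<Delta> A act) (enveloping_algebra K B))"
proof -
  interpret B: unital_algebra K B by (rule unital_algebra_smash)
  have "tensor_algebras K A A_op" "tensor_algebras K B B_op"
    by (simp_all add: tensor_algebras_def A.unital_algebra_axioms A.unital_algebra_opposite
        B.unital_algebra_axioms B.unital_algebra_opposite)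
  from projective_tensor_algebra[OF this smash_incl_alg_hom _ projective_smash_left[OF assms] projective_smash_right[OF assms]]
  show ?thesis
    using smash_incl_alg_hom alg_hom_opposite[of K A B]
    by (simp add: enveloping_algebra_def smash_incl_env_def Let_def)
qed

end

theorem lemma3p12:
  fixes K :: "'k ring" and H :: "('k, 'h) module" and A :: "('k, 'a) module"
    and \<Delta> :: "'h \<Rightarrow> ('h \<times> 'h \<Rightarrow> 'k) set" and \<epsilon> :: "'h \<Rightarrow> 'k" and S :: "'h \<Rightarrow> 'h"
    and act :: "'h \<Rightarrow> 'a \<Rightarrow> 'a"
  assumes "cring K"
    and "cocommutative_hopf_algebra K H \<Delta> \<epsilon> S"
    and "unital_algebra K A"
    and "symmetric_partial_action K H \<Delta> \<epsilon> S A act"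
    and "projective_module K H"
  shows "projective_module (enveloping_algebra K A)
    (module_along (smash_incl_env K H \<Delta> A act)
      (enveloping_algebra K (partial_smash K H \<Delta> A act)))"
proof -
  interpret cocommutative_partial_action K H \<Delta> \<epsilon> S A act
    using assms(2,4) by (simp add: cocommutative_partial_action_def)
  show ?thesis by (rule projective_enveloping_algebra_smash[OF assms(5)])
qed

end
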